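(* Let $d\in\{1,2,\dots\}$ and $p\in[1,\infty]$. There exist linear maps $J_\infty:\dot{W}^{1,p}\to C^\infty(\mathbb{R}^d)$ and $J_0:\dot{W}^{1,p}\to W^{1,p}(\mathbb{R}^d)$ such that $$[u]=[J_\infty[u]+J_0[u]]\qquad\text{for all }[u]\in\dot{W}^{1,p},$$ and, for all $[u]\in\dot{W}^{1,p}$, $$\|\partial J_\infty[u]\|_{L^p}\le\|\partial u\|_{L^p},\qquad \|\partial J_\infty[u]\|_{L^\infty}\le\|\partial u\|_{L^p},\qquad \|J_0[u]\|_{W^{1,p}}\le C\|\partial u\|_{L^p},$$ where $C=C(d)>0$. Moreover, $J_\infty$ may be chosen to satisfy the following growth conditions at infinity: (i) If $p<d$, then $\dot{W}^{1,p}$ is continuously embedded in $L^{p^*}(\mathbb{R}^d)$, in the sense that for each $[u]\in\dot{W}^{1,p}$ there exists a unique $u_0\in[u]$ such that $u_0\in L^{p^*}(\mathbb{R}^d)$ and $\|u_0\|_{L^{p^*}}\le C\|\partial u_0\|_{L^p}$, where $C$ is a positive constant independent of $u_0$. In particular, $J_\infty[u](x)\to0$ as $|x|\to\infty$, $x\in\mathbb{R}^d$. (ii) If $p>d$, then $|J_\infty[u](x)|\le C\,\|[u]\|_{\dot{W}^{1,p}}\,|x|^{1/p'}$ for all $x\in\mathbb{R}^d$ and all $[u]\in\dot{W}^{1,p}$, with a constant $C$ independent of $[u]$ and $x$. (iii) If $p=d$, then $|J_\infty[u](x)|\le C\,\|[u]\|_{\dot{W}^{1,p}}\,\log(2+|x|)$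 for all $x\in\mathbb{R}^d$ and all $[u]\in\dot{W}^{1,p}$, with a constant $C$ independent of $[u]$ and $x$.
   Context: For a measurable function $u:\mathbb{R}^d\to\mathbb{R}$, let $[u]:=\{u+c \mid c\in\mathbb{R}\}$ be its equivalence class modulo additive constants. $\partial u$ denotes the (distributional) gradient of $u$. Define $\dot{W}^{1,p}:=\{[u] \mid u\in W^{1,p}_{\rm loc}(\mathbb{R}^d),\ \partial u\in L^p(\mathbb{R}^d)\}$, with norm $\|[u]\|_{\dot{W}^{1,p}}:=\|\partial u\|_{L^p(\mathbb{R}^d)}$ for any $u\in[u]$ (independent of the representative). Here $p'=p/(p-1)$ is the conjugate exponent (so $1/p'=1-1/p$), and for $d>1$, $p\in[1,d)$, $p^*$ is the Sobolev conjugate defined by $1/p^*=1/p-1/d$. All norms without a domain are over $\mathbb{R}^d$. *)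

theory Defs
  imports "HOL-Analysis.Analysis" "HOL-Probability.Essential_Supremum"
begin

section \<open>Lebesgue spaces\<close>

text \<open>For vector-valued functions the pointwise norm is the norm of the codomain, so the
  \<open>L\<^sup>p\<close> norm of a gradient uses its Euclidean length. The value is \<open>\<infinity>\<close>
  when the defining integral or essential supremum is infinite.\<close>

definition Lp_norm :: "'a measure \<Rightarrow> ennreal \<Rightarrow> ('a \<Rightarrow> 'b::real_normed_vector) \<Rightarrow> ennreal" where
  "Lp_norm M p f =
    (if p = \<infinity> then esssup M (\<lambda>x. ennreal (norm (f x)))
     else let I = (\<integral>\<^sup>+x. ennreal (norm (f x) powr enn2real p) \<partial>M)
          in if I = \<infinity> then \<infinity> else ennreal (enn2real I powr (1 / enn2real p)))"

definition Lp_space :: "'a measure \<Rightarrow> ennreal \<Rightarrow> ('a \<Rightarrow> 'b::real_normed_vector) set" where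
  "Lp_space M p = {f \<in> borel_measurable M. Lp_norm M p f < \<infinity>}"

definition Lp_loc :: "ennreal \<Rightarrow> ('a::euclidean_space \<Rightarrow> 'b::real_normed_vector) set" where
  "Lp_loc p = {f. \<forall>K. compact K \<longrightarrow> f \<in> Lp_space (lebesgue_on K) p}"

definition conj_exp :: "ennreal \<Rightarrow> ennreal" where
  "conj_exp p = inverse (1 - inverse p)"

text \<open>Meaningful for \<open>1 \<le> p < d\<close> only.\<close>

definition sobolev_conj :: "nat \<Rightarrow> ennreal \<Rightarrow> ennreal" where
  "sobolev_conj d p = inverse (inverse p - inverse (of_nat d))"

section \<open>Smooth functions and weak gradients\<close>

abbreviation partial_deriv :: "'a::euclidean_space \<Rightarrow> ('a \<Rightarrow> real) \<Rightarrow> 'a \<Rightarrow> real" where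
  "partial_deriv i f x \<equiv> frechet_derivative f (at x) i"

primrec Ck :: "nat \<Rightarrow> ('a::euclidean_space \<Rightarrow> real) \<Rightarrow> bool" where
  "Ck 0 f = continuous_on UNIV f"
| "Ck (Suc k) f = ((\<forall>x. f differentiable (at x)) \<and> (\<forall>i\<in>Basis. Ck k (partial_deriv i f)))"

definition C_inf :: "('a::euclidean_space \<Rightarrow> real) set" where
  "C_inf = {f. \<forall>k. Ck k f}"

definition test_fun :: "('a::euclidean_space \<Rightarrow> real) set" where
  "test_fun = {\<phi> \<in> C_inf. compact (closure {x. \<phi> x \<noteq> 0})}"

definition has_weak_gradient :: "('a::euclidean_space \<Rightarrow> real) \<Rightarrow> ('a \<Rightarrow> 'a) \<Rightarrow> bool" where
  "has_weak_gradient u g \<longleftrightarrow>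
     (\<forall>K. compact K \<longrightarrow> u absolutely_integrable_on K) \<and>
     (\<forall>K. compact K \<longrightarrow> g absolutely_integrable_on K) \<and>
     (\<forall>\<phi>\<in>test_fun. \<forall>i\<in>Basis.
        (LINT x|lebesgue. u x * partial_deriv i \<phi> x) = - (LINT x|lebesgue. (g x \<bullet> i) * \<phi> x))"

text \<open>A weak gradient is unique up to null sets. The choice below is meaningful whenever a
  locally integrable weak gradient exists, for instance for \<open>C\<^sup>1\<close> functions, where it is
  almost everywhere the classical gradient.\<close>

definition weak_grad :: "('a::euclidean_space \<Rightarrow> real) \<Rightarrow> 'a \<Rightarrow> 'a" where
  "weak_grad u = (SOME g. has_weak_gradient u g)"

section \<open>Sobolev spaces\<close>

text \<open>Elements of these spaces are functions; as usual they represent their classes modulo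
  almost everywhere equality.\<close>

definition W1p :: "ennreal \<Rightarrow> ('a::euclidean_space \<Rightarrow> real) set" where
  "W1p p = {u. (\<exists>g. has_weak_gradient u g) \<and>
     u \<in> Lp_space lebesgue p \<and> weak_grad u \<in> Lp_space lebesgue p}"

definition W1p_norm :: "ennreal \<Rightarrow> ('a::euclidean_space \<Rightarrow> real) \<Rightarrow> ennreal" where
  "W1p_norm p u = Lp_norm lebesgue p u + Lp_norm lebesgue p (weak_grad u)"

definition W1p_loc :: "ennreal \<Rightarrow> ('a::euclidean_space \<Rightarrow> real) set" where
  "W1p_loc p = {u. (\<exists>g. has_weak_gradient u g) \<and> u \<in> Lp_loc p \<and> weak_grad u \<in> Lp_loc p}"

text \<open>The class of \<open>u\<close> modulo additive constants, where functions that agree almost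
  everywhere are identified.\<close>

definition const_class :: "('a::euclidean_space \<Rightarrow> real) \<Rightarrow> ('a \<Rightarrow> real) set" where
  "const_class u = {v \<in> borel_measurable lebesgue. \<exists>c. AE x in lebesgue. v x = u x + c}"

definition Wdot :: "ennreal \<Rightarrow> ('a::euclidean_space \<Rightarrow> real) set set" where
  "Wdot p = {const_class u | u. u \<in> W1p_loc p \<and> weak_grad u \<in> Lp_space lebesgue p}"

text \<open>The value does not depend on the representative: all members of a class have the same
  weak gradients.\<close>

definition Wdot_norm :: "ennreal \<Rightarrow> ('a::euclidean_space \<Rightarrow> real) set \<Rightarrow> ennreal" where
  "Wdot_norm p U = Lp_norm lebesgue p (weak_grad (SOME u. u \<in> U))"

text \<open>The vector space operations of the quotient are those of representatives. The first
  predicate is linearity of a map into a space of genuine functions, the second one of a map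
  into a space of functions modulo almost everywhere equality.\<close>

definition linear_Wdot :: "ennreal \<Rightarrow> (('a::euclidean_space \<Rightarrow> real) set \<Rightarrow> 'a \<Rightarrow> real) \<Rightarrow> bool" where
  "linear_Wdot p J \<longleftrightarrow>
     (\<forall>u v a b. const_class u \<in> Wdot p \<longrightarrow> const_class v \<in> Wdot p \<longrightarrow>
        (\<forall>x. J (const_class (\<lambda>y. a * u y + b * v y)) x
               = a * J (const_class u) x + b * J (const_class v) x))"

definition linear_Wdot_AE :: "ennreal \<Rightarrow> (('a::euclidean_space \<Rightarrow> real) set \<Rightarrow> 'a \<Rightarrow> real) \<Rightarrow> bool" where
  "linear_Wdot_AE p J \<longleftrightarrow>
     (\<forall>u v a b. const_class u \<in> Wdot p \<longrightarrow> const_class v \<in> Wdot p \<longrightarrow>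
        (AE x in lebesgue. J (const_class (\<lambda>y. a * u y + b * v y)) x
               = a * J (const_class u) x + b * J (const_class v) x))"

end

(* Fix a smooth probability density \<phi> \<le> 1 with support in a ball of radius R and let
   A_s u (x) be the average of u (x - s y) with respect to \<phi> (y) dy. Then J_inf u is A_1 u minus a
   constant and J_0 u = u - A_1 u. Writing differences as integrals of the gradient along segments,
   Jensen's inequality and Tonelli's theorem bound u - A_s u in L^p by s R times the norm N of the
   gradient. Since \<phi> \<le> 1, an average at scale s of the gradient is at most s^(-d/p) N pointwise, so
   |A_S v - A_r v| is at most R N times the integral of s^(-d/p) over [r, S]. For p \<ge> d this gives the
   growth bounds directly.
   For p < d it shows that the averages converge to a constant k at infinity and that A_r (v - k) is
   O(r^(1-d/p)); choosing r optimally gives a weak type Sobolev bound, which applied to the truncations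
   of v - k at dyadic levels becomes the strong one (Maz'ya's truncation argument). *)
theory Submission
  imports Defs "HOL-Probability.Probability"
begin

section \<open>Smooth functions and test functions\<close>

text \<open>The constant in the bound on J_0 may depend on the dimension only, so the density is
  fixed before p is known; \<open>rexp\<close>, which is 1/p with value 0 at p = \<infinity>, lets
  all exponents share one set of estimates. The maps act on classes, so the constant subtracted from
  A_1 u has to be linear in u, shift with u and ignore null sets. For p < d it is the limit of the
  averages at the origin over growing scales, since J_inf must vanish at infinity. For p \<ge> d it
  is A_1 u (0); when p > d, the growth bound at x = 0 forces J_inf [u] (0) = 0. A weak gradient
  cannot be integrated along individual segments, so that step is carried out by duality, against
  test functions. The finer estimates are then proved for mollified, hence C^1, functions. For the
  same reason the truncation is C^1 rather than piecewise linear: its gradient obeys the pointwise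
  chain rule. Fatou's lemma along the mollifications returns to u; this works because u and all A_e
  u share the same constant at infinity.\<close>

lemma has_derivative_imp_frechet:
  "(f has_derivative D) (at x) \<Longrightarrow> frechet_derivative f (at x) = D"
  using frechet_derivative_at by metis

lemma Ck_SucI:
  assumes "\<And>x. (f has_derivative D x) (at x)" "\<And>i. i \<in> Basis \<Longrightarrow> Ck k (\<lambda>x. D x i)"
  shows "Ck (Suc k) f"
  using assms by (auto simp: has_derivative_imp_frechet[OF assms(1)] differentiable_def)

lemma Ck_imp_continuous: "Ck k f \<Longrightarrow> continuous_on UNIV f"
  by (cases k) (auto simp: differentiable_imp_continuous_within continuous_on_eq_continuous_at)

lemma Ck_SucD: "Ck (Suc k) f \<Longrightarrow> Ck k f"
proof (induction k arbitrary: f)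
  case 0
  then show ?case using Ck_imp_continuous[OF 0] by simp
next
  case (Suc k)
  then show ?case by (subst Ck.simps(2), subst (asm) Ck.simps(2)) blast
qed

lemma Ck_Suc_has_derivative:
  "Ck (Suc k) f \<Longrightarrow> (f has_derivative frechet_derivative f (at x)) (at x)"
  by (simp add: frechet_derivative_works[symmetric])

lemma Ck_const [simp]: "Ck k (\<lambda>_. c)"
proof (induction k arbitrary: c)
  case (Suc k)
  show ?case by (rule Ck_SucI[of _ "\<lambda>_ _. 0"]) (auto simp: Suc)
qed auto

lemma Ck_add: "Ck k f \<Longrightarrow> Ck k g \<Longrightarrow> Ck k (\<lambda>x. f x + g x)"
proof (induction k arbitrary: f g)
  case 0
  then show ?case by (auto intro!: continuous_intros)
next
  case (Suc k)
  show ?case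
  proof (rule Ck_SucI)
    show "((\<lambda>x. f x + g x) has_derivative
      (\<lambda>h. frechet_derivative f (at x) h + frechet_derivative g (at x) h)) (at x)" for x
      by (intro has_derivative_add Ck_Suc_has_derivative[OF Suc.prems(1)] Ck_Suc_has_derivative[OF Suc.prems(2)])
    show "Ck k (\<lambda>x. partial_deriv i f x + partial_deriv i g x)" if "i \<in> Basis" for i
      using Suc that by auto
  qed
qed

lemma Ck_mult: "Ck k f \<Longrightarrow> Ck k g \<Longrightarrow> Ck k (\<lambda>x. f x * g x)"
proof (induction k arbitrary: f g)
  case 0
  then show ?case by (auto intro!: continuous_intros)
next
  case (Suc k)
  show ?case
  proof (rule Ck_SucI)
    show "((\<lambda>x. f x * g x) has_derivative
      (\<lambda>h. f x * frechet_derivative g (at x) h + frechet_derivative f (at x) h * g x)) (at x)" for x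
      by (intro has_derivative_mult Ck_Suc_has_derivative[OF Suc.prems(1)] Ck_Suc_has_derivative[OF Suc.prems(2)])
    show "Ck k (\<lambda>x. f x * partial_deriv i g x + partial_deriv i f x * g x)" if "i \<in> Basis" for i
      using Suc.prems Suc.prems[THEN Ck_SucD] that by (intro Ck_add Suc.IH) auto
  qed
qed

lemma Ck_prod: "finite I \<Longrightarrow> (\<And>i. i \<in> I \<Longrightarrow> Ck k (f i)) \<Longrightarrow> Ck k (\<lambda>x. \<Prod>i\<in>I. f i x)"
  by (induction rule: finite_induct) (auto intro: Ck_mult)

lemma has_derivative_compose_affine:
  fixes f :: "'a::real_normed_vector \<Rightarrow> 'b::real_normed_vector"
  assumes "(f has_derivative D) (at (c *\<^sub>R x + b))"
  shows "((\<lambda>x. f (c *\<^sub>R x + b)) has_derivative (\<lambda>h. D (c *\<^sub>R h))) (at x)"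
  by (rule has_derivative_compose[of "\<lambda>x. c *\<^sub>R x + b" "\<lambda>h. c *\<^sub>R h" x UNIV f D, simplified])
     (use assms in \<open>auto intro!: derivative_eq_intros\<close>)

lemma has_derivative_affine_Ck:
  assumes "Ck (Suc k) f"
  shows "((\<lambda>x. f (c *\<^sub>R x + b)) has_derivative (\<lambda>h. c * frechet_derivative f (at (c *\<^sub>R x + b)) h)) (at x)"
proof -
  note D = Ck_Suc_has_derivative[OF assms, of "c *\<^sub>R x + b"]
  have "frechet_derivative f (at (c *\<^sub>R x + b)) (c *\<^sub>R h) = c * frechet_derivative f (at (c *\<^sub>R x + b)) h" for h
    using linear_scale[OF has_derivative_linear[OF D]] by simp
  with has_derivative_compose_affine[OF D] show ?thesis by simp
qed

text \<open>One affine form c x + b serves the reflections z -> x - z in convolutions, the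
  translations of test functions and the dilations of the mollifier.\<close>

lemma Ck_affine: "Ck k f \<Longrightarrow> Ck k (\<lambda>x. f (c *\<^sub>R x + b))"
proof (induction k arbitrary: f)
  case 0
  then show ?case by (auto intro!: continuous_intros continuous_on_compose2[of UNIV f])
next
  case (Suc k)
  show ?case
  proof (rule Ck_SucI)
    show "((\<lambda>x. f (c *\<^sub>R x + b)) has_derivative (\<lambda>h. c * frechet_derivative f (at (c *\<^sub>R x + b)) h)) (at x)" for x
      by (rule has_derivative_affine_Ck[OF Suc.prems])
    show "Ck k (\<lambda>x. c * partial_deriv i f (c *\<^sub>R x + b))" if "i \<in> Basis" for i
      using Suc.prems that by (intro Ck_mult Ck_const Suc.IH) auto
  qed
qed

section \<open>Smooth functions P(1/t) exp(-1/t), flat at the origin\<close>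

definition flat :: "real poly \<Rightarrow> real \<Rightarrow> real" where
  "flat P t = (if t > 0 then poly P (inverse t) * exp (- inverse t) else 0)"

lemma poly_exp_tendsto_0: "((\<lambda>s. poly P s * exp (- s)) \<longlongrightarrow> (0::real)) at_top"
proof -
  have "((\<lambda>s. \<Sum>i\<le>degree P. coeff P i * (s ^ i / exp s)) \<longlongrightarrow> (\<Sum>i\<le>degree P. coeff P i * 0)) at_top"
    by (intro tendsto_sum tendsto_mult tendsto_const tendsto_power_div_exp_0)
  then show ?thesis
    by (simp add: poly_altdef sum_distrib_right exp_minus field_simps sum_divide_distrib)
qed

lemma flat_tendsto_0: "((\<lambda>h. poly P (inverse h) * exp (- inverse h)) \<longlongrightarrow> (0::real)) (at_right 0)"
  using filterlim_compose[OF poly_exp_tendsto_0 filterlim_inverse_at_top_right] .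

text \<open>Differentiating P(1/t) exp(-1/t) gives t^(-2) (P - P')(1/t) exp(-1/t), which has the
  same form with the polynomial X^2 (P - P'). The polynomial parameter thus closes the family under
  differentiation, and \<open>Ck_flat\<close> becomes an induction over k with P arbitrary.\<close>

lemma flat_has_derivative:
  "(flat P has_real_derivative flat ([:0, 0, 1:] * (P - pderiv P)) t) (at t)"
proof -
  consider "t > 0" | "t < 0" | "t = 0" by linarith
  then show ?thesis
  proof cases
    case 1
    have "((\<lambda>t. poly P (inverse t) * exp (- inverse t)) has_real_derivative
        flat ([:0, 0, 1:] * (P - pderiv P)) t) (at t)"
      using 1 by (auto intro!: derivative_eq_intros simp: flat_def field_simps power2_eq_square)
    then show ?thesis
      by (rule has_field_derivative_transform_within_open[where S="{0<..}"]) (use 1 in \<open>auto simp: flat_def\<close>)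
  next
    case 2
    have "((\<lambda>t. 0) has_real_derivative flat ([:0, 0, 1:] * (P - pderiv P)) t) (at t)"
      using 2 by (auto simp: flat_def)
    then show ?thesis
      by (rule has_field_derivative_transform_within_open[where S="{..<0}"]) (use 2 in \<open>auto simp: flat_def\<close>)
  next
    case 3
    have "((\<lambda>h. flat P h / h) \<longlongrightarrow> 0) (at 0)"
    proof (subst filterlim_at_split, intro conjI)
      show "((\<lambda>h. flat P h / h) \<longlongrightarrow> 0) (at_left 0)"
        by (rule tendsto_eventually) (auto simp: flat_def eventually_at_filter)
      \<comment> \<open>The factor 1/h of the difference quotient at 0 is absorbed into the
        polynomial X P.\<close>
      have "((\<lambda>h. poly ([:0, 1:] * P) (inverse h) * exp (- inverse h)) \<longlongrightarrow> 0) (at_right 0)"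
        by (rule flat_tendsto_0)
      then show "((\<lambda>h. flat P h / h) \<longlongrightarrow> 0) (at_right 0)"
        by (rule Lim_transform_eventually) (auto simp: flat_def eventually_at_filter field_simps)
    qed
    then show ?thesis using 3 by (simp add: DERIV_def flat_def)
  qed
qed

lemma Ck_flat: "Ck k (\<lambda>x. flat P (c * (x \<bullet> i) + a))"
proof (induction k arbitrary: P)
  case 0
  have "isCont (flat P) t" for t
    using DERIV_isCont flat_has_derivative by blast
  then have "continuous_on UNIV (flat P)" by (simp add: continuous_at_imp_continuous_on)
  then show ?case by (auto intro!: continuous_intros continuous_on_compose2[of UNIV "flat P"])
next
  case (Suc k)
  define Q where "Q = [:0, 0, 1:] * (P - pderiv P)"
  show ?case
  proof (rule Ck_SucI)
    show "((\<lambda>x. flat P (c * (x \<bullet> i) + a)) has_derivative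
        (\<lambda>h. flat Q (c * (x \<bullet> i) + a) * (c * (h \<bullet> i)))) (at x)" for x
      unfolding Q_def
      by (rule has_derivative_compose[of "\<lambda>x. c * (x \<bullet> i) + a" "\<lambda>h. c * (h \<bullet> i)" x UNIV "flat P"])
         (auto intro!: derivative_eq_intros flat_has_derivative[unfolded has_field_derivative_def] simp del: mult_pCons_left)
    show "Ck k (\<lambda>x. flat Q (c * (x \<bullet> i) + a) * (c * (j \<bullet> i)))" for j
      by (intro Ck_mult Suc Ck_const)
  qed
qed

lemma test_funD_Ck: "\<phi> \<in> test_fun \<Longrightarrow> Ck k \<phi>"
  by (auto simp: test_fun_def C_inf_def)

lemma test_fun_continuous: "\<phi> \<in> test_fun \<Longrightarrow> continuous_on UNIV \<phi>"
  using test_funD_Ck[of \<phi> 0] by simp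

lemma test_fun_has_derivative:
  "\<phi> \<in> test_fun \<Longrightarrow> (\<phi> has_derivative frechet_derivative \<phi> (at x)) (at x)"
  using Ck_Suc_has_derivative test_funD_Ck by blast

lemma test_funI:
  fixes \<phi> :: "'a::euclidean_space \<Rightarrow> real"
  assumes "\<And>k. Ck k \<phi>" "\<And>x. \<rho> < norm x \<Longrightarrow> \<phi> x = 0"
  shows "\<phi> \<in> test_fun"
proof -
  have "{x. \<phi> x \<noteq> 0} \<subseteq> cball 0 \<rho>" using assms(2) by (auto simp: not_less[symmetric])
  then have "bounded {x. \<phi> x \<noteq> 0}" using bounded_cball bounded_subset by blast
  then show ?thesis using assms(1) by (auto simp: test_fun_def C_inf_def compact_eq_bounded_closed)
qed

lemma test_fun_support:
  assumes "\<phi> \<in> test_fun"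
  obtains \<rho> where "\<rho> > 0" "\<And>x. \<rho> < norm x \<Longrightarrow> \<phi> x = 0"
proof -
  have "bounded (closure {x. \<phi> x \<noteq> 0})" using assms by (auto simp: test_fun_def compact_imp_bounded)
  then obtain \<rho> where "\<rho> > 0" "\<And>x. x \<in> closure {x. \<phi> x \<noteq> 0} \<Longrightarrow> norm x \<le> \<rho>"
    by (auto simp: bounded_pos)
  then show ?thesis using that[of \<rho>] closure_subset[of "{x. \<phi> x \<noteq> 0}"] by force
qed

lemma partial_deriv_eq_0:
  fixes \<phi> :: "'a::euclidean_space \<Rightarrow> real"
  assumes "\<And>x. \<rho> < norm x \<Longrightarrow> \<phi> x = 0" "\<rho> < norm x"
  shows "partial_deriv i \<phi> x = 0"
proof -
  have "(\<phi> has_derivative (\<lambda>_. 0)) (at x)"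
    by (rule has_derivative_transform_within_open[OF has_derivative_const[of 0], where s="- cball 0 \<rho>"])
       (use assms in \<open>auto simp: open_Compl\<close>)
  from has_derivative_imp_frechet[OF this] show ?thesis by simp
qed

lemma test_fun_partial_deriv:
  assumes "\<phi> \<in> test_fun" "i \<in> Basis"
  shows "partial_deriv i \<phi> \<in> test_fun"
proof -
  obtain \<rho> where "\<And>x. \<rho> < norm x \<Longrightarrow> \<phi> x = 0" using test_fun_support[OF assms(1)] by metis
  moreover have "Ck k (partial_deriv i \<phi>)" for k
    using test_funD_Ck[OF assms(1), of "Suc k"] assms(2) by simp
  ultimately show ?thesis by (intro test_funI[of _ \<rho>] partial_deriv_eq_0)
qed

lemma test_fun_affine:
  fixes \<phi> :: "'a::euclidean_space \<Rightarrow> real"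
  assumes "\<phi> \<in> test_fun" "c \<noteq> 0"
  shows "(\<lambda>x. a * \<phi> (c *\<^sub>R x + b)) \<in> test_fun"
proof -
  obtain \<rho> where \<rho>: "\<And>x. \<rho> < norm x \<Longrightarrow> \<phi> x = 0" using test_fun_support[OF assms(1)] by metis
  show ?thesis
  proof (rule test_funI[of _ "(\<rho> + norm b) / \<bar>c\<bar>"])
    show "Ck k (\<lambda>x. a * \<phi> (c *\<^sub>R x + b))" for k
      using test_funD_Ck[OF assms(1)] by (intro Ck_mult Ck_const Ck_affine)
    fix x :: 'a assume "(\<rho> + norm b) / \<bar>c\<bar> < norm x"
    then have "\<rho> + norm b < norm (c *\<^sub>R x)" using assms(2) by (simp add: field_simps)
    then have "\<rho> < norm (c *\<^sub>R x + b)" using norm_triangle_ineq4[of "c *\<^sub>R x + b" b] by simp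
    then show "a * \<phi> (c *\<^sub>R x + b) = 0" using \<rho> by simp
  qed
qed

lemma partial_deriv_affine:
  assumes "\<phi> \<in> test_fun"
  shows "partial_deriv i (\<lambda>x. a * \<phi> (c *\<^sub>R x + b)) x = a * c * partial_deriv i \<phi> (c *\<^sub>R x + b)"
proof -
  have "((\<lambda>x. a * \<phi> (c *\<^sub>R x + b)) has_derivative
      (\<lambda>h. a * (c * frechet_derivative \<phi> (at (c *\<^sub>R x + b)) h))) (at x)"
    by (intro has_derivative_mult_right has_derivative_affine_Ck[where k=0] test_funD_Ck assms)
  from has_derivative_imp_frechet[OF this] show ?thesis by simp
qed

lemma test_fun_bounded:
  assumes "\<phi> \<in> test_fun"
  obtains B where "B > 0" "\<And>x. \<bar>\<phi> x\<bar> \<le> B"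
proof -
  obtain \<rho> where \<rho>: "\<rho> > 0" "\<And>x. \<rho> < norm x \<Longrightarrow> \<phi> x = 0" using test_fun_support[OF assms] by metis
  have "compact (\<phi> ` cball 0 \<rho>)"
    by (intro compact_continuous_image compact_cball) (use test_fun_continuous[OF assms] continuous_on_subset in blast)
  then obtain B where B: "B > 0" "\<And>x. x \<in> cball 0 \<rho> \<Longrightarrow> \<bar>\<phi> x\<bar> \<le> B"
    by (auto dest!: compact_imp_bounded simp: bounded_pos)
  have "\<bar>\<phi> x\<bar> \<le> B" for x using B \<rho>(2)[of x] by (cases "x \<in> cball 0 \<rho>") auto
  with B(1) that show ?thesis by blast
qed

definition grad :: "('a::euclidean_space \<Rightarrow> real) \<Rightarrow> 'a \<Rightarrow> 'a" where
  "grad \<phi> x = (\<Sum>i\<in>Basis. partial_deriv i \<phi> x *\<^sub>R i)"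

lemma frechet_derivative_eq_grad:
  assumes "\<phi> differentiable (at x)"
  shows "frechet_derivative \<phi> (at x) h = grad \<phi> x \<bullet> h"
proof -
  have "linear (frechet_derivative \<phi> (at x))"
    using assms linear_frechet_derivative by blast
  then have "frechet_derivative \<phi> (at x) (\<Sum>i\<in>Basis. (h \<bullet> i) *\<^sub>R i) = (\<Sum>i\<in>Basis. (h \<bullet> i) * partial_deriv i \<phi> x)"
    by (simp add: linear_sum linear_scale)
  then show ?thesis
    by (simp add: euclidean_representation grad_def inner_sum_left inner_sum_right inner_commute[of _ h] mult.commute)
qed

lemma test_fun_grad:
  assumes "\<phi> \<in> test_fun"
  shows "(\<phi> has_derivative (\<lambda>h. grad \<phi> x \<bullet> h)) (at x)"
proof -
  have "\<phi> differentiable (at x)" using test_fun_has_derivative[OF assms] differentiableI by blast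
  from frechet_derivative_eq_grad[OF this] have "frechet_derivative \<phi> (at x) = (\<lambda>h. grad \<phi> x \<bullet> h)" by auto
  then show ?thesis using test_fun_has_derivative[OF assms, of x] by simp
qed

lemma grad_continuous:
  assumes "\<phi> \<in> test_fun"
  shows "continuous_on UNIV (grad \<phi>)"
  unfolding grad_def
  by (intro continuous_intros test_fun_continuous test_fun_partial_deriv assms)

lemma grad_eq_0:
  assumes "\<And>x. \<rho> < norm x \<Longrightarrow> \<phi> x = 0" "\<rho> < norm x"
  shows "grad \<phi> x = 0"
  using partial_deriv_eq_0[OF assms] by (simp add: grad_def)

lemma test_fun_grad_bounded:
  assumes "\<phi> \<in> test_fun"
  obtains B where "B > 0" "\<And>x. norm (grad \<phi> x) \<le> B"
proof -
  obtain \<rho> where \<rho>: "\<rho> > 0" "\<And>x. \<rho> < norm x \<Longrightarrow> \<phi> x = 0" using test_fun_support[OF assms] by metis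
  have "compact (grad \<phi> ` cball 0 \<rho>)"
    by (intro compact_continuous_image compact_cball) (use grad_continuous[OF assms] continuous_on_subset in blast)
  then obtain B where B: "B > 0" "\<And>x. x \<in> cball 0 \<rho> \<Longrightarrow> norm (grad \<phi> x) \<le> B"
    by (auto dest!: compact_imp_bounded simp: bounded_pos)
  have "norm (grad \<phi> x) \<le> B" for x
    using B grad_eq_0[of \<rho> \<phi> x] \<rho>(2) by (cases "x \<in> cball 0 \<rho>") auto
  with B(1) that show ?thesis by blast
qed

lemma uniformly_continuous_compact_support:
  fixes f :: "'a::euclidean_space \<Rightarrow> 'b::real_normed_vector"
  assumes "continuous_on UNIV f" "\<And>x. \<rho> < norm x \<Longrightarrow> f x = 0"
  shows "uniformly_continuous_on UNIV f"
  unfolding uniformly_continuous_on_def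
proof (intro allI impI)
  fix e :: real assume e: "e > 0"
  \<comment> \<open>Two points at distance below 1 either both lie in this enlarged ball or both lie
    outside the ball of radius \<rho>, where f vanishes.\<close>
  have "uniformly_continuous_on (cball 0 (\<rho> + 1)) f"
    by (rule compact_uniformly_continuous[OF _ compact_cball]) (use assms continuous_on_subset in blast)
  then obtain d where d: "d > 0" "\<And>x y. x \<in> cball 0 (\<rho> + 1) \<Longrightarrow> y \<in> cball 0 (\<rho> + 1) \<Longrightarrow> dist y x < d \<Longrightarrow> dist (f y) (f x) < e"
    using e unfolding uniformly_continuous_on_def by metis
  show "\<exists>d>0. \<forall>x\<in>UNIV. \<forall>x'\<in>UNIV. dist x' x < d \<longrightarrow> dist (f x') (f x) < e"
  proof (intro exI[of _ "min d 1"] conjI ballI impI)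
    fix x y :: 'a assume xy: "dist y x < min d 1"
    have n: "norm y \<le> norm x + 1" "norm x \<le> norm y + 1"
      using xy norm_triangle_ineq2[of y x] norm_triangle_ineq2[of x y] by (auto simp: dist_norm norm_minus_commute)
    show "dist (f y) (f x) < e"
    proof (cases "norm x \<le> \<rho> \<or> norm y \<le> \<rho>")
      case True
      then show ?thesis using xy n by (intro d(2)) auto
    qed (use assms(2) e in auto)
  qed (use d in auto)
qed

text \<open>The distance d does not depend on the base point, because \<open>grad \<phi>\<close> is
  uniformly continuous and the mean value theorem turns this into a uniform remainder. The
  uniformity permits differentiation under the integral against a merely locally integrable
  function.\<close>

lemma grad_uniform_linearization:
  assumes "\<phi> \<in> test_fun" "e > 0"
  obtains d where "d > 0" "\<And>a h. norm h < d \<Longrightarrow> \<bar>\<phi> (a + h) - \<phi> a - grad \<phi> a \<bullet> h\<bar> \<le> e * norm h"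
proof -
  obtain \<rho> where \<rho>: "\<rho> > 0" "\<And>x. \<rho> < norm x \<Longrightarrow> \<phi> x = 0" using test_fun_support[OF assms(1)] by metis
  have "uniformly_continuous_on UNIV (grad \<phi>)"
    by (rule uniformly_continuous_compact_support[OF grad_continuous[OF assms(1)]])
       (rule grad_eq_0[of \<rho>], use \<rho> in auto)
  then obtain d where d: "d > 0" "\<And>x y. dist y x < d \<Longrightarrow> dist (grad \<phi> y) (grad \<phi> x) < e"
    using assms(2) unfolding uniformly_continuous_on_def by (metis UNIV_I)
  show ?thesis
  proof (rule that[OF d(1)])
    fix a h :: 'a assume h: "norm h < d"
    have "\<exists>t::real. 0 < t \<and> t < 1 \<and> \<phi> (a + 1 *\<^sub>R h) - \<phi> (a + 0 *\<^sub>R h) = (1 - 0) * (grad \<phi> (a + t *\<^sub>R h) \<bullet> h)"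
    proof (rule MVT2)
      fix t :: real
      have "((\<lambda>t. \<phi> (a + t *\<^sub>R h)) has_derivative (\<lambda>s. grad \<phi> (a + t *\<^sub>R h) \<bullet> (s *\<^sub>R h))) (at t)"
        by (rule has_derivative_compose[of "\<lambda>t. a + t *\<^sub>R h" "\<lambda>s. s *\<^sub>R h" t UNIV \<phi>, simplified])
           (auto intro!: derivative_eq_intros test_fun_grad assms)
      then show "((\<lambda>t. \<phi> (a + t *\<^sub>R h)) has_real_derivative grad \<phi> (a + t *\<^sub>R h) \<bullet> h) (at t)"
        by (simp add: has_field_derivative_def mult_commute_abs)
    qed auto
    then obtain t where t: "0 < t" "t < 1" "\<phi> (a + h) - \<phi> a = grad \<phi> (a + t *\<^sub>R h) \<bullet> h" by auto
    have "norm (t *\<^sub>R h) < d" using t h by (simp add: mult_less_le_imp_less order_le_less_trans[OF mult_left_le_one_le])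
    then have "norm (grad \<phi> (a + t *\<^sub>R h) - grad \<phi> a) < e" using d(2)[of "a + t *\<^sub>R h" a] by (simp add: dist_norm)
    moreover have "\<bar>\<phi> (a + h) - \<phi> a - grad \<phi> a \<bullet> h\<bar> \<le> norm (grad \<phi> (a + t *\<^sub>R h) - grad \<phi> a) * norm h"
      unfolding t(3) inner_diff_left[symmetric] by (rule Cauchy_Schwarz_ineq2)
    ultimately show "\<bar>\<phi> (a + h) - \<phi> a - grad \<phi> a \<bullet> h\<bar> \<le> e * norm h"
      by (smt (verit) mult_right_mono norm_ge_zero)
  qed
qed

section \<open>Smooth bumps supported on boxes\<close>

definition box_bump :: "real \<Rightarrow> 'a::euclidean_space \<Rightarrow> 'a \<Rightarrow> 'a \<Rightarrow> real" where
  "box_bump c a b x = (\<Prod>i\<in>Basis. flat 1 (c * (x \<bullet> i) + c * - (a \<bullet> i)) * flat 1 (- c * (x \<bullet> i) + c * (b \<bullet> i)))"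

lemma flat_1: "0 \<le> flat 1 t" "flat 1 t \<le> 1" "flat 1 t = 0 \<longleftrightarrow> t \<le> 0"
  by (auto simp: flat_def)

lemma box_bump_nonneg: "0 \<le> box_bump c a b x"
  by (auto simp: box_bump_def flat_1 intro!: prod_nonneg)

lemma box_bump_le_1: "box_bump c a b x \<le> 1"
  unfolding box_bump_def by (intro prod_le_1 conjI mult_nonneg_nonneg mult_le_one flat_1)

lemma box_bump_eq_0_iff: "c > 0 \<Longrightarrow> box_bump c a b x = 0 \<longleftrightarrow> x \<notin> box a b"
proof -
  assume c: "c > 0"
  have "c * (x \<bullet> i) + c * - (a \<bullet> i) \<le> 0 \<longleftrightarrow> x \<bullet> i \<le> a \<bullet> i" "- c * (x \<bullet> i) + c * (b \<bullet> i) \<le> 0 \<longleftrightarrow> b \<bullet> i \<le> x \<bullet> i" for i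
    using c by auto
  then show ?thesis unfolding box_bump_def mem_box prod_zero_iff[OF finite_Basis] mult_eq_0_iff flat_1(3)
    by (auto simp: not_less)
qed

lemma box_bump_test_fun: "c > 0 \<Longrightarrow> box_bump c a b \<in> test_fun"
proof -
  assume c: "c > 0"
  obtain \<rho> where \<rho>: "\<And>x. x \<in> box a b \<Longrightarrow> norm x \<le> \<rho>" using bounded_box[of a b] by (auto simp: bounded_iff)
  show ?thesis
  proof (rule test_funI[of _ \<rho>])
    show "Ck k (box_bump c a b)" for k
      unfolding box_bump_def[abs_def] by (intro Ck_prod Ck_mult Ck_flat finite_Basis)
    show "box_bump c a b x = 0" if "\<rho> < norm x" for x
      using \<rho>[of x] that box_bump_eq_0_iff[OF c] by force
  qed
qed

text \<open>Inside the box every factor is exp(-1/(n t)) for some t > 0, so sharpening the parameter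
  drives it to 1; outside the box the bump is 0 throughout.\<close>

lemma box_bump_tendsto: "(\<lambda>n. box_bump (real (Suc n)) a b x) \<longlonglongrightarrow> indicator (box a b) x"
proof (cases "x \<in> box a b")
  case True
  have 1: "(\<lambda>n. flat 1 (real (Suc n) * t)) \<longlonglongrightarrow> 1" if "t > 0" for t
  proof -
    have "(\<lambda>n. exp (- (inverse (real (Suc n)) * inverse t))) \<longlonglongrightarrow> exp (- (0 * inverse t))"
      by (intro tendsto_intros LIMSEQ_inverse_real_of_nat)
    moreover have "flat 1 (real (Suc n) * t) = exp (- (inverse (real (Suc n)) * inverse t))" for n
      using that by (simp add: flat_def del: of_nat_Suc)
    ultimately show ?thesis by simp
  qed
  have "(\<lambda>n. box_bump (real (Suc n)) a b x) \<longlonglongrightarrow> (\<Prod>i\<in>(Basis::'a set). 1 * 1)"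
    unfolding box_bump_def
  proof (intro tendsto_prod tendsto_mult)
    fix i :: 'a assume "i \<in> Basis"
    then have "0 < x \<bullet> i - a \<bullet> i" "0 < b \<bullet> i - x \<bullet> i" using True by (auto simp: mem_box)
    from this[THEN 1] show
      "(\<lambda>n. flat 1 (real (Suc n) * (x \<bullet> i) + real (Suc n) * - (a \<bullet> i))) \<longlonglongrightarrow> 1"
      "(\<lambda>n. flat 1 (- real (Suc n) * (x \<bullet> i) + real (Suc n) * (b \<bullet> i))) \<longlonglongrightarrow> 1"
      by (simp_all add: algebra_simps del: of_nat_Suc)
  qed
  then show ?thesis using True by simp
next
  case False
  then have "box_bump (real (Suc n)) a b x = 0" for n by (subst box_bump_eq_0_iff) auto
  then show ?thesis using False by simp
qed

section \<open>Lebesgue norms and averages\<close>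

lemma Lp_exponent_cases:
  assumes "1 \<le> (p::ennreal)"
  obtains "p = \<infinity>" | P where "p = ennreal P" "1 \<le> P"
  using assms by (cases p) auto

lemma Lp_norm_infinity_le:
  assumes "f \<in> borel_measurable M"
  shows "Lp_norm M \<infinity> f \<le> c \<longleftrightarrow> (AE x in M. ennreal (norm (f x)) \<le> c)"
proof
  assume *: "Lp_norm M \<infinity> f \<le> c"
  have "AE x in M. ennreal (norm (f x)) \<le> esssup M (\<lambda>x. ennreal (norm (f x)))" by (rule esssup_AE)
  with * show "AE x in M. ennreal (norm (f x)) \<le> c" by (auto simp: Lp_norm_def elim!: order_trans)
next
  assume "AE x in M. ennreal (norm (f x)) \<le> c"
  with assms show "Lp_norm M \<infinity> f \<le> c" unfolding Lp_norm_def by (auto intro!: esssup_I)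
qed

lemma Lp_norm_finite_le:
  assumes "1 \<le> P" "0 \<le> N"
  shows "Lp_norm M (ennreal P) f \<le> ennreal N \<longleftrightarrow> (\<integral>\<^sup>+x. ennreal (norm (f x) powr P) \<partial>M) \<le> ennreal (N powr P)"
proof (cases "\<integral>\<^sup>+x. ennreal (norm (f x) powr P) \<partial>M")
  case (real r)
  have "r powr (1 / P) \<le> N \<longleftrightarrow> r \<le> N powr P"
  proof
    assume "r powr (1 / P) \<le> N"
    then have "(r powr (1 / P)) powr P \<le> N powr P" using assms by (intro powr_mono2) auto
    then show "r \<le> N powr P" using assms real by (simp add: powr_powr)
  next
    assume "r \<le> N powr P"
    then have "r powr (1 / P) \<le> (N powr P) powr (1 / P)" using assms real by (intro powr_mono2) auto
    then show "r powr (1 / P) \<le> N" using assms by (simp add: powr_powr)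
  qed
  then show ?thesis using assms real by (simp add: Lp_norm_def)
qed (use assms in \<open>auto simp: Lp_norm_def top_unique\<close>)

text \<open>Convexity of t^P: the graph lies above its tangent at a, with the terms arranged so that
  nothing is negative. It comes from Young's inequality with weights 1/P and (P - 1)/P, which makes
  sense for P = 1 too, and it yields both Jensen's inequality and midpoint convexity.\<close>

lemma powr_tangent:
  assumes "1 \<le> P" "0 < a" "0 \<le> (b::real)"
  shows "P * a powr (P - 1) * b \<le> b powr P + (P - 1) * a powr P"
proof (cases "b = 0")
  case False
  have "(b powr P) powr (1/P) * (a powr P) powr ((P - 1)/P) \<le> (1/P) * b powr P + ((P - 1)/P) * a powr P"
    by (rule Youngs_inequality_0) (use assms False in \<open>auto simp: field_simps\<close>)
  moreover have P: "P \<noteq> 0" "P > 0" using assms by auto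
  then have "(b powr P) powr (1/P) = b" "(a powr P) powr ((P - 1)/P) = a powr (P - 1)"
    using assms by (simp_all add: powr_powr)
  ultimately have "b * a powr (P - 1) \<le> (1/P) * b powr P + ((P - 1)/P) * a powr P" by simp
  then have "P * (b * a powr (P - 1)) \<le> P * ((1/P) * b powr P + ((P - 1)/P) * a powr P)"
    using P by (intro mult_left_mono) auto
  also have "\<dots> = b powr P + (P - 1) * a powr P" using P by (simp add: distrib_left)
  finally show ?thesis by (simp add: mult_ac)
next
  case True
  have "0 \<le> (P - 1) * a powr P" using assms(1) by (intro mult_nonneg_nonneg) auto
  with True show ?thesis by (metis add_nonneg_nonneg mult_zero_right powr_ge_zero)
qed

text \<open>Jensen's inequality for t^P, by integrating the tangent inequality at the point a.
  Taking a real lower bound a of the mean, instead of the mean itself, keeps the statement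
  meaningful when the mean is infinite.\<close>

lemma (in prob_space) nn_integral_powr_ge:
  assumes [measurable]: "f \<in> borel_measurable M"
    and f0: "\<And>x. 0 \<le> f x" and a: "0 \<le> a" and P: "1 \<le> P"
    and le: "ennreal a \<le> (\<integral>\<^sup>+x. ennreal (f x) \<partial>M)"
  shows "ennreal (a powr P) \<le> (\<integral>\<^sup>+x. ennreal (f x powr P) \<partial>M)"
proof (cases "a = 0")
  case False
  then have a: "0 < a" using a by simp
  show ?thesis
  proof (cases "\<integral>\<^sup>+x. ennreal (f x powr P) \<partial>M")
    case (real r)
    have "ennreal (P * a powr P) = ennreal (P * a powr (P - 1)) * ennreal a"
      using a P by (simp add: ennreal_mult'[symmetric] powr_diff)
    also have "\<dots> \<le> ennreal (P * a powr (P - 1)) * (\<integral>\<^sup>+x. ennreal (f x) \<partial>M)"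
      by (intro mult_left_mono le) auto
    also have "\<dots> = (\<integral>\<^sup>+x. ennreal (P * a powr (P - 1) * f x) \<partial>M)"
      using P by (subst nn_integral_cmult[symmetric]) (auto simp: ennreal_mult' f0)
    also have "\<dots> \<le> (\<integral>\<^sup>+x. ennreal (f x powr P) + ennreal ((P - 1) * a powr P) \<partial>M)"
      using powr_tangent[OF P a f0] P by (intro nn_integral_mono) (simp add: ennreal_plus[symmetric] del: ennreal_plus)
    also have "\<dots> = ennreal r + ennreal ((P - 1) * a powr P)"
      by (subst nn_integral_add) (auto simp: real emeasure_space_1)
    finally have "P * a powr P \<le> r + (P - 1) * a powr P"
      using P real by (simp add: ennreal_plus[symmetric] del: ennreal_plus)
    then show ?thesis using real by (simp add: algebra_simps)
  qed auto
qed auto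

lemma nn_integral_lborel_affine:
  fixes f :: "'a::euclidean_space \<Rightarrow> ennreal"
  assumes [measurable]: "f \<in> borel_measurable borel" and c: "c \<noteq> 0"
  shows "(\<integral>\<^sup>+x. f x \<partial>lborel) = ennreal (\<bar>c\<bar> ^ DIM('a)) * (\<integral>\<^sup>+x. f (t + c *\<^sub>R x) \<partial>lborel)"
  by (subst lborel_affine[OF c, of t])
     (simp add: nn_integral_density nn_integral_distr nn_integral_cmult)

lemma lborel_integrable_affine:
  fixes f :: "'a::euclidean_space \<Rightarrow> 'b::{banach, second_countable_topology}"
  assumes f: "integrable lborel f" and c: "c \<noteq> 0"
  shows "integrable lborel (\<lambda>x. f (t + c *\<^sub>R x))"
proof -
  have [measurable]: "f \<in> borel_measurable borel" using borel_measurable_integrable[OF f] by simp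
  show ?thesis using f unfolding integrable_iff_bounded
    by (subst (asm) nn_integral_lborel_affine[OF _ c, where t=t]) (auto simp: ennreal_mult_less_top c)
qed

lemma lborel_integral_affine:
  fixes f :: "'a::euclidean_space \<Rightarrow> 'b::{banach, second_countable_topology}"
  assumes [measurable]: "f \<in> borel_measurable borel" and c: "c \<noteq> 0"
  shows "(\<integral>x. f x \<partial>lborel) = (\<bar>c\<bar> ^ DIM('a)) *\<^sub>R (\<integral>x. f (t + c *\<^sub>R x) \<partial>lborel)"
  by (subst lborel_affine[OF c, of t])
     (simp add: integral_density integral_distr)

lemma AE_lborel_affine:
  fixes P :: "'a::euclidean_space \<Rightarrow> bool"
  assumes c: "c \<noteq> 0" and P[measurable]: "Measurable.pred borel P" and ae: "AE x in lborel. P x"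
  shows "AE x in lborel. P (t + c *\<^sub>R x)"
  using ae by (subst (asm) lborel_affine[OF c, of t]) (simp_all add: AE_density AE_distr_iff c)

text \<open>For averages, Minkowski's integral inequality follows from Jensen's inequality, applied
  pointwise, and Tonelli's theorem.\<close>

lemma Lp_norm_average_le:
  fixes g :: "'a::euclidean_space \<Rightarrow> 'b::euclidean_space" and h :: "'a \<Rightarrow> 'c::euclidean_space"
    and \<tau> :: "'m \<Rightarrow> 'a"
  assumes mu: "prob_space \<mu>" and \<tau>[measurable]: "\<tau> \<in> borel_measurable \<mu>" and g[measurable]: "g \<in> borel_measurable borel"
    and h[measurable]: "h \<in> borel_measurable borel" and p: "1 \<le> p"
    and le: "AE x in lborel. ennreal (norm (h x)) \<le> (\<integral>\<^sup>+\<omega>. ennreal (norm (g (x - \<tau> \<omega>))) \<partial>\<mu>)"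
  shows "Lp_norm lborel p h \<le> Lp_norm lborel p g"
proof (cases "Lp_norm lborel p g")
  case (real N)
  interpret mu: prob_space \<mu> by fact
  interpret P: pair_sigma_finite lborel \<mu> ..
  show ?thesis
    using p
  proof (cases rule: Lp_exponent_cases)
    case 1
    have N: "AE x in lborel. ennreal (norm (g x)) \<le> ennreal N"
      using real(2) unfolding 1 by (subst Lp_norm_infinity_le[symmetric]) auto
    have "AE x in lborel. ennreal (norm (g (x - \<tau> \<omega>))) \<le> ennreal N" for \<omega>
      using AE_lborel_affine[OF _ _ N, of 1 "- \<tau> \<omega>"] by simp
    then have "AE \<omega> in \<mu>. AE x in lborel. ennreal (norm (g (x - \<tau> \<omega>))) \<le> ennreal N" by simp
    \<comment> \<open>The exceptional null set of a translate depends on \<omega>; Tonelli's theorem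
      exchanges the two almost-everywhere quantifiers.\<close>
    then have "AE x in lborel. AE \<omega> in \<mu>. ennreal (norm (g (x - \<tau> \<omega>))) \<le> ennreal N"
      by (subst P.AE_commute) measurable
    then have "AE x in lborel. ennreal (norm (h x)) \<le> ennreal N"
      using le
    proof eventually_elim
      case (elim x)
      have "(\<integral>\<^sup>+\<omega>. ennreal (norm (g (x - \<tau> \<omega>))) \<partial>\<mu>) \<le> (\<integral>\<^sup>+\<omega>. ennreal N \<partial>\<mu>)"
        by (rule nn_integral_mono_AE) (rule elim)
      with elim(2) show ?case by (simp add: mu.emeasure_space_1)
    qed
    then show ?thesis unfolding real(2) unfolding 1 by (subst Lp_norm_infinity_le) auto
  next
    case (2 P)
    have N: "(\<integral>\<^sup>+x. ennreal (norm (g x) powr P) \<partial>lborel) \<le> ennreal (N powr P)"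
      using real 2 by (subst Lp_norm_finite_le[symmetric]) auto
    have tr: "(\<integral>\<^sup>+x. ennreal (norm (g (x - \<tau> \<omega>)) powr P) \<partial>lborel) = (\<integral>\<^sup>+x. ennreal (norm (g x) powr P) \<partial>lborel)" for \<omega>
      by (subst (2) nn_integral_lborel_affine[of _ 1 "- \<tau> \<omega>"]) auto
    have "(\<integral>\<^sup>+x. ennreal (norm (h x) powr P) \<partial>lborel)
        \<le> (\<integral>\<^sup>+x. (\<integral>\<^sup>+\<omega>. ennreal (norm (g (x - \<tau> \<omega>)) powr P) \<partial>\<mu>) \<partial>lborel)"
    proof (rule nn_integral_mono_AE, use le in eventually_elim)
      case (elim x)
      then show ?case by (intro mu.nn_integral_powr_ge) (auto simp: 2)
    qed
    also have "\<dots> = (\<integral>\<^sup>+\<omega>. (\<integral>\<^sup>+x. ennreal (norm (g (x - \<tau> \<omega>)) powr P) \<partial>lborel) \<partial>\<mu>)"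
      by (rule P.Fubini'[symmetric]) measurable
    also have "\<dots> \<le> ennreal (N powr P)" using N by (simp add: tr mu.emeasure_space_1)
    finally show ?thesis unfolding real(2) unfolding 2 using 2 real by (subst Lp_norm_finite_le) auto
  qed
qed auto

text \<open>The real number 1/p with 1/\<infinity> = 0, so that p = \<infinity> fits into exponents
  such as d/p and 1 - 1/p.\<close>

definition rexp :: "ennreal \<Rightarrow> real" where
  "rexp p = enn2real (inverse p)"

lemma rexp_top [simp]: "rexp top = 0"
  by (simp add: rexp_def)

lemma rexp_ennreal [simp]: "1 \<le> P \<Longrightarrow> rexp (ennreal P) = 1 / P"
  by (simp add: rexp_def inverse_ennreal inverse_eq_divide)

text \<open>Jensen's inequality bounds a^P by the average of |g|^P. Then \<phi> \<le> 1 removes the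
  density, the substitution y -> x - s y contributes s^(-d), and the P-th root gives the scaling
  s^(-d/p). At p = \<infinity> the exponent is 0 and the essential bound passes to averages
  directly.\<close>

lemma average_le_scaled_Lp_norm:
  fixes g :: "'a::euclidean_space \<Rightarrow> 'b::euclidean_space"
  assumes [measurable]: "\<phi> \<in> borel_measurable borel" and \<phi>: "\<And>x. 0 \<le> \<phi> x" "\<And>x. \<phi> x \<le> 1"
    and pr: "prob_space (density lborel (\<lambda>x. ennreal (\<phi> x)))"
    and [measurable]: "g \<in> borel_measurable borel" and p: "1 \<le> p" and s: "0 < s" and a: "0 \<le> a" and N: "0 \<le> N"
    and gN: "Lp_norm lborel p g \<le> ennreal N"
    and le: "ennreal a \<le> (\<integral>\<^sup>+y. ennreal (norm (g (x - s *\<^sub>R y))) \<partial>density lborel (\<lambda>x. ennreal (\<phi> x)))"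
  shows "a \<le> s powr (- (DIM('a) * rexp p)) * N"
  using p
proof (cases rule: Lp_exponent_cases)
  interpret prob_space "density lborel (\<lambda>x. ennreal (\<phi> x))" by fact
  case 1
  have "AE x in lborel. ennreal (norm (g x)) \<le> ennreal N"
    using gN unfolding 1 by (subst Lp_norm_infinity_le[symmetric]) auto
  from AE_lborel_affine[OF _ _ this, of "-s" x]
  have "AE y in lborel. ennreal (norm (g (x - s *\<^sub>R y))) \<le> ennreal N" using s by simp
  then have "AE y in density lborel (\<lambda>x. ennreal (\<phi> x)). ennreal (norm (g (x - s *\<^sub>R y))) \<le> ennreal N"
    by (subst AE_density) auto
  then have "(\<integral>\<^sup>+y. ennreal (norm (g (x - s *\<^sub>R y))) \<partial>density lborel (\<lambda>x. ennreal (\<phi> x)))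
      \<le> (\<integral>\<^sup>+y. ennreal N \<partial>density lborel (\<lambda>x. ennreal (\<phi> x)))" by (rule nn_integral_mono_AE)
  also have "\<dots> = ennreal N" by (simp only: nn_integral_const emeasure_space_1) simp
  finally have "ennreal a \<le> ennreal N" by (rule order_trans[OF le])
  then have "a \<le> N" using N by (simp add: ennreal_le_iff)
  then show ?thesis using s 1 by simp
next
  interpret prob_space "density lborel (\<lambda>x. ennreal (\<phi> x))" by fact
  case (2 P)
  have N': "(\<integral>\<^sup>+x. ennreal (norm (g x) powr P) \<partial>lborel) \<le> ennreal (N powr P)"
    using gN 2 N by (subst Lp_norm_finite_le[symmetric]) auto
  have "ennreal (a powr P) \<le> (\<integral>\<^sup>+y. ennreal (norm (g (x - s *\<^sub>R y)) powr P) \<partial>density lborel (\<lambda>x. ennreal (\<phi> x)))"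
    by (rule nn_integral_powr_ge) (use le a 2 in auto)
  also have "\<dots> = (\<integral>\<^sup>+y. ennreal (\<phi> y) * ennreal (norm (g (x - s *\<^sub>R y)) powr P) \<partial>lborel)"
    by (rule nn_integral_density) measurable
  also have "\<dots> \<le> (\<integral>\<^sup>+y. 1 * ennreal (norm (g (x - s *\<^sub>R y)) powr P) \<partial>lborel)"
    using \<phi> by (intro nn_integral_mono mult_right_mono) (auto simp: ennreal_le_1)
  finally have "ennreal (s ^ DIM('a)) * ennreal (a powr P)
    \<le> ennreal (s ^ DIM('a)) * (\<integral>\<^sup>+y. ennreal (norm (g (x - s *\<^sub>R y)) powr P) \<partial>lborel)"
    by (intro mult_left_mono) auto
  also have "\<dots> = (\<integral>\<^sup>+x. ennreal (norm (g x) powr P) \<partial>lborel)"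
    using s by (subst (2) nn_integral_lborel_affine[of _ "-s" x]) auto
  also note N'
  finally have "s ^ DIM('a) * a powr P \<le> N powr P" using s by (simp add: ennreal_mult'[symmetric])
  then have "a powr P \<le> s powr (- real DIM('a)) * N powr P"
    using s by (simp add: powr_minus powr_realpow field_simps)
  then have "(a powr P) powr (1/P) \<le> (s powr (- real DIM('a)) * N powr P) powr (1/P)"
    using 2 by (intro powr_mono2) auto
  then show ?thesis using 2 a N s by (simp add: powr_powr powr_mult field_simps)
qed

section \<open>Locally integrable functions\<close>

lemma cball_in_sets_borel [measurable]: "cball a r \<in> sets borel"
  by (simp add: borel_closed)

lemma box_subset_cball:
  obtains r where "box a b \<subseteq> cball (0::'a::euclidean_space) r"
  using bounded_box[of a b] by (force simp: bounded_iff)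

text \<open>Borel rather than Lebesgue measurability: translates f (x - \<tau> \<omega>) have to be
  jointly measurable on a product sigma-algebra before integrals can be exchanged, which a Borel f
  guarantees.\<close>

definition loc_int :: "('a::euclidean_space \<Rightarrow> 'b::euclidean_space) \<Rightarrow> bool" where
  "loc_int f \<longleftrightarrow> f \<in> borel_measurable borel \<and>
     (\<forall>r. (\<integral>\<^sup>+x. ennreal (norm (f x)) * indicator (cball 0 r) x \<partial>lborel) < \<infinity>)"

lemma loc_int_measurable [measurable_dest]: "loc_int f \<Longrightarrow> f \<in> borel_measurable borel"
  by (simp add: loc_int_def)

lemma loc_int_cball:
  assumes "loc_int f"
  shows "(\<integral>\<^sup>+x. ennreal (norm (f x)) * indicator (cball a r) x \<partial>lborel) < \<infinity>"
proof -
  have "cball a r \<subseteq> cball 0 (norm a + r)"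
    by (auto simp: dist_norm) (metis add_le_cancel_left norm_triangle_sub order_trans norm_minus_commute)
  then have "(\<integral>\<^sup>+x. ennreal (norm (f x)) * indicator (cball a r) x \<partial>lborel)
     \<le> (\<integral>\<^sup>+x. ennreal (norm (f x)) * indicator (cball 0 (norm a + r)) x \<partial>lborel)"
    by (intro nn_integral_mono mult_left_mono) (auto split: split_indicator)
  also have "\<dots> < \<infinity>" using assms by (simp add: loc_int_def)
  finally show ?thesis .
qed

lemma loc_int_integrable:
  fixes f :: "'a::euclidean_space \<Rightarrow> 'b::euclidean_space"
  assumes f: "loc_int f" and [measurable]: "k \<in> borel_measurable borel"
    and k: "\<And>x. \<bar>k x\<bar> \<le> B" "\<And>x. x \<notin> cball a r \<Longrightarrow> k x = 0"
  shows "integrable lborel (\<lambda>x. k x *\<^sub>R f x)"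
proof (rule integrableI_bounded)
  note [measurable] = loc_int_measurable[OF f]
  show "(\<lambda>x. k x *\<^sub>R f x) \<in> borel_measurable lborel" by measurable
  have "(\<integral>\<^sup>+x. ennreal (norm (k x *\<^sub>R f x)) \<partial>lborel) \<le>
     (\<integral>\<^sup>+x. ennreal B * (ennreal (norm (f x)) * indicator (cball a r) x) \<partial>lborel)"
    using k by (intro nn_integral_mono)
      (auto simp: ennreal_mult'[symmetric] ennreal_mult''[symmetric] mult_right_mono intro!: ennreal_leI split: split_indicator)
  also have "\<dots> < \<infinity>"
    using loc_int_cball[OF f, of a r] by (subst nn_integral_cmult) (auto simp: ennreal_mult_less_top)
  finally show "(\<integral>\<^sup>+x. ennreal (norm (k x *\<^sub>R f x)) \<partial>lborel) < \<infinity>" .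
qed

lemma loc_intI:
  fixes f :: "'a::euclidean_space \<Rightarrow> 'b::euclidean_space"
  assumes [measurable]: "f \<in> borel_measurable borel"
    and "\<And>r. integrable lborel (\<lambda>x. indicator (cball 0 r) x *\<^sub>R f x)"
  shows "loc_int f"
  unfolding loc_int_def
proof (intro conjI allI)
  fix r
  have "(\<integral>\<^sup>+x. ennreal (norm (indicator (cball 0 r) x *\<^sub>R f x)) \<partial>lborel) < \<infinity>"
    using assms(2)[of r] by (simp add: integrable_iff_bounded)
  then show "(\<integral>\<^sup>+x. ennreal (norm (f x)) * indicator (cball 0 r) x \<partial>lborel) < \<infinity>"
    by (simp add: ennreal_mult mult.commute ennreal_indicator)
qed fact

lemma loc_int_continuous:
  assumes "continuous_on UNIV f"
  shows "loc_int f"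
proof (rule loc_intI)
  show "integrable lborel (\<lambda>x. indicator (cball 0 r) x *\<^sub>R f x)" for r
    by (rule borel_integrable_compact[OF compact_cball]) (use assms continuous_on_subset in blast)
qed (use assms in \<open>rule borel_measurable_continuous_onI\<close>)

lemma loc_int_add:
  assumes "loc_int f" "loc_int g"
  shows "loc_int (\<lambda>x. a *\<^sub>R f x + b *\<^sub>R g x)"
proof (rule loc_intI)
  show "(\<lambda>x. a *\<^sub>R f x + b *\<^sub>R g x) \<in> borel_measurable borel"
    using assms[THEN loc_int_measurable] by measurable
  have "integrable lborel (\<lambda>x. a *\<^sub>R (indicator (cball 0 r) x *\<^sub>R f x) + b *\<^sub>R (indicator (cball 0 r) x *\<^sub>R g x))" for r
    by (intro Bochner_Integration.integrable_add impI integrable_scaleR_right loc_int_integrable[OF assms(1), of _ 1 0 r] loc_int_integrable[OF assms(2), of _ 1 0 r])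
       (auto split: split_indicator)
  then show "integrable lborel (\<lambda>x. indicator (cball 0 r) x *\<^sub>R (a *\<^sub>R f x + b *\<^sub>R g x))" for r
    by (simp add: scaleR_add_right mult.commute)
qed

lemma loc_int_translate:
  fixes f :: "'a::euclidean_space \<Rightarrow> 'b::euclidean_space"
  assumes f: "loc_int f" and c: "c \<noteq> 0"
  shows "loc_int (\<lambda>y. f (x + c *\<^sub>R y))"
  unfolding loc_int_def
proof (intro conjI allI)
  note [measurable] = loc_int_measurable[OF f]
  show "(\<lambda>y. f (x + c *\<^sub>R y)) \<in> borel_measurable borel" by measurable
  fix r
  have 1: "indicator (cball x (\<bar>c\<bar> * r)) (x + c *\<^sub>R y) = (indicator (cball 0 r) y :: ennreal)" for y
    using c by (auto simp: dist_norm split: split_indicator)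
  have "ennreal (\<bar>c\<bar> ^ DIM('a)) * (\<integral>\<^sup>+y. ennreal (norm (f (x + c *\<^sub>R y))) * indicator (cball 0 r) y \<partial>lborel) < \<infinity>"
    using loc_int_cball[OF f, of x "\<bar>c\<bar> * r"]
    by (subst (asm) nn_integral_lborel_affine[OF _ c, of _ x]) (simp_all add: 1)
  then show "(\<integral>\<^sup>+y. ennreal (norm (f (x + c *\<^sub>R y))) * indicator (cball 0 r) y \<partial>lborel) < \<infinity>"
    using c by (auto simp: ennreal_mult_less_top)
qed

lemma loc_int_inner: "loc_int g \<Longrightarrow> loc_int (\<lambda>x. g x \<bullet> i)"
proof (rule loc_intI)
  assume g: "loc_int g"
  show "(\<lambda>x. g x \<bullet> i) \<in> borel_measurable borel" using loc_int_measurable[OF g] by measurable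
  have "integrable lborel (\<lambda>x. (indicator (cball 0 r) x *\<^sub>R g x) \<bullet> i)" for r
    by (intro integrable_inner_left impI loc_int_integrable[OF g, of _ 1 0 r]) (auto split: split_indicator)
  then show "integrable lborel (\<lambda>x. indicator (cball 0 r) x *\<^sub>R (g x \<bullet> i))" for r
    by simp
qed

text \<open>The integrability hypothesis for exchanging signed integrals over space with averages
  over translations. Since |\<tau>| \<le> \<rho> and k is supported in a ball of radius C, only the
  values of f on the ball of radius C + \<rho> enter, so one finite number D bounds the inner
  integral for almost all \<omega>.\<close>

lemma integrable_pair_translate:
  fixes f :: "'a::euclidean_space \<Rightarrow> 'b::euclidean_space" and \<tau> :: "'m \<Rightarrow> 'a"
    and k :: "'a \<Rightarrow> 'm \<Rightarrow> 'b"
  assumes mu: "prob_space \<mu>" and \<tau>[measurable]: "\<tau> \<in> borel_measurable \<mu>" and f: "loc_int f"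
    and \<rho>: "AE \<omega> in \<mu>. norm (\<tau> \<omega>) \<le> \<rho>"
    and k[measurable]: "case_prod k \<in> borel_measurable (lborel \<Otimes>\<^sub>M \<mu>)"
    and B: "AE \<omega> in \<mu>. \<forall>x. norm (k x \<omega>) \<le> B"
    and C: "AE \<omega> in \<mu>. \<forall>x. x \<notin> cball 0 C \<longrightarrow> k x \<omega> = 0"
  shows "integrable (lborel \<Otimes>\<^sub>M \<mu>) (\<lambda>(x, \<omega>). f (x - \<tau> \<omega>) \<bullet> k x \<omega>)"
proof (rule integrableI_bounded)
  interpret mu: prob_space \<mu> by fact
  interpret P: pair_sigma_finite lborel \<mu> ..
  note [measurable] = loc_int_measurable[OF f]
  show m: "(\<lambda>(x, \<omega>). f (x - \<tau> \<omega>) \<bullet> k x \<omega>) \<in> borel_measurable (lborel \<Otimes>\<^sub>M \<mu>)" by measurable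
  define D where "D = (\<integral>\<^sup>+x. ennreal B * (ennreal (norm (f x)) * indicator (cball 0 (C + \<rho>)) x) \<partial>lborel)"
  have "D < \<infinity>"
    using loc_int_cball[OF f, of 0 "C + \<rho>"] unfolding D_def
    by (subst nn_integral_cmult) (auto simp: ennreal_mult_less_top)
  have "(\<integral>\<^sup>+z. ennreal (norm (case z of (x, \<omega>) \<Rightarrow> f (x - \<tau> \<omega>) \<bullet> k x \<omega>)) \<partial>(lborel \<Otimes>\<^sub>M \<mu>))
     = (\<integral>\<^sup>+\<omega>. (\<integral>\<^sup>+x. ennreal (norm (f (x - \<tau> \<omega>) \<bullet> k x \<omega>)) \<partial>lborel) \<partial>\<mu>)"
    by (subst P.nn_integral_snd[symmetric]) (use m in auto)
  also have "\<dots> \<le> (\<integral>\<^sup>+\<omega>. D \<partial>\<mu>)"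
  proof (rule nn_integral_mono_AE, use \<rho> B C in eventually_elim)
    case (elim \<omega>)
    have sub: "x \<in> cball 0 C \<Longrightarrow> x - \<tau> \<omega> \<in> cball 0 (C + \<rho>)" for x
      using elim(1) norm_triangle_ineq4[of x "\<tau> \<omega>"] by auto
    have "(\<integral>\<^sup>+x. ennreal (norm (f (x - \<tau> \<omega>) \<bullet> k x \<omega>)) \<partial>lborel)
      \<le> (\<integral>\<^sup>+x. ennreal B * (ennreal (norm (f (x - \<tau> \<omega>))) * indicator (cball 0 (C + \<rho>)) (x - \<tau> \<omega>)) \<partial>lborel)"
    proof (rule nn_integral_mono)
      fix x
      show "ennreal (norm (f (x - \<tau> \<omega>) \<bullet> k x \<omega>))
        \<le> ennreal B * (ennreal (norm (f (x - \<tau> \<omega>))) * indicator (cball 0 (C + \<rho>)) (x - \<tau> \<omega>))"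
      proof (cases "x \<in> cball 0 C")
        case True
        have "0 \<le> B" using elim(2) norm_ge_zero order_trans by blast
        have "\<bar>f (x - \<tau> \<omega>) \<bullet> k x \<omega>\<bar> \<le> norm (f (x - \<tau> \<omega>)) * norm (k x \<omega>)"
          by (rule Cauchy_Schwarz_ineq2)
        also have "\<dots> \<le> norm (f (x - \<tau> \<omega>)) * B" using elim(2) by (intro mult_left_mono) auto
        finally show ?thesis using sub[OF True] \<open>0 \<le> B\<close>
          by (simp add: ennreal_mult[symmetric] mult.commute)
      qed (use elim(3) in simp)
    qed
    also have "\<dots> = D"
      unfolding D_def by (subst (2) nn_integral_lborel_affine[of _ 1 "- \<tau> \<omega>"]) auto
    finally show ?case .
  qed
  also have "\<dots> = D" by (simp add: mu.emeasure_space_1)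
  finally show "(\<integral>\<^sup>+z. ennreal (norm (case z of (x, \<omega>) \<Rightarrow> f (x - \<tau> \<omega>) \<bullet> k x \<omega>)) \<partial>(lborel \<Otimes>\<^sub>M \<mu>)) < \<infinity>"
    using \<open>D < \<infinity>\<close> by order
qed

section \<open>The fundamental lemma of the calculus of variations\<close>

text \<open>As \<open>ennreal\<close> cuts negative values off at 0, \<mu> and \<nu> have the
  densities f^+ and f^-. They are finite and equal on boxes, an intersection-stable generator of the
  Borel sets, so they coincide. Then f^+ = f^- almost everywhere, which leaves only f = 0.\<close>

lemma AE_eq_0_if_box_integrals_eq_0:
  fixes f :: "'a::euclidean_space \<Rightarrow> real"
  assumes f: "loc_int f" and 0: "\<And>a b. (\<integral>x. indicator (box a b) x * f x \<partial>lborel) = 0"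
  shows "AE x in lborel. f x = 0"
proof -
  note [measurable] = loc_int_measurable[OF f]
  define \<mu> where "\<mu> = density lborel (\<lambda>x. ennreal (f x))"
  define \<nu> where "\<nu> = density lborel (\<lambda>x. ennreal (- f x))"
  have int: "integrable lborel (\<lambda>x. indicator (box a b) x * f x)" for a b
  proof -
    obtain r where "box a b \<subseteq> cball 0 r" using box_subset_cball by blast
    then show ?thesis using loc_int_integrable[OF f, of "indicator (box a b)" 1 0 r] by (force split: split_indicator)
  qed
  have fin: "emeasure \<mu> (box a b) = ennreal (enn2real (\<integral>\<^sup>+ x. ennreal (indicator (box a b) x * f x) \<partial>lborel))"
     "emeasure \<nu> (box a b) = ennreal (enn2real (\<integral>\<^sup>+ x. ennreal (- (indicator (box a b) x * f x)) \<partial>lborel))" for a b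
  proof -
    have 1: "(\<integral>\<^sup>+ x. ennreal (indicator (box a b) x * f x) \<partial>lborel) < \<infinity>" "(\<integral>\<^sup>+ x. ennreal (- (indicator (box a b) x * f x)) \<partial>lborel) < \<infinity>"
      using int[of a b] by (auto simp: real_integrable_def less_top)
    have "emeasure \<mu> (box a b) = (\<integral>\<^sup>+ x. ennreal (indicator (box a b) x * f x) \<partial>lborel)"
      "emeasure \<nu> (box a b) = (\<integral>\<^sup>+ x. ennreal (- (indicator (box a b) x * f x)) \<partial>lborel)"
      by (auto simp: \<mu>_def \<nu>_def emeasure_density intro!: nn_integral_cong split: split_indicator)
    then show "emeasure \<mu> (box a b) = ennreal (enn2real (\<integral>\<^sup>+ x. ennreal (indicator (box a b) x * f x) \<partial>lborel))"
     "emeasure \<nu> (box a b) = ennreal (enn2real (\<integral>\<^sup>+ x. ennreal (- (indicator (box a b) x * f x)) \<partial>lborel))"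
      using 1 by (auto simp: ennreal_enn2real)
  qed
  have eq: "emeasure \<mu> (box a b) = emeasure \<nu> (box a b)" for a b
    using 0[of a b] unfolding real_lebesgue_integral_def[OF int] fin by simp
  have "\<mu> = \<nu>"
  proof (rule measure_eqI_generator_eq)
    let ?E = "range (\<lambda>(a, b). box a b::'a set)"
    show "Int_stable ?E" by (auto simp: Int_stable_def box_Int_box)
    show "?E \<subseteq> Pow UNIV" "sets \<mu> = sigma_sets UNIV ?E" "sets \<nu> = sigma_sets UNIV ?E"
      by (simp_all add: borel_eq_box \<mu>_def \<nu>_def)
    let ?A = "\<lambda>n::nat. box (- (real n *\<^sub>R One)) (real n *\<^sub>R One) :: 'a set"
    show "range ?A \<subseteq> ?E" "(\<Union>i. ?A i) = UNIV"
      unfolding UN_box_eq_UNIV by auto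
    show "emeasure \<mu> (?A i) \<noteq> \<infinity>" for i unfolding fin by simp
    show "emeasure \<mu> X = emeasure \<nu> X" if "X \<in> ?E" for X
      using that eq by auto
  qed
  then have "AE x in lborel. ennreal (f x) = ennreal (- f x)"
    unfolding \<mu>_def \<nu>_def by (intro sigma_finite_measure.density_unique[OF sigma_finite_lborel]) auto
  moreover have "y = 0" if "ennreal y = ennreal (- y)" for y
    using that ennreal_neg[of y] ennreal_neg[of "- y"] by (cases "0 \<le> y") (auto simp: ennreal_eq_0_iff)
  ultimately show ?thesis by auto
qed

text \<open>The indicator of a box is the limit of the bumps \<open>box_bump\<close>, all of which
  it dominates; as f is integrable on the box, dominated convergence carries the orthogonality over
  to boxes.\<close>

lemma AE_eq_0_if_orthogonal_test_fun:
  fixes f :: "'a::euclidean_space \<Rightarrow> real"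
  assumes f: "loc_int f" and 0: "\<And>\<psi>. \<psi> \<in> test_fun \<Longrightarrow> (\<integral>x. f x * \<psi> x \<partial>lborel) = 0"
  shows "AE x in lborel. f x = 0"
proof (rule AE_eq_0_if_box_integrals_eq_0[OF f])
  fix a b :: 'a
  note [measurable] = loc_int_measurable[OF f]
  have [measurable]: "box_bump (real (Suc n)) a b \<in> borel_measurable borel" for n
    by (intro borel_measurable_continuous_onI test_fun_continuous box_bump_test_fun) simp
  obtain r where r: "box a b \<subseteq> cball 0 r" using box_subset_cball by blast
  have int: "integrable lborel (\<lambda>x. indicator (box a b) x * f x)"
    using r loc_int_integrable[OF f, of "indicator (box a b)" 1 0 r] by (force split: split_indicator)
  have "(\<lambda>n. \<integral>x. box_bump (real (Suc n)) a b x * f x \<partial>lborel) \<longlonglongrightarrow> (\<integral>x. indicator (box a b) x * f x \<partial>lborel)"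
  proof (rule integral_dominated_convergence[where w="\<lambda>x. norm (indicator (box a b) x * f x)"])
    show "integrable lborel (\<lambda>x. norm (indicator (box a b) x * f x))" using int by (rule integrable_norm)
    show "AE x in lborel. (\<lambda>n. box_bump (real (Suc n)) a b x * f x) \<longlonglongrightarrow> indicator (box a b) x * f x"
      by (intro AE_I2 tendsto_mult box_bump_tendsto tendsto_const)
    show "AE x in lborel. norm (box_bump (real (Suc n)) a b x * f x) \<le> norm (indicator (box a b) x * f x)" for n
    proof (intro AE_I2)
      fix x
      have "\<bar>box_bump (real (Suc n)) a b x\<bar> \<le> indicator (box a b) x"
        using box_bump_eq_0_iff[of "real (Suc n)" a b x] box_bump_nonneg[of "real (Suc n)" a b x] box_bump_le_1[of "real (Suc n)" a b x]
        by (auto split: split_indicator)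
      then show "norm (box_bump (real (Suc n)) a b x * f x) \<le> norm (indicator (box a b) x * f x)"
        by (simp add: abs_mult mult_right_mono)
    qed
  qed measurable
  moreover have "(\<integral>x. box_bump (real (Suc n)) a b x * f x \<partial>lborel) = 0" for n
    using 0[OF box_bump_test_fun[of "real (Suc n)" a b]] by (simp add: mult.commute)
  ultimately show "(\<integral>x. indicator (box a b) x * f x \<partial>lborel) = 0"
    by (simp add: LIMSEQ_const_iff)
qed

section \<open>Weak gradients and mollification\<close>

text \<open>The Borel version of \<open>has_weak_gradient\<close>.\<close>

definition wgrad :: "('a::euclidean_space \<Rightarrow> real) \<Rightarrow> ('a \<Rightarrow> 'a) \<Rightarrow> bool" where
  "wgrad u g \<longleftrightarrow> loc_int u \<and> loc_int g \<and>
     (\<forall>\<phi>\<in>test_fun. \<forall>i\<in>Basis. (\<integral>x. u x * partial_deriv i \<phi> x \<partial>lborel) = - (\<integral>x. (g x \<bullet> i) * \<phi> x \<partial>lborel))"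

lemma test_fun_measurable [measurable]: "\<phi> \<in> test_fun \<Longrightarrow> \<phi> \<in> borel_measurable borel"
  by (intro borel_measurable_continuous_onI test_fun_continuous)

lemma loc_int_test_fun_integrable:
  fixes f :: "'a::euclidean_space \<Rightarrow> 'b::euclidean_space"
  assumes f: "loc_int f" and \<phi>: "\<phi> \<in> test_fun"
  shows "integrable lborel (\<lambda>x. \<phi> x *\<^sub>R f x)"
proof -
  obtain \<rho> where \<rho>: "\<And>x. \<rho> < norm x \<Longrightarrow> \<phi> x = 0" using test_fun_support[OF \<phi>] by metis
  obtain B where B: "\<And>x. \<bar>\<phi> x\<bar> \<le> B" using test_fun_bounded[OF \<phi>] by metis
  show ?thesis
    by (rule loc_int_integrable[OF f _ B, where a=0 and r=\<rho>]) (use \<rho> test_fun_measurable[OF \<phi>] in auto)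
qed

lemma wgrad_unique:
  fixes g :: "'a::euclidean_space \<Rightarrow> 'a"
  assumes "wgrad u g" "wgrad u g'"
  shows "AE x in lborel. g x = g' x"
proof -
  note [measurable] = loc_int_measurable
  have g: "loc_int g" "loc_int g'" using assms by (auto simp: wgrad_def)
  have "AE x in lborel. g x \<bullet> i - g' x \<bullet> i = 0" if i: "i \<in> Basis" for i
  proof (rule AE_eq_0_if_orthogonal_test_fun)
    show "loc_int (\<lambda>x. g x \<bullet> i - g' x \<bullet> i)"
      using loc_int_add[OF g[THEN loc_int_inner], where a=1 and b="-1"] by simp
    fix \<psi> :: "'a \<Rightarrow> real" assume \<psi>: "\<psi> \<in> test_fun"
    have "(\<integral>x. (g x \<bullet> i) * \<psi> x \<partial>lborel) = (\<integral>x. (g' x \<bullet> i) * \<psi> x \<partial>lborel)"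
      using assms[unfolded wgrad_def] \<psi> i by (auto simp: minus_equation_iff[of _ "- _"])
    then show "(\<integral>x. (g x \<bullet> i - g' x \<bullet> i) * \<psi> x \<partial>lborel) = 0"
      using loc_int_test_fun_integrable[OF loc_int_inner[OF g(1)] \<psi>, of i]
        loc_int_test_fun_integrable[OF loc_int_inner[OF g(2)] \<psi>, of i]
      by (simp add: left_diff_distrib right_diff_distrib mult.commute)
  qed
  then have "AE x in lborel. \<forall>i\<in>Basis. g x \<bullet> i - g' x \<bullet> i = 0"
    by (intro AE_finite_allI) auto
  then show ?thesis by eventually_elim (auto intro: euclidean_eqI)
qed

lemma wgrad_add:
  assumes "wgrad u g" "wgrad v h"
  shows "wgrad (\<lambda>x. a * u x + b * v x) (\<lambda>x. a *\<^sub>R g x + b *\<^sub>R h x)"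
  unfolding wgrad_def
proof (intro conjI ballI)
  have l: "loc_int u" "loc_int v" "loc_int g" "loc_int h" using assms by (auto simp: wgrad_def)
  show "loc_int (\<lambda>x. a * u x + b * v x)" using loc_int_add[OF l(1,2), of a b] by simp
  show "loc_int (\<lambda>x. a *\<^sub>R g x + b *\<^sub>R h x)" using loc_int_add[OF l(3,4)] .
  fix \<phi> :: "'a \<Rightarrow> real" and i :: 'a assume \<phi>: "\<phi> \<in> test_fun" and i: "i \<in> Basis"
  have 1: "integrable lborel (\<lambda>x. u x * partial_deriv i \<phi> x)" "integrable lborel (\<lambda>x. v x * partial_deriv i \<phi> x)"
    using loc_int_test_fun_integrable[OF l(1) test_fun_partial_deriv[OF \<phi> i]]
      loc_int_test_fun_integrable[OF l(2) test_fun_partial_deriv[OF \<phi> i]] by (simp_all add: mult.commute)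
  have 2: "integrable lborel (\<lambda>x. (g x \<bullet> i) * \<phi> x)" "integrable lborel (\<lambda>x. (h x \<bullet> i) * \<phi> x)"
    using loc_int_test_fun_integrable[OF loc_int_inner[OF l(3)] \<phi>, of i]
      loc_int_test_fun_integrable[OF loc_int_inner[OF l(4)] \<phi>, of i] by (simp_all add: mult.commute)
  have "(\<integral>x. (a * u x + b * v x) * partial_deriv i \<phi> x \<partial>lborel)
      = a * (\<integral>x. u x * partial_deriv i \<phi> x \<partial>lborel) + b * (\<integral>x. v x * partial_deriv i \<phi> x \<partial>lborel)"
    using 1 by (simp add: distrib_right mult.assoc)
  also have "\<dots> = - (a * (\<integral>x. (g x \<bullet> i) * \<phi> x \<partial>lborel) + b * (\<integral>x. (h x \<bullet> i) * \<phi> x \<partial>lborel))"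
    using assms \<phi> i by (simp add: wgrad_def)
  also have "\<dots> = - (\<integral>x. ((a *\<^sub>R g x + b *\<^sub>R h x) \<bullet> i) * \<phi> x \<partial>lborel)"
    using 2 by (simp add: distrib_right inner_add_left mult.assoc)
  finally show "(\<integral>x. (a * u x + b * v x) * partial_deriv i \<phi> x \<partial>lborel)
      = - (\<integral>x. ((a *\<^sub>R g x + b *\<^sub>R h x) \<bullet> i) * \<phi> x \<partial>lborel)" .
qed

lemma wgrad_direction:
  assumes w: "wgrad u g" and \<psi>: "\<psi> \<in> test_fun"
  shows "(\<integral>x. \<psi> x * (g x \<bullet> h) \<partial>lborel) = - (\<integral>x. u x * (grad \<psi> x \<bullet> h) \<partial>lborel)"
proof -
  have l: "loc_int u" "loc_int g" using w by (auto simp: wgrad_def)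
  have 1: "integrable lborel (\<lambda>x. u x * partial_deriv i \<psi> x)" if "i \<in> Basis" for i
    using loc_int_test_fun_integrable[OF l(1) test_fun_partial_deriv[OF \<psi> that]] by (simp add: mult.commute)
  have 2: "integrable lborel (\<lambda>x. (g x \<bullet> i) * \<psi> x)" for i
    using loc_int_test_fun_integrable[OF loc_int_inner[OF l(2)] \<psi>, of i] by (simp add: mult.commute)
  have "(\<integral>x. \<psi> x * (g x \<bullet> h) \<partial>lborel) = (\<integral>x. (\<Sum>i\<in>Basis. (h \<bullet> i) * ((g x \<bullet> i) * \<psi> x)) \<partial>lborel)"
    by (subst euclidean_inner) (simp add: sum_distrib_left mult_ac)
  also have "\<dots> = (\<Sum>i\<in>Basis. (h \<bullet> i) * (\<integral>x. (g x \<bullet> i) * \<psi> x \<partial>lborel))"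
    using 2 by (subst Bochner_Integration.integral_sum) auto
  also have "\<dots> = (\<Sum>i\<in>Basis. (h \<bullet> i) * - (\<integral>x. u x * partial_deriv i \<psi> x \<partial>lborel))"
    using w \<psi> by (intro sum.cong) (auto simp: wgrad_def)
  also have "\<dots> = - (\<integral>x. (\<Sum>i\<in>Basis. (h \<bullet> i) * (u x * partial_deriv i \<psi> x)) \<partial>lborel)"
    using 1 by (subst Bochner_Integration.integral_sum) (auto simp: sum_negf)
  also have "\<dots> = - (\<integral>x. u x * (grad \<psi> x \<bullet> h) \<partial>lborel)"
    by (simp add: grad_def inner_sum_right sum_distrib_left inner_commute[of _ h] mult_ac)
  finally show ?thesis .
qed

definition conv :: "('a::euclidean_space \<Rightarrow> real) \<Rightarrow> ('a \<Rightarrow> real) \<Rightarrow> 'a \<Rightarrow> real" where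
  "conv k u x = (\<integral>z. k (x - z) * u z \<partial>lborel)"

lemma test_fun_reflect: "k \<in> test_fun \<Longrightarrow> (\<lambda>z. k (x - z)) \<in> test_fun"
  using test_fun_affine[of k "-1" 1 x] by simp

lemma conv_integrable:
  assumes "loc_int u" "k \<in> test_fun"
  shows "integrable lborel (\<lambda>z. k (x - z) * u z)"
  using loc_int_test_fun_integrable[OF assms(1) test_fun_reflect[OF assms(2)]] by simp

text \<open>Differentiation under the integral: the linearisation of k is uniform in the base point,
  so the remainder is at most e' |h| times the integral of |u| over a fixed ball.\<close>

lemma conv_has_derivative:
  assumes u: "loc_int u" and k: "k \<in> test_fun"
  shows "(conv k u has_derivative (\<lambda>h. \<Sum>i\<in>Basis. (h \<bullet> i) * conv (partial_deriv i k) u x)) (at x)"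
  unfolding has_derivative_at_alt
proof (intro conjI allI impI)
  note [measurable] = loc_int_measurable[OF u]
  show "bounded_linear (\<lambda>h. \<Sum>i\<in>Basis. (h \<bullet> i) * conv (partial_deriv i k) u x)"
    by (intro bounded_linear_sum bounded_linear_mult_left[THEN bounded_linear_compose] bounded_linear_inner_left)
  fix e :: real assume e: "0 < e"
  obtain \<rho> where \<rho>: "\<rho> > 0" "\<And>x. \<rho> < norm x \<Longrightarrow> k x = 0" using test_fun_support[OF k] by metis
  define M where "M = (\<integral>z. indicator (cball x (\<rho> + 1)) z * \<bar>u z\<bar> \<partial>lborel)"
  have Mi: "integrable lborel (\<lambda>z. indicator (cball x (\<rho> + 1)) z * \<bar>u z\<bar>)"
    using integrable_norm[OF loc_int_integrable[OF u, of "indicator (cball x (\<rho> + 1))" 1 x "\<rho> + 1"]]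
    by (simp add: abs_mult split: split_indicator)
  have M: "0 \<le> M" by (simp add: M_def)
  \<comment> \<open>The summand 1 covers the case M = 0.\<close>
  define e' where "e' = e / (M + 1)"
  have e': "0 < e'" "e' * M \<le> e" using e M by (auto simp: e'_def field_simps)
  obtain d where d: "0 < d" "\<And>a h. norm h < d \<Longrightarrow> \<bar>k (a + h) - k a - grad k a \<bullet> h\<bar> \<le> e' * norm h"
    using grad_uniform_linearization[OF k e'(1)] by metis
  show "\<exists>d>0. \<forall>y. norm (y - x) < d \<longrightarrow>
      norm (conv k u y - conv k u x - (\<Sum>i\<in>Basis. ((y - x) \<bullet> i) * conv (partial_deriv i k) u x)) \<le> e * norm (y - x)"
  \<comment> \<open>A step shorter than 1 keeps the supports of both kernels inside the ball of
    radius \<rho> + 1 over which |u| is integrated.\<close>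
  proof (intro exI[of _ "min d 1"] conjI allI impI)
    fix y assume y: "norm (y - x) < min d 1"
    define h where "h = y - x"
    note i1 = conv_integrable[OF u k]
    note i2 = conv_integrable[OF u test_fun_partial_deriv[OF k]]
    define F where "F z = k (y - z) * u z - k (x - z) * u z - (\<Sum>i\<in>Basis. (h \<bullet> i) * (partial_deriv i k (x - z) * u z))" for z
    have Fi: "integrable lborel F" unfolding F_def using i1 i2 by auto
    have F: "F z = (k (y - z) - k (x - z) - grad k (x - z) \<bullet> h) * u z" for z
      by (simp add: F_def grad_def inner_sum_right sum_distrib_left right_diff_distrib inner_commute[of _ h] mult_ac)
    have eq: "conv k u y - conv k u x - (\<Sum>i\<in>Basis. (h \<bullet> i) * conv (partial_deriv i k) u x) = (\<integral>z. F z \<partial>lborel)"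
      unfolding conv_def F_def using i1 i2 by (simp add: Bochner_Integration.integral_diff Bochner_Integration.integral_sum)
    have bd: "norm (F z) \<le> e' * norm h * (indicator (cball x (\<rho> + 1)) z * \<bar>u z\<bar>)" for z
    proof (cases "z \<in> cball x (\<rho> + 1)")
      case True
      have "\<bar>k (y - z) - k (x - z) - grad k (x - z) \<bullet> h\<bar> \<le> e' * norm h"
        using d(2)[of h "x - z"] y by (simp add: h_def algebra_simps)
      then show ?thesis using True by (simp add: F abs_mult mult_right_mono)
    next
      case False
      then have 1: "\<rho> + 1 < norm (x - z)" by (simp add: dist_norm)
      then have "\<rho> < norm (y - z)" using y norm_triangle_ineq2[of "x - z" "x - y"] by (simp add: norm_minus_commute)
      with 1 \<rho> have "k (y - z) = 0" "k (x - z) = 0" "grad k (x - z) = 0"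
        using grad_eq_0[of \<rho> k "x - z"] by auto
      then show ?thesis using e' by (simp add: F)
    qed
    have "norm (\<integral>z. F z \<partial>lborel)
        \<le> (\<integral>z. e' * norm h * (indicator (cball x (\<rho> + 1)) z * \<bar>u z\<bar>) \<partial>lborel)"
      by (rule Bochner_Integration.integral_norm_bound_integral[OF Fi _ bd]) (use Mi in auto)
    also have "\<dots> = e' * M * norm h" by (simp add: M_def mult_ac)
    also have "\<dots> \<le> e * norm h" using e' by (intro mult_right_mono) auto
    finally show "norm (conv k u y - conv k u x - (\<Sum>i\<in>Basis. ((y - x) \<bullet> i) * conv (partial_deriv i k) u x)) \<le> e * norm (y - x)"
      using eq by (simp add: h_def)
  qed (use d in auto)
qed

text \<open>All derivatives fall on the kernel, whose partial derivatives are again test functions;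
  u is only ever integrated.\<close>

lemma conv_Ck: "loc_int u \<Longrightarrow> k \<in> test_fun \<Longrightarrow> Ck n (conv k u)"
proof (induction n arbitrary: k)
  case 0
  then show ?case
    using has_derivative_continuous[OF conv_has_derivative] by (auto intro: continuous_at_imp_continuous_on)
next
  case (Suc n)
  show ?case
  proof (rule Ck_SucI)
    show "(conv k u has_derivative (\<lambda>h. \<Sum>i\<in>Basis. (h \<bullet> i) * conv (partial_deriv i k) u x)) (at x)" for x
      by (rule conv_has_derivative) fact+
    show "Ck n (\<lambda>x. \<Sum>i\<in>Basis. (j \<bullet> i) * conv (partial_deriv i k) u x)" if "j \<in> Basis" for j
    proof -
      have "(\<lambda>x. \<Sum>i\<in>Basis. (j \<bullet> i) * conv (partial_deriv i k) u x) = conv (partial_deriv j k) u"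
        using that by (auto simp: inner_Basis if_distrib[where f="\<lambda>c. c * _"] sum.delta cong: if_cong)
      then show ?thesis using Suc.IH[OF Suc.prems(1) test_fun_partial_deriv[OF Suc.prems(2) that]] by simp
    qed
  qed
qed

text \<open>The weak gradient identity is tested with z -> k (x - z). The reflection and the
  integration by parts contribute one minus sign each.\<close>

lemma conv_partial_deriv_wgrad:
  assumes w: "wgrad u g" and k: "k \<in> test_fun" and i: "i \<in> Basis"
  shows "conv (partial_deriv i k) u x = conv k (\<lambda>z. g z \<bullet> i) x"
proof -
  have "(\<integral>z. u z * partial_deriv i (\<lambda>z. 1 * k ((-1) *\<^sub>R z + x)) z \<partial>lborel)
      = - (\<integral>z. (g z \<bullet> i) * (1 * k ((-1) *\<^sub>R z + x)) \<partial>lborel)"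
    using w i test_fun_affine[OF k, of "-1" 1 x] unfolding wgrad_def by auto
  then show ?thesis unfolding partial_deriv_affine[OF k] by (simp add: conv_def mult.commute)
qed

lemma conv_has_gradient:
  assumes w: "wgrad u g" and k: "k \<in> test_fun"
  shows "(conv k u has_derivative (\<lambda>h. \<Sum>i\<in>Basis. (h \<bullet> i) * conv k (\<lambda>z. g z \<bullet> i) x)) (at x)"
  using conv_has_derivative[of u k x] w k by (simp add: conv_partial_deriv_wgrad[OF w k] wgrad_def)

section \<open>Averages of translates\<close>

text \<open>A constant weight w covers \<open>avg\<close> and its components, the weight s y covers
  the integral of a gradient along segments. The second claim moves the translation from f to the
  smooth \<psi>, where it can be differentiated.\<close>

lemma translate_average:
  fixes f :: "'a::euclidean_space \<Rightarrow> 'b::euclidean_space" and \<tau> :: "'m \<Rightarrow> 'a"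
  assumes mu: "prob_space \<mu>" and \<tau>[measurable]: "\<tau> \<in> borel_measurable \<mu>" and f: "loc_int f"
    and \<rho>: "AE \<omega> in \<mu>. norm (\<tau> \<omega>) \<le> \<rho>"
    and w[measurable]: "w \<in> borel_measurable \<mu>" and B: "AE \<omega> in \<mu>. norm (w \<omega>) \<le> B"
  shows loc_int_translate_average: "loc_int (\<lambda>x. \<integral>\<omega>. f (x - \<tau> \<omega>) \<bullet> w \<omega> \<partial>\<mu>)"
    and integral_translate_average: "\<psi> \<in> test_fun \<Longrightarrow> (\<integral>x. \<psi> x * (\<integral>\<omega>. f (x - \<tau> \<omega>) \<bullet> w \<omega> \<partial>\<mu>) \<partial>lborel)
      = (\<integral>\<omega>. (\<integral>x. \<psi> (x + \<tau> \<omega>) * (f x \<bullet> w \<omega>) \<partial>lborel) \<partial>\<mu>)"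
proof -
  interpret mu: prob_space \<mu> by fact
  interpret P: pair_sigma_finite lborel \<mu> ..
  note [measurable] = loc_int_measurable[OF f]
  show "loc_int (\<lambda>x. \<integral>\<omega>. f (x - \<tau> \<omega>) \<bullet> w \<omega> \<partial>\<mu>)"
  proof (rule loc_intI)
    show "(\<lambda>x. \<integral>\<omega>. f (x - \<tau> \<omega>) \<bullet> w \<omega> \<partial>\<mu>) \<in> borel_measurable borel"
      using mu.borel_measurable_lebesgue_integral[of "\<lambda>x \<omega>. f (x - \<tau> \<omega>) \<bullet> w \<omega>" lborel] by simp
    fix r
    have "integrable (lborel \<Otimes>\<^sub>M \<mu>) (\<lambda>(x, \<omega>). f (x - \<tau> \<omega>) \<bullet> (indicator (cball 0 r) x *\<^sub>R w \<omega>))"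
      by (rule integrable_pair_translate[OF mu \<tau> f \<rho>, where C=r and B=B])
         (use B in \<open>auto split: split_indicator elim!: eventually_mono intro: order_trans[OF norm_ge_zero]\<close>)
    from P.integrable_fst[OF this]
    show "integrable lborel (\<lambda>x. indicator (cball 0 r) x *\<^sub>R (\<integral>\<omega>. f (x - \<tau> \<omega>) \<bullet> w \<omega> \<partial>\<mu>))"
      by (simp add: mult.commute)
  qed
  assume \<psi>: "\<psi> \<in> test_fun"
  obtain C where C: "\<And>x. C < norm x \<Longrightarrow> \<psi> x = 0" using test_fun_support[OF \<psi>] by metis
  obtain D where D: "\<And>x. \<bar>\<psi> x\<bar> \<le> D" using test_fun_bounded[OF \<psi>] by metis
  note [measurable] = test_fun_measurable[OF \<psi>]
  have "integrable (lborel \<Otimes>\<^sub>M \<mu>) (\<lambda>(x, \<omega>). f (x - \<tau> \<omega>) \<bullet> (\<psi> x *\<^sub>R w \<omega>))"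
    by (rule integrable_pair_translate[OF mu \<tau> f \<rho>, where C=C and B="D * B"])
       (use B C in \<open>auto elim!: eventually_mono intro!: mult_mono D order_trans[OF abs_ge_zero D]\<close>)
  from P.Fubini_integral[OF this]
  have "(\<integral>x. \<psi> x * (\<integral>\<omega>. f (x - \<tau> \<omega>) \<bullet> w \<omega> \<partial>\<mu>) \<partial>lborel)
      = (\<integral>\<omega>. (\<integral>x. \<psi> x * (f (x - \<tau> \<omega>) \<bullet> w \<omega>) \<partial>lborel) \<partial>\<mu>)" by simp
  also have "\<dots> = (\<integral>\<omega>. (\<integral>x. \<psi> (x + \<tau> \<omega>) * (f x \<bullet> w \<omega>) \<partial>lborel) \<partial>\<mu>)"
  proof (rule Bochner_Integration.integral_cong[OF refl])
    fix \<omega>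
    show "(\<integral>x. \<psi> x * (f (x - \<tau> \<omega>) \<bullet> w \<omega>) \<partial>lborel) = (\<integral>x. \<psi> (x + \<tau> \<omega>) * (f x \<bullet> w \<omega>) \<partial>lborel)"
      by (subst lborel_integral_affine[where c=1 and t="\<tau> \<omega>"]) (auto simp: add.commute)
  qed
  finally show "(\<integral>x. \<psi> x * (\<integral>\<omega>. f (x - \<tau> \<omega>) \<bullet> w \<omega> \<partial>\<mu>) \<partial>lborel)
      = (\<integral>\<omega>. (\<integral>x. \<psi> (x + \<tau> \<omega>) * (f x \<bullet> w \<omega>) \<partial>lborel) \<partial>\<mu>)" .
qed

text \<open>Unconditional, because the Bochner integral of a non-integrable function is 0.\<close>

lemma norm_integral_le_nn_integral:
  fixes f :: "'a \<Rightarrow> 'b::{banach, second_countable_topology}"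
  shows "ennreal (norm (\<integral>x. f x \<partial>M)) \<le> (\<integral>\<^sup>+x. ennreal (norm (f x)) \<partial>M)"
  by (cases "integrable M f") (auto intro: integral_norm_bound_ennreal simp: not_integrable_integral_eq)

text \<open>Integrals over t in [0, 1] become expectations. Together with the law of y they form a
  probability measure on pairs (y, t), so that \<open>Lp_norm_average_le\<close> applies to
  integrals along random segments.\<close>

definition uniform01 :: "real measure" where
  "uniform01 = density lborel (indicator {0..1})"

lemma prob_space_uniform01: "prob_space uniform01"
  by (rule prob_spaceI) (simp add: uniform01_def emeasure_density)

lemma sets_uniform01 [simp, measurable_cong]: "sets uniform01 = sets borel"
  by (simp add: uniform01_def)

lemma AE_uniform01: "AE t in uniform01. 0 \<le> t \<and> t \<le> 1"
  unfolding uniform01_def by (subst AE_density) (auto simp: indicator_def)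

lemma nn_integral_uniform01:
  "f \<in> borel_measurable borel \<Longrightarrow> (\<integral>\<^sup>+t. f t \<partial>uniform01) = (\<integral>\<^sup>+t. f t * indicator {0..1} t \<partial>lborel)"
  unfolding uniform01_def by (subst nn_integral_density) (auto simp: mult.commute)

lemma integral_uniform01:
  fixes f :: "real \<Rightarrow> 'b::{banach, second_countable_topology}"
  assumes "f \<in> borel_measurable borel"
  shows "(\<integral>t. f t \<partial>uniform01) = (\<integral>t. indicator {0..1} t *\<^sub>R f t \<partial>lborel)"
proof -
  have "uniform01 = density lborel (\<lambda>x. ennreal (indicator {0..1} x))"
    by (simp add: uniform01_def ennreal_indicator)
  then show ?thesis using integral_density[of f lborel "indicator {0..1}"] assms by simp
qed

lemma integral_gradient_segment:
  fixes v :: "'a::euclidean_space \<Rightarrow> real"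
  assumes v: "\<And>x. (v has_derivative (\<lambda>h. G x \<bullet> h)) (at x)" and G: "continuous_on UNIV G"
  shows "(\<integral>t. G (a + t *\<^sub>R h) \<bullet> h \<partial>uniform01) = v (a + h) - v a"
proof -
  have c: "continuous_on UNIV (\<lambda>t. G (a + t *\<^sub>R h) \<bullet> h)"
    by (intro continuous_intros continuous_on_compose2[OF G]) auto
  have d: "((\<lambda>t. v (a + t *\<^sub>R h)) has_vector_derivative G (a + t *\<^sub>R h) \<bullet> h) (at t within {0..1})" for t
  proof -
    have "((\<lambda>t. v (a + t *\<^sub>R h)) has_derivative (\<lambda>s. G (a + t *\<^sub>R h) \<bullet> (s *\<^sub>R h))) (at t)"
      by (rule has_derivative_compose[of "\<lambda>t. a + t *\<^sub>R h" "\<lambda>s. s *\<^sub>R h" t UNIV v, simplified])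
         (auto intro!: derivative_eq_intros v)
    then have "((\<lambda>t. v (a + t *\<^sub>R h)) has_vector_derivative G (a + t *\<^sub>R h) \<bullet> h) (at t)"
      by (simp add: has_vector_derivative_def)
    then show ?thesis by (rule has_vector_derivative_at_within)
  qed
  have "(\<integral>t. G (a + t *\<^sub>R h) \<bullet> h \<partial>uniform01) = (\<integral>t. indicator {0..1} t *\<^sub>R (G (a + t *\<^sub>R h) \<bullet> h) \<partial>lborel)"
    by (intro integral_uniform01 borel_measurable_continuous_onI c)
  also have "\<dots> = v (a + 1 *\<^sub>R h) - v (a + 0 *\<^sub>R h)"
    by (rule integral_FTC_atLeastAtMost) (use d continuous_on_subset[OF c] in auto)
  finally show ?thesis by simp
qed

lemma Lp_norm_scaleR_le:
  fixes f :: "'a \<Rightarrow> 'b::euclidean_space"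
  assumes p: "1 \<le> p" and [measurable]: "f \<in> borel_measurable M"
  shows "Lp_norm M p (\<lambda>x. c *\<^sub>R f x) \<le> ennreal \<bar>c\<bar> * Lp_norm M p f"
proof (cases "Lp_norm M p f")
  case (real N)
  from p show ?thesis
  proof (cases rule: Lp_exponent_cases)
    case 1
    have "AE x in M. ennreal (norm (f x)) \<le> ennreal N"
      using real unfolding 1 by (subst Lp_norm_infinity_le[symmetric]) auto
    then have "AE x in M. ennreal (norm (c *\<^sub>R f x)) \<le> ennreal (\<bar>c\<bar> * N)"
      by eventually_elim (use real in \<open>auto simp: ennreal_le_iff intro!: ennreal_leI mult_left_mono\<close>)
    then show ?thesis unfolding real(2) unfolding 1 using real by (subst Lp_norm_infinity_le) (auto simp: ennreal_mult)
  next
    case (2 P)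
    have "(\<integral>\<^sup>+x. ennreal (norm (f x) powr P) \<partial>M) \<le> ennreal (N powr P)"
      using real 2 by (subst Lp_norm_finite_le[symmetric]) auto
    then have "ennreal (\<bar>c\<bar> powr P) * (\<integral>\<^sup>+x. ennreal (norm (f x) powr P) \<partial>M) \<le> ennreal (\<bar>c\<bar> powr P) * ennreal (N powr P)"
      by (intro mult_left_mono) auto
    then have "(\<integral>\<^sup>+x. ennreal (norm (c *\<^sub>R f x) powr P) \<partial>M) \<le> ennreal ((\<bar>c\<bar> * N) powr P)"
      using real by (simp add: powr_mult nn_integral_cmult ennreal_mult')
    then show ?thesis
      unfolding real(2) unfolding 2 using 2 real by (subst ennreal_mult[symmetric]) (auto simp: Lp_norm_finite_le)
  qed
next
  case top
  then show ?thesis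
  proof (cases "c = 0")
    case True
    from p have "Lp_norm M p (\<lambda>x. 0 :: 'b) \<le> ennreal 0"
    proof (cases rule: Lp_exponent_cases)
      case (2 P)
      then show ?thesis using Lp_norm_finite_le[of P 0 M "\<lambda>x. 0 :: 'b"] by simp
    next
      case 1
      then show ?thesis by (subst 1, subst Lp_norm_infinity_le) auto
    qed
    then show ?thesis using True by simp
  qed (simp add: ennreal_mult_top)
qed

text \<open>The tangent inequalities at the midpoint m are added for the points a and b; their
  linear terms sum to 2 P m^P.\<close>

lemma powr_midpoint_le:
  assumes "1 \<le> P" "0 \<le> a" "0 \<le> (b::real)"
  shows "(a + b) powr P \<le> 2 powr P * ((a powr P + b powr P) / 2)"
proof (cases "a + b = 0")
  case False
  define m where "m = (a + b) / 2"
  have m: "0 < m" "a + b = 2 * m" using False assms by (auto simp: m_def)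
  have "P * m powr (P - 1) * a + P * m powr (P - 1) * b \<le> a powr P + b powr P + 2 * (P - 1) * m powr P"
    using powr_tangent[OF assms(1) m(1) assms(2)] powr_tangent[OF assms(1) m(1) assms(3)] by (simp add: algebra_simps)
  moreover have "P * m powr (P - 1) * a + P * m powr (P - 1) * b = 2 * P * m powr P"
  proof -
    have "P * m powr (P - 1) * a + P * m powr (P - 1) * b = P * m powr (P - 1) * (2 * m)"
      unfolding m(2)[symmetric] by (rule distrib_left[symmetric])
    then show ?thesis using m(1) by (simp add: powr_diff)
  qed
  ultimately have "m powr P \<le> (a powr P + b powr P) / 2" by (simp add: algebra_simps)
  then show ?thesis using m assms by (simp add: powr_mult)
next
  case True
  then show ?thesis using assms by simp
qed

text \<open>A triangle inequality for two functions with a common bound N. In this case midpoint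
  convexity of t^P suffices and yields the exact constant 2.\<close>

lemma Lp_norm_diff_le:
  fixes f g :: "'a \<Rightarrow> 'b::euclidean_space"
  assumes p: "1 \<le> p" and N: "0 \<le> N" and [measurable]: "f \<in> borel_measurable M" "g \<in> borel_measurable M"
    and f: "Lp_norm M p f \<le> ennreal N" and g: "Lp_norm M p g \<le> ennreal N"
  shows "Lp_norm M p (\<lambda>x. f x - g x) \<le> ennreal (2 * N)"
  using p
proof (cases rule: Lp_exponent_cases)
  case 1
  have "AE x in M. ennreal (norm (f x)) \<le> ennreal N" "AE x in M. ennreal (norm (g x)) \<le> ennreal N"
    using f g unfolding 1 by (subst Lp_norm_infinity_le[symmetric]; auto)+
  then have "AE x in M. ennreal (norm (f x - g x)) \<le> ennreal (2 * N)"
  proof eventually_elim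
    case (elim x)
    then show ?case using N norm_triangle_ineq4[of "f x" "g x"] by (auto simp: ennreal_le_iff intro!: ennreal_leI)
  qed
  then show ?thesis unfolding 1 by (subst Lp_norm_infinity_le) auto
next
  case (2 P)
  have I: "(\<integral>\<^sup>+x. ennreal (norm (f x) powr P) \<partial>M) \<le> ennreal (N powr P)" "(\<integral>\<^sup>+x. ennreal (norm (g x) powr P) \<partial>M) \<le> ennreal (N powr P)"
    using f g 2 N by (subst Lp_norm_finite_le[symmetric]; auto)+
  have "(\<integral>\<^sup>+x. ennreal (norm (f x - g x) powr P) \<partial>M)
     \<le> (\<integral>\<^sup>+x. ennreal (2 powr P / 2) * (ennreal (norm (f x) powr P) + ennreal (norm (g x) powr P)) \<partial>M)"
  proof (rule nn_integral_mono)
    fix x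
    have "norm (f x - g x) powr P \<le> (norm (f x) + norm (g x)) powr P"
      using 2 by (intro powr_mono2 norm_triangle_ineq4) auto
    also have "\<dots> \<le> 2 powr P / 2 * (norm (f x) powr P + norm (g x) powr P)"
      using powr_midpoint_le[of P "norm (f x)" "norm (g x)"] 2 by simp
    finally show "ennreal (norm (f x - g x) powr P)
      \<le> ennreal (2 powr P / 2) * (ennreal (norm (f x) powr P) + ennreal (norm (g x) powr P))"
      by (simp add: ennreal_plus[symmetric] ennreal_mult[symmetric] ennreal_leI del: ennreal_plus)
  qed
  also have "\<dots> = ennreal (2 powr P / 2) * ((\<integral>\<^sup>+x. ennreal (norm (f x) powr P) \<partial>M) + (\<integral>\<^sup>+x. ennreal (norm (g x) powr P) \<partial>M))"
    by (subst nn_integral_cmult, simp, subst nn_integral_add) auto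
  also have "\<dots> \<le> ennreal (2 powr P / 2) * (ennreal (N powr P) + ennreal (N powr P))"
    by (intro mult_left_mono add_mono I) auto
  also have "\<dots> = ennreal ((2 * N) powr P)"
    using N by (simp add: ennreal_plus[symmetric] ennreal_mult[symmetric] powr_mult del: ennreal_plus)
  finally show ?thesis unfolding 2(1) using 2 N by (subst Lp_norm_finite_le) auto
qed

section \<open>Mollifiers and averages at scale s\<close>

locale mollifier =
  fixes \<phi> :: "'a::euclidean_space \<Rightarrow> real" and R :: real
  assumes test: "\<phi> \<in> test_fun" and nonneg: "0 \<le> \<phi> x" and le_1: "\<phi> x \<le> 1"
    and R_pos: "0 < R" and support: "R < norm x \<Longrightarrow> \<phi> x = 0"
    and total: "(\<integral>\<^sup>+x. ennreal (\<phi> x) \<partial>lborel) = 1"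

text \<open>Unit mass and \<phi> \<le> 1 compete when the mass i of the bump is small. Spreading the
  bump by a factor s multiplies its mass by s^d, and the normalising factor c = 1/(s^d i) is at most
  1 once s is large enough.\<close>

lemma ex_mollifier: "\<exists>\<phi> R. mollifier (\<phi> :: 'a::euclidean_space \<Rightarrow> real) R"
proof -
  define \<beta> where "\<beta> = box_bump 1 (- One) (One :: 'a)"
  have \<beta>: "\<beta> \<in> test_fun" "0 \<le> \<beta> x" "\<beta> x \<le> 1" "\<beta> x = 0 \<longleftrightarrow> x \<notin> box (- One) One" for x
    by (simp_all add: \<beta>_def box_bump_test_fun box_bump_nonneg box_bump_le_1 box_bump_eq_0_iff)
  note [measurable] = test_fun_measurable[OF \<beta>(1)]
  define I where "I = (\<integral>\<^sup>+x. ennreal (\<beta> x) \<partial>lborel)"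
  have "integrable lborel (\<lambda>x. \<beta> x *\<^sub>R (1::real))"
    by (rule loc_int_test_fun_integrable[OF loc_int_continuous \<beta>(1)]) simp
  then have "I < \<infinity>" using \<beta>(2) by (simp add: I_def integrable_iff_bounded)
  moreover have "I \<noteq> 0"
  proof
    assume "I = 0"
    then have "AE x in lborel. x \<notin> box (- One) (One :: 'a)"
      using \<beta> by (subst (asm) I_def, subst (asm) nn_integral_0_iff_AE) (auto simp: ennreal_eq_0_iff order_antisym_conv)
    then have "emeasure lborel (box (- One) (One :: 'a)) = 0" by (subst (asm) AE_iff_measurable[OF _ refl]) auto
    moreover have "(\<Prod>b\<in>Basis. (One - - One :: 'a) \<bullet> b) = (\<Prod>b\<in>(Basis :: 'a set). 2)"
      by (intro prod.cong) (auto simp: inner_diff_left inner_add_left inner_minus_left)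
    ultimately show False by (subst (asm) emeasure_lborel_box) (auto simp: inner_minus_left)
  qed
  ultimately obtain i where i: "I = ennreal i" "0 < i" by (cases I) (auto simp: less_le)
  \<comment> \<open>With s \<ge> 1 one has s^d i \<ge> s i, and s \<ge> 1/i makes this at least
    1.\<close>
  define s where "s = max 1 (1 / i)"
  have s: "1 \<le> s" "1 \<le> s * i" using i by (auto simp: s_def max_def field_simps)
  have "s * i \<le> s ^ DIM('a) * i" using s i self_le_power[of s "DIM('a)"] by (intro mult_right_mono) auto
  then have si: "1 \<le> s ^ DIM('a) * i" using s by linarith
  obtain r where r: "box (- One) (One :: 'a) \<subseteq> cball 0 r" using box_subset_cball by metis
  define c where "c = 1 / (s ^ DIM('a) * i)"
  have c: "0 < c" "c \<le> 1" using si s i by (auto simp: c_def divide_le_eq_1)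
  \<comment> \<open>The maximum with 1 makes the support radius positive whatever r is.\<close>
  have "mollifier (\<lambda>x. c * \<beta> (inverse s *\<^sub>R x + 0)) (s * max 1 r)"
  proof
    show "(\<lambda>x. c * \<beta> (inverse s *\<^sub>R x + 0)) \<in> test_fun" using s by (intro test_fun_affine \<beta>) auto
    show "0 < s * max 1 r" using s by (intro mult_pos_pos) auto
    fix x
    show "0 \<le> c * \<beta> (inverse s *\<^sub>R x + 0)" "c * \<beta> (inverse s *\<^sub>R x + 0) \<le> 1"
      using c \<beta>(2,3)[of "inverse s *\<^sub>R x + 0"] by (auto intro: mult_le_one)
    show "c * \<beta> (inverse s *\<^sub>R x + 0) = 0" if "s * max 1 r < norm x"
    proof -
      have "r < norm (inverse s *\<^sub>R x)"
      proof -
        have "s * r \<le> s * max 1 r" using s by (intro mult_left_mono) auto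
        then have "s * r < norm x" using that by linarith
        then show ?thesis using s by (simp add: field_simps)
      qed
      then have "inverse s *\<^sub>R x \<notin> box (- One) (One :: 'a)" using r by auto
      then show ?thesis using \<beta>(4) by simp
    qed
  next
    have "(\<integral>\<^sup>+x. ennreal (c * \<beta> (inverse s *\<^sub>R x + 0)) \<partial>lborel)
        = ennreal (s ^ DIM('a)) * (\<integral>\<^sup>+x. ennreal (c * \<beta> x) \<partial>lborel)"
      using s by (subst nn_integral_lborel_affine[where c=s and t=0]) auto
    also have "\<dots> = ennreal (s ^ DIM('a) * c * i)"
    proof -
      have "(\<integral>\<^sup>+x. ennreal (c * \<beta> x) \<partial>lborel) = ennreal c * I"
        unfolding I_def using c \<beta>(2) by (subst nn_integral_cmult[symmetric]) (auto simp: ennreal_mult)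
      then show ?thesis using s c i by (simp add: ennreal_mult mult.assoc)
    qed
    also have "\<dots> = 1" using s i by (simp add: c_def)
    finally show "(\<integral>\<^sup>+x. ennreal (c * \<beta> (inverse s *\<^sub>R x + 0)) \<partial>lborel) = 1" .
  qed
  then show ?thesis by blast
qed

context mollifier
begin

definition K :: "'a measure" where
  "K = density lborel (\<lambda>x. ennreal (\<phi> x))"

lemma phi_measurable [measurable]: "\<phi> \<in> borel_measurable borel"
  using test by measurable

lemma sets_K [simp, measurable_cong]: "sets K = sets borel"
  by (simp add: K_def)

lemma prob_space_K: "prob_space K"
  by (rule prob_spaceI) (simp add: K_def emeasure_density total)

sublocale K: prob_space K
  by (rule prob_space_K)

sublocale T: prob_space uniform01
  by (rule prob_space_uniform01)

sublocale KT: pair_prob_space K uniform01 ..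

lemma AE_K: "AE y in K. norm y \<le> R"
proof -
  have "ennreal (\<phi> y) \<noteq> 0 \<longrightarrow> norm y \<le> R" for y
    using support[of y] by (cases "norm y \<le> R") auto
  then show ?thesis unfolding K_def by (subst AE_density) auto
qed

lemma measurable_KT [measurable]:
  "fst \<in> K \<Otimes>\<^sub>M uniform01 \<rightarrow>\<^sub>M borel" "snd \<in> K \<Otimes>\<^sub>M uniform01 \<rightarrow>\<^sub>M borel"
  using measurable_fst[of K uniform01] measurable_snd[of K uniform01]
  by (simp_all cong: measurable_cong_sets)

lemma AE_KT: "AE \<omega> in K \<Otimes>\<^sub>M uniform01. norm (fst \<omega>) \<le> R \<and> 0 \<le> snd \<omega> \<and> snd \<omega> \<le> 1"
proof (rule KT.AE_pair_measure)
  show "{x \<in> space (K \<Otimes>\<^sub>M uniform01). norm (fst x) \<le> R \<and> 0 \<le> snd x \<and> snd x \<le> 1} \<in> sets (K \<Otimes>\<^sub>M uniform01)"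
    by measurable
  show "AE x in K. AE y in uniform01. norm (fst (x, y)) \<le> R \<and> 0 \<le> snd (x, y) \<and> snd (x, y) \<le> 1"
    using AE_K
  proof eventually_elim
    case (elim x)
    show ?case using AE_uniform01 by eventually_elim (simp add: elim)
  qed
qed

definition avg :: "real \<Rightarrow> ('a \<Rightarrow> 'b::euclidean_space) \<Rightarrow> 'a \<Rightarrow> 'b" where
  "avg s f x = (\<integral>y. f (x - s *\<^sub>R y) \<partial>K)"

lemma avg_eq_lborel:
  assumes [measurable]: "f \<in> borel_measurable borel"
  shows "avg s f x = (\<integral>y. \<phi> y *\<^sub>R f (x - s *\<^sub>R y) \<partial>lborel)"
  unfolding avg_def K_def by (subst integral_density) (auto simp: nonneg)

lemma avg_integrable:
  assumes f: "loc_int f"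
  shows "integrable K (\<lambda>y. f (x - s *\<^sub>R y))"
proof (cases "s = 0")
  case False
  note [measurable] = loc_int_measurable[OF f]
  have "integrable lborel (\<lambda>y. \<phi> y *\<^sub>R f (x + (- s) *\<^sub>R y))"
    using False by (intro loc_int_test_fun_integrable loc_int_translate f test) auto
  then show ?thesis unfolding K_def by (subst integrable_density) (auto simp: nonneg)
qed simp

lemma avg_0 [simp]: "avg 0 f x = f x"
  by (simp add: avg_def K.prob_space)

lemma avg_add:
  assumes "loc_int f" "loc_int g"
  shows "avg s (\<lambda>x. a *\<^sub>R f x + b *\<^sub>R g x) x = a *\<^sub>R avg s f x + b *\<^sub>R avg s g x"
  using avg_integrable[OF assms(1)] avg_integrable[OF assms(2)] by (simp add: avg_def)

lemma avg_shift:
  assumes "loc_int f"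
  shows "avg s (\<lambda>x. f x + c) x = avg s f x + c"
  using avg_integrable[OF assms(1)] by (simp add: avg_def K.prob_space)

lemma avg_cong_AE:
  assumes [measurable]: "f \<in> borel_measurable borel" "g \<in> borel_measurable borel"
    and ae: "AE x in lborel. f x = g x" and s: "s \<noteq> 0"
  shows "avg s f x = avg s g x"
proof -
  have "AE y in lborel. f (x + (-s) *\<^sub>R y) = g (x + (-s) *\<^sub>R y)"
    by (rule AE_lborel_affine[OF _ _ ae]) (use s in auto)
  then have "AE y in K. f (x - s *\<^sub>R y) = g (x - s *\<^sub>R y)"
    unfolding K_def by (subst AE_density) auto
  then show ?thesis unfolding avg_def by (intro integral_cong_AE) auto
qed

text \<open>The kernel s^(-d) \<phi>(x/s), which turns the average at scale s into a convolution.
  The summand 0 puts it into the affine form of \<open>test_fun_affine\<close>.\<close>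

definition dilate :: "real \<Rightarrow> 'a \<Rightarrow> real" where
  "dilate s x = inverse s ^ DIM('a) * \<phi> (inverse s *\<^sub>R x + 0)"

lemma dilate_test_fun: "s \<noteq> 0 \<Longrightarrow> dilate s \<in> test_fun"
  unfolding dilate_def[abs_def] by (intro test_fun_affine test) auto

lemma avg_eq_conv:
  fixes f :: "'a \<Rightarrow> real"
  assumes f: "loc_int f" and s: "0 < s"
  shows "avg s f x = conv (dilate s) f x"
proof -
  note [measurable] = loc_int_measurable[OF f]
  have [measurable]: "dilate s \<in> borel_measurable borel" using test_fun_measurable[OF dilate_test_fun[of s]] s by simp
  have "conv (dilate s) f x = (s ^ DIM('a)) * (\<integral>y. dilate s (s *\<^sub>R y) * f (x - s *\<^sub>R y) \<partial>lborel)"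
    unfolding conv_def using s by (subst lborel_integral_affine[of _ "-s" x]) auto
  also have "\<dots> = avg s f x"
    using s by (simp add: avg_eq_lborel dilate_def power_inverse mult.assoc)
  finally show ?thesis by simp
qed

lemma avg_Ck:
  assumes "loc_int f" "0 < s"
  shows "Ck n (avg s f)"
proof -
  have "avg s f = conv (dilate s) f" by (rule ext) (rule avg_eq_conv[OF assms])
  then show ?thesis using conv_Ck[OF assms(1) dilate_test_fun] assms(2) by simp
qed

lemma avg_continuous:
  fixes f :: "'a \<Rightarrow> 'b::euclidean_space"
  assumes f: "loc_int f" and s: "0 < s"
  shows "continuous_on UNIV (avg s f)"
proof (rule continuous_on_componentwise[THEN iffD2], rule ballI)
  fix i :: 'b
  have e: "(\<lambda>x. avg s f x \<bullet> i) = avg s (\<lambda>x. f x \<bullet> i)"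
    using avg_integrable[OF f] by (simp add: avg_def fun_eq_iff)
  show "continuous_on UNIV (\<lambda>x. avg s f x \<bullet> i)"
    unfolding e by (rule Ck_imp_continuous[OF avg_Ck[OF loc_int_inner[OF f] s]])
qed

lemma avg_has_gradient:
  assumes w: "wgrad u g" and s: "0 < s"
  shows "(avg s u has_derivative (\<lambda>h. avg s g x \<bullet> h)) (at x)"
proof -
  have l: "loc_int u" "loc_int g" using w by (auto simp: wgrad_def)
  have "avg s u = conv (dilate s) u" by (rule ext) (rule avg_eq_conv[OF l(1) s])
  moreover have "conv (dilate s) (\<lambda>z. g z \<bullet> i) x = avg s g x \<bullet> i" for i
    using avg_eq_conv[OF loc_int_inner[OF l(2)] s, of i x] avg_integrable[OF l(2)] by (simp add: avg_def)
  moreover have "(\<Sum>i\<in>Basis. (h \<bullet> i) * (avg s g x \<bullet> i)) = avg s g x \<bullet> h" for h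
    by (subst euclidean_inner) (simp add: mult.commute)
  ultimately show ?thesis
    using conv_has_gradient[OF w dilate_test_fun, of s x] s by simp
qed

lemma grad_translate:
  fixes \<psi> :: "'b::euclidean_space \<Rightarrow> real"
  assumes "\<psi> \<in> test_fun"
  shows "(\<lambda>x. \<psi> (x + b)) \<in> test_fun" "grad (\<lambda>x. \<psi> (x + b)) x = grad \<psi> (x + b)"
    "partial_deriv i (\<lambda>x. \<psi> (x + b)) x = partial_deriv i \<psi> (x + b)"
  using test_fun_affine[OF assms, where a=1 and c=1 and b=b] partial_deriv_affine[OF assms, where a=1 and c=1 and b=b]
  by (simp_all add: grad_def)

text \<open>For each fixed y the weak gradient identity is applied to the translated test function;
  averaging over y and moving the translations back gives the claim by duality.\<close>

lemma wgrad_avg: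
  assumes w: "wgrad u g" and s: "0 < s"
  shows "wgrad (avg s u) (avg s g)"
  unfolding wgrad_def
proof (intro conjI ballI)
  have l: "loc_int u" "loc_int g" using w by (auto simp: wgrad_def)
  show "loc_int (avg s u)" "loc_int (avg s g)" using l s by (auto intro: loc_int_continuous avg_continuous)
  fix \<psi> :: "'a \<Rightarrow> real" and i :: 'a assume \<psi>: "\<psi> \<in> test_fun" and i: "i \<in> Basis"
  note tr = grad_translate[OF \<psi>]
  have b: "AE y in K. norm (s *\<^sub>R y) \<le> s * R" using AE_K s by (auto elim!: eventually_mono)
  have m: "(\<lambda>y. s *\<^sub>R y) \<in> borel_measurable K" by simp
  have "(\<integral>x. partial_deriv i \<psi> x * avg s u x \<partial>lborel) = (\<integral>y. (\<integral>x. partial_deriv i \<psi> (x + s *\<^sub>R y) * u x \<partial>lborel) \<partial>K)"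
    using integral_translate_average[OF prob_space_K m l(1) b _ _ test_fun_partial_deriv[OF \<psi> i], of "\<lambda>_. 1" 1]
    by (simp add: avg_def)
  also have "\<dots> = (\<integral>y. - (\<integral>x. \<psi> (x + s *\<^sub>R y) * (g x \<bullet> i) \<partial>lborel) \<partial>K)"
  proof (rule Bochner_Integration.integral_cong[OF refl])
    fix y
    have "(\<integral>x. u x * partial_deriv i (\<lambda>x. \<psi> (x + s *\<^sub>R y)) x \<partial>lborel) = - (\<integral>x. (g x \<bullet> i) * \<psi> (x + s *\<^sub>R y) \<partial>lborel)"
      using w i tr(1) unfolding wgrad_def by auto
    then show "(\<integral>x. partial_deriv i \<psi> (x + s *\<^sub>R y) * u x \<partial>lborel) = - (\<integral>x. \<psi> (x + s *\<^sub>R y) * (g x \<bullet> i) \<partial>lborel)"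
      by (simp add: tr(3) mult.commute)
  qed
  also have "\<dots> = - (\<integral>x. \<psi> x * (\<integral>y. g (x - s *\<^sub>R y) \<bullet> i \<partial>K) \<partial>lborel)"
    using integral_translate_average[OF prob_space_K m l(2) b _ _ \<psi>, of "\<lambda>_. i" 1] i by simp
  also have "\<dots> = - (\<integral>x. (avg s g x \<bullet> i) * \<psi> x \<partial>lborel)"
    using avg_integrable[OF l(2)] by (simp add: avg_def mult.commute)
  finally show "(\<integral>x. avg s u x * partial_deriv i \<psi> x \<partial>lborel) = - (\<integral>x. (avg s g x \<bullet> i) * \<psi> x \<partial>lborel)"
    by (simp add: mult.commute)
qed

lemma prob_space_KT: "prob_space (K \<Otimes>\<^sub>M uniform01)"
  by unfold_locales

text \<open>Tested against a smooth function, with the translations moved onto it, this is the fundamental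
  theorem of calculus along segments.\<close>

lemma diff_avg_weak:
  assumes w: "wgrad u g" and s: "0 < s"
  shows "AE x in lborel. u x - avg s u x
    = (\<integral>\<omega>. g (x - (snd \<omega> * s) *\<^sub>R fst \<omega>) \<bullet> (s *\<^sub>R fst \<omega>) \<partial>(K \<Otimes>\<^sub>M uniform01))"
proof -
  have l: "loc_int u" "loc_int g" using w by (auto simp: wgrad_def)
  note [measurable] = loc_int_measurable[OF l(1)] loc_int_measurable[OF l(2)]
  let ?\<mu> = "K \<Otimes>\<^sub>M uniform01"
  \<comment> \<open>For \<omega> = (y, t) the segment from x to x - s y is at x - \<tau> at time t,
    and d is s y. Formally, u x - u (x - s y) is the integral of g (x - \<tau>) \<bullet> d over
    t.\<close>
  define \<tau> where "\<tau> \<omega> = (snd \<omega> * s) *\<^sub>R fst \<omega>" for \<omega> :: "'a \<times> real"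
  define d where "d \<omega> = s *\<^sub>R fst \<omega>" for \<omega> :: "'a \<times> real"
  define E where "E x = (\<integral>\<omega>. g (x - \<tau> \<omega>) \<bullet> d \<omega> \<partial>?\<mu>)" for x
  have [measurable]: "\<tau> \<in> borel_measurable ?\<mu>" "d \<in> borel_measurable ?\<mu>"
    unfolding \<tau>_def[abs_def] d_def[abs_def] by measurable
  have bd: "AE \<omega> in ?\<mu>. norm (d \<omega>) \<le> s * R"
    using AE_KT by eventually_elim (use s in \<open>auto simp: d_def\<close>)
  have b\<tau>: "AE \<omega> in ?\<mu>. norm (\<tau> \<omega>) \<le> s * R"
    using AE_KT
  proof eventually_elim
    case (elim \<omega>)
    then have "snd \<omega> * norm (fst \<omega>) \<le> 1 * R" using R_pos by (intro mult_mono) auto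
    then show ?case using s elim by (simp add: \<tau>_def abs_mult mult_ac)
  qed
  have bK: "AE y in K. norm (s *\<^sub>R y) \<le> s * R" using AE_K s by (auto elim!: eventually_mono)
  have E: "loc_int E"
    unfolding E_def[abs_def] by (rule loc_int_translate_average[OF prob_space_KT _ l(2) b\<tau> _ bd]) measurable
  have la: "loc_int (avg s u)" using l s by (auto intro: loc_int_continuous avg_continuous)
  have "AE x in lborel. (u x - avg s u x) - E x = 0"
  proof (rule AE_eq_0_if_orthogonal_test_fun)
    have "loc_int (\<lambda>x. u x - avg s u x)" using loc_int_add[OF l(1) la, of 1 "-1"] by simp
    from loc_int_add[OF this E, of 1 "-1"] show "loc_int (\<lambda>x. u x - avg s u x - E x)" by simp
    fix \<psi> :: "'a \<Rightarrow> real" assume \<psi>: "\<psi> \<in> test_fun"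
    note tr = grad_translate[OF \<psi>]
    note [measurable] = test_fun_measurable[OF \<psi>] borel_measurable_continuous_onI[OF grad_continuous[OF \<psi>]]
    obtain C where C: "\<And>x. C < norm x \<Longrightarrow> \<psi> x = 0" using test_fun_support[OF \<psi>] by metis
    obtain D where D: "\<And>x. \<bar>\<psi> x\<bar> \<le> D" using test_fun_bounded[OF \<psi>] by metis
    obtain D' where D': "\<And>x. norm (grad \<psi> x) \<le> D'" using test_fun_grad_bounded[OF \<psi>] by metis
    have far: "C < norm (x + y)" if "norm y \<le> s * R" "x \<notin> cball 0 (C + s * R)" for x y :: 'a
      using that norm_triangle_ineq4[of "x + y" y] by simp
    have gb: "norm (grad \<psi> z \<bullet> d \<omega>) \<le> D' * (s * R)" if "norm (d \<omega>) \<le> s * R" for z \<omega>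
    proof -
      have "norm (grad \<psi> z) * norm (d \<omega>) \<le> D' * (s * R)"
        using that by (intro mult_mono D' order_trans[OF norm_ge_zero D']) auto
      then show ?thesis using Cauchy_Schwarz_ineq2[of "grad \<psi> z" "d \<omega>"] by simp
    qed
    interpret P: pair_sigma_finite lborel ?\<mu> ..
    interpret Q: pair_sigma_finite lborel K ..
    \<comment> \<open>The translation now sits in the kernel, so u is shifted by 0 and the support
      radius grows by s R.\<close>
    have i1: "integrable (lborel \<Otimes>\<^sub>M ?\<mu>) (\<lambda>(x, \<omega>). u (x - 0) \<bullet> (grad \<psi> (x + \<tau> \<omega>) \<bullet> d \<omega>))"
    proof (rule integrable_pair_translate[OF prob_space_KT _ l(1), where B="D' * (s * R)" and C="C + s * R" and \<rho>=0])
      show "AE \<omega> in ?\<mu>. \<forall>x. norm (grad \<psi> (x + \<tau> \<omega>) \<bullet> d \<omega>) \<le> D' * (s * R)"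
        using bd by eventually_elim (use gb in auto)
      show "AE \<omega> in ?\<mu>. \<forall>x. x \<notin> cball 0 (C + s * R) \<longrightarrow> grad \<psi> (x + \<tau> \<omega>) \<bullet> d \<omega> = 0"
        using b\<tau> by eventually_elim (use far grad_eq_0[of C \<psi>, OF C] in auto)
      show "(\<lambda>(x, \<omega>). grad \<psi> (x + \<tau> \<omega>) \<bullet> d \<omega>) \<in> borel_measurable (lborel \<Otimes>\<^sub>M ?\<mu>)" by measurable
    qed simp_all
    have i2: "integrable (lborel \<Otimes>\<^sub>M K) (\<lambda>(x, y). u (x - 0) \<bullet> \<psi> (x + s *\<^sub>R y))"
    proof (rule integrable_pair_translate[OF prob_space_K _ l(1), where B=D and C="C + s * R" and \<rho>=0])
      show "AE y in K. \<forall>x. x \<notin> cball 0 (C + s * R) \<longrightarrow> \<psi> (x + s *\<^sub>R y) = 0"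
        using bK by eventually_elim (use far C in blast)
      show "(\<lambda>(x, y). \<psi> (x + s *\<^sub>R y)) \<in> borel_measurable (lborel \<Otimes>\<^sub>M K)" by measurable
    qed (use D in simp_all)
    \<comment> \<open>The fundamental theorem of calculus along the segment from x to x + s y,
      applied to the smooth \<psi> in place of u.\<close>
    have inner: "(\<integral>\<omega>. grad \<psi> (x + \<tau> \<omega>) \<bullet> d \<omega> \<partial>?\<mu>) = (\<integral>y. \<psi> (x + s *\<^sub>R y) \<partial>K) - \<psi> x" for x
    proof -
      have "integrable ?\<mu> (\<lambda>\<omega>. grad \<psi> (x + \<tau> \<omega>) \<bullet> d \<omega>)"
      proof (rule KT.P.integrable_const_bound[of _ "D' * (s * R)"])
        show "AE \<omega> in ?\<mu>. norm (grad \<psi> (x + \<tau> \<omega>) \<bullet> d \<omega>) \<le> D' * (s * R)"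
          using bd by eventually_elim (use gb in auto)
      qed measurable
      from KT.integral_fst'[OF this, symmetric]
      have "(\<integral>\<omega>. grad \<psi> (x + \<tau> \<omega>) \<bullet> d \<omega> \<partial>?\<mu>) = (\<integral>y. (\<integral>t. grad \<psi> (x + t *\<^sub>R (s *\<^sub>R y)) \<bullet> (s *\<^sub>R y) \<partial>uniform01) \<partial>K)"
        by (simp only: \<tau>_def d_def fst_conv snd_conv scaleR_scaleR)
      also have "\<dots> = (\<integral>y. \<psi> (x + s *\<^sub>R y) - \<psi> x \<partial>K)"
        by (subst integral_gradient_segment[OF test_fun_grad[OF \<psi>] grad_continuous[OF \<psi>]]) simp
      also have "\<dots> = (\<integral>y. \<psi> (x + s *\<^sub>R y) \<partial>K) - \<psi> x"
      proof -
        have "integrable K (\<lambda>y. \<psi> (x + s *\<^sub>R y))"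
          by (rule K.integrable_const_bound[of _ D]) (use D in auto)
        then show ?thesis by (simp add: K.prob_space)
      qed
      finally show ?thesis .
    qed
    have "(\<integral>x. \<psi> x * E x \<partial>lborel) = (\<integral>\<omega>. (\<integral>x. \<psi> (x + \<tau> \<omega>) * (g x \<bullet> d \<omega>) \<partial>lborel) \<partial>?\<mu>)"
      unfolding E_def by (rule integral_translate_average[OF prob_space_KT _ l(2) b\<tau> _ bd \<psi>]) measurable
    also have "\<dots> = (\<integral>\<omega>. - (\<integral>x. u x * (grad \<psi> (x + \<tau> \<omega>) \<bullet> d \<omega>) \<partial>lborel) \<partial>?\<mu>)"
      by (subst wgrad_direction[OF w tr(1)]) (simp add: tr(2))
    also have "\<dots> = - (\<integral>x. (\<integral>\<omega>. u x * (grad \<psi> (x + \<tau> \<omega>) \<bullet> d \<omega>) \<partial>?\<mu>) \<partial>lborel)"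
      using P.Fubini_integral[OF i1] by simp
    also have "\<dots> = - (\<integral>x. u x * (\<integral>y. \<psi> (x + s *\<^sub>R y) \<partial>K) - u x * \<psi> x \<partial>lborel)"
      by (simp add: inner right_diff_distrib)
    also have "\<dots> = (\<integral>x. u x * \<psi> x \<partial>lborel) - (\<integral>x. u x * (\<integral>y. \<psi> (x + s *\<^sub>R y) \<partial>K) \<partial>lborel)"
      using Q.integrable_fst[OF i2] loc_int_test_fun_integrable[OF l(1) \<psi>] by (simp add: mult.commute)
    also have "(\<integral>x. u x * (\<integral>y. \<psi> (x + s *\<^sub>R y) \<partial>K) \<partial>lborel) = (\<integral>y. (\<integral>x. \<psi> (x + s *\<^sub>R y) * u x \<partial>lborel) \<partial>K)"
      using Q.Fubini_integral[OF i2] by (simp add: mult.commute)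
    also have "\<dots> = (\<integral>x. \<psi> x * avg s u x \<partial>lborel)"
      using integral_translate_average[OF prob_space_K _ l(1) bK _ _ \<psi>, of "\<lambda>_. 1" 1] by (simp add: avg_def)
    finally have "(\<integral>x. \<psi> x * E x \<partial>lborel) = (\<integral>x. \<psi> x * u x \<partial>lborel) - (\<integral>x. \<psi> x * avg s u x \<partial>lborel)"
      by (simp add: mult.commute)
    then show "(\<integral>x. (u x - avg s u x - E x) * \<psi> x \<partial>lborel) = 0"
      using loc_int_test_fun_integrable[OF l(1) \<psi>] loc_int_test_fun_integrable[OF la \<psi>] loc_int_test_fun_integrable[OF E \<psi>]
      by (simp add: mult.commute[of _ "\<psi> _"] right_diff_distrib)
  qed
  then show ?thesis by eventually_elim (simp add: E_def \<tau>_def d_def)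
qed

end

text \<open>A classical gradient with continuity built in, so that it can be integrated along every
  segment. Mollified functions and their truncations are of this kind, and the estimates for them
  hold at every point.\<close>

definition c1_grad :: "('a::euclidean_space \<Rightarrow> real) \<Rightarrow> ('a \<Rightarrow> 'a) \<Rightarrow> bool" where
  "c1_grad v G \<longleftrightarrow> (\<forall>x. (v has_derivative (\<lambda>h. G x \<bullet> h)) (at x)) \<and> continuous_on UNIV G"

lemma c1_grad_continuous: "c1_grad v G \<Longrightarrow> continuous_on UNIV v"
  by (auto simp: c1_grad_def intro!: continuous_at_imp_continuous_on has_derivative_continuous)

lemma c1_grad_measurable: "c1_grad v G \<Longrightarrow> v \<in> borel_measurable borel" "c1_grad v G \<Longrightarrow> G \<in> borel_measurable borel"
  using c1_grad_continuous by (auto simp: c1_grad_def intro: borel_measurable_continuous_onI)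

lemma c1_grad_loc_int: "c1_grad v G \<Longrightarrow> loc_int v"
  by (intro loc_int_continuous c1_grad_continuous)

lemma c1_grad_segment_le:
  assumes "c1_grad v G"
  shows "ennreal \<bar>v (a + h) - v a\<bar> \<le> (\<integral>\<^sup>+t. ennreal (norm (G (a + t *\<^sub>R h)) * norm h) \<partial>uniform01)"
proof -
  have "ennreal \<bar>v (a + h) - v a\<bar> \<le> (\<integral>\<^sup>+t. ennreal (norm (G (a + t *\<^sub>R h) \<bullet> h)) \<partial>uniform01)"
    using norm_integral_le_nn_integral[of uniform01 "\<lambda>t. G (a + t *\<^sub>R h) \<bullet> h"] integral_gradient_segment[of v G a h] assms
    by (auto simp: c1_grad_def)
  also have "\<dots> \<le> (\<integral>\<^sup>+t. ennreal (norm (G (a + t *\<^sub>R h)) * norm h) \<partial>uniform01)"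
    by (intro nn_integral_mono ennreal_leI) (use Cauchy_Schwarz_ineq2 in auto)
  finally show ?thesis .
qed

lemma c1_grad_lipschitz:
  assumes v: "c1_grad v G" and N: "\<And>x. norm (G x) \<le> N"
  shows "\<bar>v b - v a\<bar> \<le> N * norm (b - a)"
proof -
  have "norm (v b - v a) \<le> N * norm (b - a)"
  proof (rule differentiable_bound)
    show "(v has_derivative (\<lambda>h. G x \<bullet> h)) (at x within UNIV)" for x using v by (simp add: c1_grad_def)
    show "onorm ((\<bullet>) (G x)) \<le> N" for x
    proof (rule onorm_le)
      fix h
      have "norm (G x \<bullet> h) \<le> norm (G x) * norm h" using Cauchy_Schwarz_ineq2[of "G x" h] by simp
      also have "\<dots> \<le> N * norm h" by (intro mult_right_mono N) auto
      finally show "norm (G x \<bullet> h) \<le> N * norm h" .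
    qed
  qed auto
  then show ?thesis by simp
qed

section \<open>Comparing averages across scales and base points\<close>

context mollifier
begin

text \<open>By \<open>diff_avg_weak\<close> the difference is dominated by an average of translates
  of s R |g|, since |s y| \<le> s R almost surely, and averaging translates does not increase an L^p
  norm.\<close>

lemma diff_avg_Lp:
  assumes w: "wgrad u g" and s: "0 < s" and p: "1 \<le> p"
  shows "Lp_norm lborel p (\<lambda>x. u x - avg s u x) \<le> ennreal (s * R) * Lp_norm lborel p g"
proof -
  have l: "loc_int u" "loc_int g" using w by (auto simp: wgrad_def)
  note [measurable] = loc_int_measurable[OF l(1)] loc_int_measurable[OF l(2)]
    borel_measurable_continuous_onI[OF avg_continuous[OF l(1) s]]
  have "Lp_norm lborel p (\<lambda>x. u x - avg s u x) \<le> Lp_norm lborel p (\<lambda>x. (s * R) *\<^sub>R g x)"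
  proof (rule Lp_norm_average_le[OF prob_space_KT _ _ _ p])
    show "(\<lambda>\<omega>. (snd \<omega> * s) *\<^sub>R fst \<omega>) \<in> borel_measurable (K \<Otimes>\<^sub>M uniform01)" by measurable
    show "AE x in lborel. ennreal (norm (u x - avg s u x))
      \<le> (\<integral>\<^sup>+\<omega>. ennreal (norm ((s * R) *\<^sub>R g (x - (snd \<omega> * s) *\<^sub>R fst \<omega>))) \<partial>(K \<Otimes>\<^sub>M uniform01))"
      using diff_avg_weak[OF w s]
    proof eventually_elim
      case (elim x)
      have "ennreal (norm (u x - avg s u x))
          \<le> (\<integral>\<^sup>+\<omega>. ennreal (norm (g (x - (snd \<omega> * s) *\<^sub>R fst \<omega>) \<bullet> (s *\<^sub>R fst \<omega>))) \<partial>(K \<Otimes>\<^sub>M uniform01))"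
        unfolding elim by (rule norm_integral_le_nn_integral)
      also have "\<dots> \<le> (\<integral>\<^sup>+\<omega>. ennreal (norm ((s * R) *\<^sub>R g (x - (snd \<omega> * s) *\<^sub>R fst \<omega>))) \<partial>(K \<Otimes>\<^sub>M uniform01))"
      proof (rule nn_integral_mono_AE, use AE_KT in eventually_elim, rule ennreal_leI)
        fix \<omega> :: "'a \<times> real" assume "norm (fst \<omega>) \<le> R \<and> 0 \<le> snd \<omega> \<and> snd \<omega> \<le> 1"
        then have "norm z * norm (s *\<^sub>R fst \<omega>) \<le> norm z * (s * R)" for z :: 'a
          using s by (intro mult_left_mono) auto
        then have "norm (z \<bullet> (s *\<^sub>R fst \<omega>)) \<le> norm ((s * R) *\<^sub>R z)" for z
          unfolding norm_scaleR[of "s * R"] using Cauchy_Schwarz_ineq2[of z "s *\<^sub>R fst \<omega>"] s R_pos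
          by (simp only: real_norm_def abs_of_pos[OF mult_pos_pos[OF s R_pos]] mult.commute[of "s * R"]) (meson order_trans)
        then show "norm (g (x - (snd \<omega> * s) *\<^sub>R fst \<omega>) \<bullet> (s *\<^sub>R fst \<omega>)) \<le> norm ((s * R) *\<^sub>R g (x - (snd \<omega> * s) *\<^sub>R fst \<omega>))" .
      qed
      finally show ?case .
    qed
  qed measurable
  also have "\<dots> \<le> ennreal (s * R) * Lp_norm lborel p g"
    using Lp_norm_scaleR_le[OF p, of g lborel "s * R"] s R_pos by simp
  finally show ?thesis .
qed

lemma avg_Lp:
  fixes g :: "'a \<Rightarrow> 'b::euclidean_space"
  assumes g: "loc_int g" and s: "0 < s" and p: "1 \<le> p"
  shows "Lp_norm lborel p (avg s g) \<le> Lp_norm lborel p g"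
proof (rule Lp_norm_average_le[OF prob_space_K _ _ _ p])
  show "(\<lambda>y. s *\<^sub>R y) \<in> borel_measurable K" by simp
  show "AE x in lborel. ennreal (norm (avg s g x)) \<le> (\<integral>\<^sup>+y. ennreal (norm (g (x - s *\<^sub>R y))) \<partial>K)"
    unfolding avg_def by (intro AE_I2 norm_integral_le_nn_integral)
  show "avg s g \<in> borel_measurable borel"
    by (intro borel_measurable_continuous_onI avg_continuous g s)
qed (rule loc_int_measurable[OF g])

text \<open>The exponent d/p: an average at scale s of an L^p function is of order s^(-d/p). Its
  position relative to 1 separates the three growth regimes.\<close>

definition decay :: "ennreal \<Rightarrow> real" where
  "decay p = DIM('a) * rexp p"

lemma nn_average_le:
  fixes g :: "'a \<Rightarrow> 'b::euclidean_space"
  assumes g: "g \<in> borel_measurable borel" and s: "0 < s" and p: "1 \<le> p" and N: "0 \<le> N" "Lp_norm lborel p g \<le> ennreal N"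
  shows "(\<integral>\<^sup>+y. ennreal (norm (g (x - s *\<^sub>R y))) \<partial>K) \<le> ennreal (s powr (- decay p) * N)"
proof -
  have *: "a \<le> s powr (- decay p) * N" if "0 \<le> a" "ennreal a \<le> (\<integral>\<^sup>+y. ennreal (norm (g (x - s *\<^sub>R y))) \<partial>K)" for a
    unfolding decay_def
    by (rule average_le_scaled_Lp_norm[OF phi_measurable nonneg le_1 prob_space_K[unfolded K_def] g p s that(1) N, of x])
       (use that(2) in \<open>simp add: K_def\<close>)
  show ?thesis
  proof (cases "\<integral>\<^sup>+y. ennreal (norm (g (x - s *\<^sub>R y))) \<partial>K")
    case (real a)
    then show ?thesis using *[of a] by (simp add: ennreal_leI)
  next
    case top
    \<comment> \<open>An infinite average would dominate every real a, including one that exceeds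
      the bound.\<close>
    then show ?thesis using *[of "s powr (- decay p) * N + 1"] N by simp
  qed
qed

lemma avg_pointwise:
  fixes g :: "'a \<Rightarrow> 'b::euclidean_space"
  assumes g: "g \<in> borel_measurable borel" and s: "0 < s" and p: "1 \<le> p" and N: "0 \<le> N" "Lp_norm lborel p g \<le> ennreal N"
  shows "norm (avg s g x) \<le> s powr (- decay p) * N"
proof -
  have "ennreal (norm (avg s g x)) \<le> (\<integral>\<^sup>+y. ennreal (norm (g (x - s *\<^sub>R y))) \<partial>K)"
    unfolding avg_def by (rule norm_integral_le_nn_integral)
  also note nn_average_le[OF assms]
  finally show ?thesis using N by (simp add: ennreal_le_iff)
qed

text \<open>The function u minus \<open>avg e u\<close> has L^p norm at most e R N, and averaging it
  at scale s gains the factor s^(-d/p). This transfers limits over growing scales between u and its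
  mollifications.\<close>

lemma avg_avg_close:
  assumes w: "wgrad u g" and e: "0 < e" and s: "0 < s" and p: "1 \<le> p" and N: "0 \<le> N" "Lp_norm lborel p g \<le> ennreal N"
  shows "\<bar>avg s (avg e u) x - avg s u x\<bar> \<le> s powr (- decay p) * (e * R * N)"
proof -
  have l: "loc_int u" "loc_int (avg e u)"
    using w e by (auto simp: wgrad_def intro: loc_int_continuous avg_continuous)
  note [measurable] = loc_int_measurable[OF l(1)] loc_int_measurable[OF l(2)]
  have "Lp_norm lborel p (\<lambda>x. u x - avg e u x) \<le> ennreal (e * R) * ennreal N"
    using diff_avg_Lp[OF w e p] N(2) by (meson mult_left_mono order_trans zero_le)
  then have "norm (avg s (\<lambda>x. u x - avg e u x) x) \<le> s powr (- decay p) * (e * R * N)"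
    using e N R_pos by (intro avg_pointwise[OF _ s p]) (auto simp: ennreal_mult)
  moreover have "avg s (\<lambda>x. u x - avg e u x) x = avg s u x - avg s (avg e u) x"
    using avg_add[OF l, of s 1 "-1" x] by simp
  ultimately show ?thesis by (simp add: abs_minus_commute)
qed

text \<open>The scale moves linearly from r to S; for each y in the support the point x - s y
  travels along a segment of length at most |S - r| R. The case r = 0 compares v itself with an
  average, as \<open>avg 0\<close> is the identity.\<close>

lemma c1_avg_diff:
  assumes v: "c1_grad v G"
  shows "ennreal \<bar>avg S v x - avg r v x\<bar> \<le>
    (\<integral>\<^sup>+\<omega>. ennreal (\<bar>S - r\<bar> * R * norm (G (x - (r + snd \<omega> * (S - r)) *\<^sub>R fst \<omega>))) \<partial>(K \<Otimes>\<^sub>M uniform01))"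
proof -
  note [measurable] = c1_grad_measurable[OF v]
  note i = avg_integrable[OF c1_grad_loc_int[OF v]]
  have "ennreal \<bar>avg S v x - avg r v x\<bar> = ennreal (norm (\<integral>y. v (x - S *\<^sub>R y) - v (x - r *\<^sub>R y) \<partial>K))"
    using i by (simp add: avg_def)
  also have "\<dots> \<le> (\<integral>\<^sup>+y. ennreal (norm (v (x - S *\<^sub>R y) - v (x - r *\<^sub>R y))) \<partial>K)"
    by (rule norm_integral_le_nn_integral)
  also have "\<dots> \<le> (\<integral>\<^sup>+y. (\<integral>\<^sup>+t. ennreal (\<bar>S - r\<bar> * R * norm (G (x - (r + t * (S - r)) *\<^sub>R y))) \<partial>uniform01) \<partial>K)"
  proof (rule nn_integral_mono_AE, use AE_K in eventually_elim)
    case (elim y)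
    have e: "x - r *\<^sub>R y + (- (S - r)) *\<^sub>R y = x - S *\<^sub>R y" "x - r *\<^sub>R y + t *\<^sub>R ((- (S - r)) *\<^sub>R y) = x - (r + t * (S - r)) *\<^sub>R y" for t
      by (simp_all add: algebra_simps)
    have "ennreal (norm (v (x - S *\<^sub>R y) - v (x - r *\<^sub>R y)))
        \<le> (\<integral>\<^sup>+t. ennreal (norm (G (x - (r + t * (S - r)) *\<^sub>R y)) * norm ((- (S - r)) *\<^sub>R y)) \<partial>uniform01)"
      using c1_grad_segment_le[OF v, of "x - r *\<^sub>R y" "(- (S - r)) *\<^sub>R y"] unfolding e by simp
    also have "\<dots> \<le> (\<integral>\<^sup>+t. ennreal (\<bar>S - r\<bar> * R * norm (G (x - (r + t * (S - r)) *\<^sub>R y))) \<partial>uniform01)"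
    proof (intro nn_integral_mono ennreal_leI)
      fix t
      have "norm ((- (S - r)) *\<^sub>R y) \<le> \<bar>S - r\<bar> * R" unfolding norm_scaleR using elim by (intro mult_mono) auto
      from mult_right_mono[OF this, of "norm (G (x - (r + t * (S - r)) *\<^sub>R y))"]
      show "norm (G (x - (r + t * (S - r)) *\<^sub>R y)) * norm ((- (S - r)) *\<^sub>R y) \<le> \<bar>S - r\<bar> * R * norm (G (x - (r + t * (S - r)) *\<^sub>R y))"
        by (simp only: mult.commute mult.left_commute norm_ge_zero)
    qed
    finally show ?case .
  qed
  also have "\<dots> = (\<integral>\<^sup>+\<omega>. ennreal (\<bar>S - r\<bar> * R * norm (G (x - (r + snd \<omega> * (S - r)) *\<^sub>R fst \<omega>))) \<partial>(K \<Otimes>\<^sub>M uniform01))"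
    by (subst T.nn_integral_fst[symmetric]) auto
  finally show ?thesis .
qed

lemma c1_diff_avg_Lp:
  assumes v: "c1_grad v G" and s: "0 < s" and p: "1 \<le> p"
  shows "Lp_norm lborel p (\<lambda>x. v x - avg s v x) \<le> ennreal (s * R) * Lp_norm lborel p G"
proof -
  note [measurable] = c1_grad_measurable[OF v] borel_measurable_continuous_onI[OF avg_continuous[OF c1_grad_loc_int[OF v] s]]
  have "Lp_norm lborel p (\<lambda>x. v x - avg s v x) \<le> Lp_norm lborel p (\<lambda>x. (s * R) *\<^sub>R G x)"
  proof (rule Lp_norm_average_le[OF prob_space_KT _ _ _ p])
    show "(\<lambda>\<omega>. (snd \<omega> * s) *\<^sub>R fst \<omega>) \<in> borel_measurable (K \<Otimes>\<^sub>M uniform01)" by measurable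
    show "AE x in lborel. ennreal (norm (v x - avg s v x))
      \<le> (\<integral>\<^sup>+\<omega>. ennreal (norm ((s * R) *\<^sub>R G (x - (snd \<omega> * s) *\<^sub>R fst \<omega>))) \<partial>(K \<Otimes>\<^sub>M uniform01))"
      using c1_avg_diff[OF v, of s _ 0] s R_pos by (intro AE_I2) (simp add: abs_minus_commute)
  qed measurable
  also have "\<dots> \<le> ennreal (s * R) * Lp_norm lborel p G"
    using Lp_norm_scaleR_le[OF p, of G lborel "s * R"] s R_pos by simp
  finally show ?thesis .
qed

text \<open>Averaging over y first gives the bound s^(-d/p) N at every intermediate scale s, and
  only then s is integrated. Leaving the antiderivative F open treats powers and the logarithm
  together.\<close>

lemma avg_scale_diff:
  assumes v: "c1_grad v G" and p: "1 \<le> p" and N: "0 \<le> N" "Lp_norm lborel p G \<le> ennreal N"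
    and r: "0 < r" "r \<le> S" and F: "\<And>s. r \<le> s \<Longrightarrow> s \<le> S \<Longrightarrow> (F has_real_derivative s powr (- decay p)) (at s)"
  shows "\<bar>avg S v x - avg r v x\<bar> \<le> R * N * (F S - F r)"
proof -
  note [measurable] = c1_grad_measurable[OF v]
  define s where "s t = r + t * (S - r)" for t
  have s: "r \<le> s t" "s t \<le> S" if "0 \<le> t" "t \<le> 1" for t
    using that r mult_left_le_one_le[of "S - r" t] by (auto simp: s_def)
  have "ennreal \<bar>avg S v x - avg r v x\<bar> \<le> (\<integral>\<^sup>+\<omega>. ennreal ((S - r) * R * norm (G (x - s (snd \<omega>) *\<^sub>R fst \<omega>))) \<partial>(K \<Otimes>\<^sub>M uniform01))"
    using c1_avg_diff[OF v, of S x r] r by (simp add: s_def)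
  also have "\<dots> = (\<integral>\<^sup>+t. (\<integral>\<^sup>+y. ennreal ((S - r) * R * norm (G (x - s t *\<^sub>R y))) \<partial>K) \<partial>uniform01)"
    by (subst KT.nn_integral_snd[symmetric]) (auto simp: s_def)
  also have "\<dots> \<le> (\<integral>\<^sup>+t. ennreal (R * N * (s t powr (- decay p) * (S - r))) \<partial>uniform01)"
  proof (rule nn_integral_mono_AE, use AE_uniform01 in eventually_elim)
    case (elim t)
    have "(\<integral>\<^sup>+y. ennreal ((S - r) * R * norm (G (x - s t *\<^sub>R y))) \<partial>K)
        = ennreal ((S - r) * R) * (\<integral>\<^sup>+y. ennreal (norm (G (x - s t *\<^sub>R y))) \<partial>K)"
      using r R_pos by (subst nn_integral_cmult[symmetric]) (auto simp: ennreal_mult)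
    also have "\<dots> \<le> ennreal ((S - r) * R) * ennreal (s t powr (- decay p) * N)"
      using s[of t] elim r by (intro mult_left_mono nn_average_le p N) auto
    also have "\<dots> = ennreal (R * N * (s t powr (- decay p) * (S - r)))"
      using r R_pos N by (simp add: ennreal_mult[symmetric] mult_ac)
    finally show ?case .
  qed
  also have "\<dots> = (\<integral>\<^sup>+t. ennreal (R * N * (s t powr (- decay p) * (S - r))) * indicator {0..1} t \<partial>lborel)"
    by (rule nn_integral_uniform01) (auto simp: s_def)
  also have "\<dots> = ennreal (R * N * F (s 1) - R * N * F (s 0))"
  proof (rule nn_integral_FTC_Icc)
    fix t :: real assume t: "t \<in> {0..1}"
    have "((\<lambda>t. F (s t)) has_real_derivative s t powr (- decay p) * (S - r)) (at t)"
      by (rule DERIV_chain'[where f=s and g=F]) (use s[of t] t in \<open>auto simp: s_def[abs_def] intro!: F derivative_eq_intros\<close>)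
    then show "((\<lambda>t. R * N * F (s t)) has_real_derivative R * N * (s t powr (- decay p) * (S - r))) (at t)"
      by (rule DERIV_cmult)
    show "0 \<le> R * N * (s t powr (- decay p) * (S - r))" using r R_pos N by simp
  qed (auto simp: s_def)
  finally have "ennreal \<bar>avg S v x - avg r v x\<bar> \<le> ennreal (R * N * (F S - F r))"
    by (simp add: s_def right_diff_distrib)
  moreover have "F r \<le> F S"
    using r F by (intro DERIV_nonneg_imp_nondecreasing[of r S F]) (auto intro: powr_ge_zero)
  ultimately show ?thesis using R_pos N by (simp add: ennreal_le_iff)
qed

text \<open>At a fixed scale the whole average moves along the segment from 0 to x, and the gradient
  averaged at scale S is at most S^(-d/p) N at each of its points.\<close>

lemma avg_translate_diff:
  assumes v: "c1_grad v G" and p: "1 \<le> p" and N: "0 \<le> N" "Lp_norm lborel p G \<le> ennreal N" and S: "0 < S"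
  shows "\<bar>avg S v x - avg S v 0\<bar> \<le> norm x * (S powr (- decay p) * N)"
proof -
  note [measurable] = c1_grad_measurable[OF v]
  note i = avg_integrable[OF c1_grad_loc_int[OF v]]
  have "ennreal \<bar>avg S v x - avg S v 0\<bar> = ennreal (norm (\<integral>y. v (x - S *\<^sub>R y) - v (0 - S *\<^sub>R y) \<partial>K))"
    using i[of x S] i[of 0 S] by (simp add: avg_def)
  also have "\<dots> \<le> (\<integral>\<^sup>+y. ennreal (norm (v (x - S *\<^sub>R y) - v (0 - S *\<^sub>R y))) \<partial>K)"
    by (rule norm_integral_le_nn_integral)
  also have "\<dots> \<le> (\<integral>\<^sup>+y. (\<integral>\<^sup>+t. ennreal (norm x * norm (G (t *\<^sub>R x - S *\<^sub>R y))) \<partial>uniform01) \<partial>K)"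
    using c1_grad_segment_le[OF v, of "- S *\<^sub>R y" x for y] by (intro nn_integral_mono) (simp add: mult.commute add.commute)
  also have "\<dots> = (\<integral>\<^sup>+t. (\<integral>\<^sup>+y. ennreal (norm x * norm (G (t *\<^sub>R x - S *\<^sub>R y))) \<partial>K) \<partial>uniform01)"
    by (rule KT.Fubini'[symmetric]) measurable
  also have "\<dots> \<le> (\<integral>\<^sup>+t. ennreal (norm x * (S powr (- decay p) * N)) \<partial>uniform01)"
  proof (rule nn_integral_mono)
    fix t
    have "(\<integral>\<^sup>+y. ennreal (norm x * norm (G (t *\<^sub>R x - S *\<^sub>R y))) \<partial>K) = ennreal (norm x) * (\<integral>\<^sup>+y. ennreal (norm (G (t *\<^sub>R x - S *\<^sub>R y))) \<partial>K)"
      by (subst nn_integral_cmult[symmetric]) (auto simp: ennreal_mult)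
    also have "\<dots> \<le> ennreal (norm x) * ennreal (S powr (- decay p) * N)"
      by (intro mult_left_mono nn_average_le p N S) auto
    finally show "(\<integral>\<^sup>+y. ennreal (norm x * norm (G (t *\<^sub>R x - S *\<^sub>R y))) \<partial>K) \<le> ennreal (norm x * (S powr (- decay p) * N))"
      using N by (simp add: ennreal_mult)
  qed
  also have "\<dots> = ennreal (norm x * (S powr (- decay p) * N))" by (simp add: T.emeasure_space_1)
  finally show ?thesis using N by (simp add: ennreal_le_iff)
qed

text \<open>A local estimate: only gradient values within distance s R of x enter. It serves with a
  global gradient bound for growth, and with a bound valid far out for decay at infinity.\<close>

lemma c1_diff_avg_le:
  assumes v: "c1_grad v G" and N: "\<And>y. norm (y - x) \<le> s * R \<Longrightarrow> norm (G y) \<le> N" and s: "0 \<le> s"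
  shows "\<bar>v x - avg s v x\<bar> \<le> s * R * N"
proof -
  have N0: "0 \<le> N" using N[of x] s R_pos by (auto intro: order_trans[OF norm_ge_zero])
  have "ennreal \<bar>avg s v x - avg 0 v x\<bar> \<le> (\<integral>\<^sup>+\<omega>. ennreal (s * R * norm (G (x - (snd \<omega> * s) *\<^sub>R fst \<omega>))) \<partial>(K \<Otimes>\<^sub>M uniform01))"
    using c1_avg_diff[OF v, of s x 0] s by simp
  also have "\<dots> \<le> (\<integral>\<^sup>+\<omega>. ennreal (s * R * N) \<partial>(K \<Otimes>\<^sub>M uniform01))"
  proof (rule nn_integral_mono_AE, use AE_KT in eventually_elim)
    case (elim \<omega>)
    have "snd \<omega> * norm (fst \<omega>) \<le> 1 * R" using elim R_pos by (intro mult_mono) auto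
    then have "s * (snd \<omega> * norm (fst \<omega>)) \<le> s * R" using s by (intro mult_left_mono) auto
    then have "norm (G (x - (snd \<omega> * s) *\<^sub>R fst \<omega>)) \<le> N"
      using s elim by (intro N) (simp add: abs_mult mult_ac)
    then show ?case using s R_pos by (intro ennreal_leI mult_left_mono) auto
  qed
  also have "\<dots> = ennreal (s * R * N)"
    by (simp add: KT.P.emeasure_space_1)
  finally show ?thesis using N0 s R_pos by (simp add: ennreal_le_iff abs_minus_commute)
qed

text \<open>The path from v x to v 0 = 0 goes up in scale to 1 and on to S, across from x to 0 at
  scale S, and down again. Up to scale 1 the sup bound on G is used, beyond it the L^p bound; for
  \<open>avg 1 g\<close> both hold with the same N.\<close>

lemma growth_bound:
  fixes v :: "'a \<Rightarrow> real"
  assumes v: "c1_grad v G" and p: "1 \<le> p" and N: "Lp_norm lborel p G \<le> ennreal N" "\<And>x. norm (G x) \<le> N"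
    and v0: "v 0 = 0" and S: "1 \<le> S" and F: "\<And>s. 0 < s \<Longrightarrow> (F has_real_derivative s powr (- decay p)) (at s)"
  shows "\<bar>v x\<bar> \<le> 2 * R * N + 2 * R * N * (F S - F 1) + norm x * (S powr (- decay p) * N)"
proof -
  have N0: "0 \<le> N" using N(2)[of 0] norm_ge_zero order_trans by blast
  have 1: "\<bar>v y - avg 1 v y\<bar> \<le> R * N" for y using c1_diff_avg_le[OF v, of y 1 N] N(2) by simp
  have 2: "\<bar>avg S v y - avg 1 v y\<bar> \<le> R * N * (F S - F 1)" for y
    by (rule avg_scale_diff[OF v p N0 N(1)]) (use S F in auto)
  have 3: "\<bar>avg S v x - avg S v 0\<bar> \<le> norm x * (S powr (- decay p) * N)"
    by (rule avg_translate_diff[OF v p N0 N(1)]) (use S in auto)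
  show ?thesis using 1[of x] 1[of 0] 2[of x] 2[of 0] 3 v0 by linarith
qed

lemma DERIV_powr_decay:
  assumes "0 < (s::real)" "a \<noteq> 1"
  shows "((\<lambda>s. s powr (1 - a) / (1 - a)) has_real_derivative s powr (- a)) (at s)"
  using DERIV_cdivide[OF has_real_derivative_powr[OF assms(1), of "1 - a"], of "1 - a"] assms by simp

lemma growth_supercritical:
  fixes v :: "'a \<Rightarrow> real"
  assumes v: "c1_grad v G" and p: "1 \<le> p" and N: "Lp_norm lborel p G \<le> ennreal N" "\<And>x. norm (G x) \<le> N"
    and v0: "v 0 = 0" and pd: "decay p < 1"
  shows "\<bar>v x\<bar> \<le> (2 * R + 2 * R / (1 - decay p) + 1) * N * norm x powr (1 - rexp p)"
proof -
  have N0: "0 \<le> N" using N(2)[of 0] norm_ge_zero order_trans by blast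
  have q0: "0 \<le> rexp p" by (simp add: rexp_def)
  have "1 * rexp p \<le> DIM('a) * rexp p" using q0 by (intro mult_right_mono) (auto simp: Suc_le_eq)
  with q0 have q: "0 \<le> rexp p" "rexp p \<le> decay p" by (auto simp: decay_def)
  have C: "1 \<le> 2 * R + 2 * R / (1 - decay p) + 1" using R_pos pd by simp
  show ?thesis
  proof (cases "norm x \<le> 1")
    case True
    \<comment> \<open>Near the origin the Lipschitz bound is enough, as |x| \<le> |x|^(1 - 1/p)
      there.\<close>
    have "\<bar>v x\<bar> \<le> N * norm x" using c1_grad_lipschitz[OF v N(2), of x 0] v0 by simp
    also have "norm x \<le> norm x powr (1 - rexp p)"
    proof (cases "x = 0")
      case False
      then have "norm x powr 1 \<le> norm x powr (1 - rexp p)" using True q by (intro powr_mono') auto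
      then show ?thesis using False by simp
    qed simp
    then have "N * norm x \<le> 1 * N * norm x powr (1 - rexp p)" using N0 by (simp add: mult_left_mono)
    also have "\<dots> \<le> (2 * R + 2 * R / (1 - decay p) + 1) * N * norm x powr (1 - rexp p)"
      using C N0 by (intro mult_right_mono) auto
    finally show ?thesis .
  next
    case False
    \<comment> \<open>Going up to the scale |x| balances the integral over scales with the
      translation: both are of order |x|^(1 - d/p), which is at most |x|^(1 - 1/p) for |x| \<ge> 1
      because d \<ge> 1.\<close>
    define S where "S = norm x"
    have S: "1 \<le> S" using False by (simp add: S_def)
    define T where "T = S powr (1 - rexp p)"
    have T: "1 \<le> T" "S powr (1 - decay p) \<le> T"
      using S q pd by (auto simp: T_def ge_one_powr_ge_zero intro!: powr_mono)
    have "\<bar>v x\<bar> \<le> 2 * R * N + 2 * R * N * (S powr (1 - decay p) / (1 - decay p) - 1 powr (1 - decay p) / (1 - decay p))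
        + norm x * (S powr (- decay p) * N)"
      by (rule growth_bound[OF v p N v0 S]) (use pd in \<open>auto intro: DERIV_powr_decay\<close>)
    also have "norm x * (S powr (- decay p) * N) = S powr (1 - decay p) * N"
      using S by (simp add: S_def[symmetric] powr_diff powr_minus field_simps)
    also have "2 * R * N + 2 * R * N * (S powr (1 - decay p) / (1 - decay p) - 1 powr (1 - decay p) / (1 - decay p)) + S powr (1 - decay p) * N
        \<le> 2 * R * N * T + 2 * R * N * (T / (1 - decay p)) + T * N"
    proof (intro add_mono)
      show "2 * R * N \<le> 2 * R * N * T" using mult_left_mono[OF T(1), of "2 * R * N"] R_pos N0 by simp
      have "S powr (1 - decay p) / (1 - decay p) - 1 powr (1 - decay p) / (1 - decay p) \<le> T / (1 - decay p)"
        using T pd by (simp add: diff_divide_distrib[symmetric] divide_right_mono)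
      then show "2 * R * N * (S powr (1 - decay p) / (1 - decay p) - 1 powr (1 - decay p) / (1 - decay p)) \<le> 2 * R * N * (T / (1 - decay p))"
        using R_pos N0 by (intro mult_left_mono) auto
      show "S powr (1 - decay p) * N \<le> T * N" using T N0 by (intro mult_right_mono)
    qed
    also have "\<dots> = (2 * R + 2 * R / (1 - decay p) + 1) * N * T" by (simp add: algebra_simps)
    finally show ?thesis by (simp add: T_def S_def)
  qed
qed

lemma growth_critical:
  fixes v :: "'a \<Rightarrow> real"
  assumes v: "c1_grad v G" and p: "1 \<le> p" and N: "Lp_norm lborel p G \<le> ennreal N" "\<And>x. norm (G x) \<le> N"
    and v0: "v 0 = 0" and pd: "decay p = 1"
  shows "\<bar>v x\<bar> \<le> (6 * R + 2) * N * ln (2 + norm x)"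
proof -
  have N0: "0 \<le> N" using N(2)[of 0] norm_ge_zero order_trans by blast
  \<comment> \<open>The offset 2 keeps ln S away from 0, so constants are absorbed by 1 \<le> 2 ln
    S. With d/p = 1 the translation term is at most N, since |x| \<le> S.\<close>
  define S where "S = 2 + norm x"
  have S: "1 \<le> S" "0 < S" by (auto simp: S_def add_nonneg_nonneg intro: add_pos_nonneg)
  have "1 \<le> 2 * ln (2::real)" using ln2_ge_two_thirds by simp
  also have "\<dots> \<le> 2 * ln S" by (simp add: S_def ln_mono)
  finally have L: "1 \<le> 2 * ln S" .
  have "\<bar>v x\<bar> \<le> 2 * R * N + 2 * R * N * (ln S - ln 1) + norm x * (S powr (- decay p) * N)"
    by (rule growth_bound[OF v p N v0 S(1)]) (auto simp: pd powr_minus inverse_eq_divide intro!: DERIV_ln_divide)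
  also have "norm x * (S powr (- decay p) * N) \<le> N"
    using S N0 by (simp add: pd powr_minus S_def field_simps) 
  also have "2 * R * N + 2 * R * N * (ln S - ln 1) + N \<le> (2 * R * N) * (2 * ln S) + 2 * R * N * ln S + N * (2 * ln S)"
  proof (intro add_mono)
    show "2 * R * N \<le> 2 * R * N * (2 * ln S)" using L mult_left_mono[OF L, of "2 * R * N"] R_pos N0 by simp
    show "N \<le> N * (2 * ln S)" using mult_left_mono[OF L N0] by simp
  qed simp
  also have "\<dots> = (6 * R + 2) * N * ln (2 + norm x)" by (simp add: S_def algebra_simps)
  finally show ?thesis by simp
qed

end

text \<open>Fatou's lemma, in the form that passes a uniform bound to an almost everywhere
  limit.\<close>

lemma nn_integral_le_limit:
  fixes f :: "nat \<Rightarrow> 'a \<Rightarrow> ennreal"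
  assumes [measurable]: "\<And>n. f n \<in> borel_measurable M"
    and lim: "AE x in M. (\<lambda>n. f n x) \<longlonglongrightarrow> F x" and C: "\<And>n. (\<integral>\<^sup>+x. f n x \<partial>M) \<le> C"
  shows "(\<integral>\<^sup>+x. F x \<partial>M) \<le> C"
proof -
  have "(\<integral>\<^sup>+x. F x \<partial>M) = (\<integral>\<^sup>+x. liminf (\<lambda>n. f n x) \<partial>M)"
    by (rule nn_integral_cong_AE) (use lim in eventually_elim, simp add: lim_imp_Liminf)
  also have "\<dots> \<le> liminf (\<lambda>n. \<integral>\<^sup>+x. f n x \<partial>M)" by (rule nn_integral_liminf) simp
  also have "\<dots> \<le> limsup (\<lambda>n. \<integral>\<^sup>+x. f n x \<partial>M)" by (rule Liminf_le_Limsup) simp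
  also have "\<dots> \<le> C" by (rule Limsup_bounded) (simp add: C)
  finally show ?thesis .
qed

section \<open>A continuously differentiable truncation\<close>

text \<open>A C^1 quadratic spline: 0 for t \<le> 0, then 2 t^2 up to 1/2, then 1 - 2 (1 - t)^2 up
  to 1, and 1 afterwards. Its largest slope is 2, attained at 1/2.\<close>

definition ramp :: "real \<Rightarrow> real" where
  "ramp t = 2 * (max 0 t)\<^sup>2 - 4 * (max 0 (t - 1/2))\<^sup>2 + 2 * (max 0 (t - 1))\<^sup>2"

definition ramp_deriv :: "real \<Rightarrow> real" where
  "ramp_deriv t = 4 * max 0 t - 8 * max 0 (t - 1/2) + 4 * max 0 (t - 1)"

text \<open>An even function, equal to \<open>ramp (\<bar>s\<bar> - 1)\<close>. At most one summand
  is nonzero, so it rises from 0 to 1 on the layer 1 \<le> \<bar>s\<bar> \<le> 2 and keeps the slope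
  bound 2.\<close>

definition cutoff :: "real \<Rightarrow> real" where
  "cutoff s = ramp (s - 1) + ramp (- s - 1)"

definition cutoff_deriv :: "real \<Rightarrow> real" where
  "cutoff_deriv s = ramp_deriv (s - 1) - ramp_deriv (- s - 1)"

lemma DERIV_max_square: "((\<lambda>t. (max 0 t)\<^sup>2) has_real_derivative 2 * max 0 t) (at (t::real))"
proof -
  consider "t > 0" | "t < 0" | "t = 0" by linarith
  then show ?thesis
  proof cases
    case 1
    have "((\<lambda>t. t\<^sup>2) has_real_derivative 2 * max 0 t) (at t)" using 1 by (auto intro!: derivative_eq_intros)
    then show ?thesis
      by (rule has_field_derivative_transform_within_open[where S="{0<..}"]) (use 1 in auto)
  next
    case 2
    have "((\<lambda>t. 0) has_real_derivative 2 * max 0 t) (at t)" using 2 by auto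
    then show ?thesis
      by (rule has_field_derivative_transform_within_open[where S="{..<0}"]) (use 2 in auto)
  next
    case 3
    have "((\<lambda>h. (max 0 h)\<^sup>2 / h) \<longlongrightarrow> 0) (at (0::real))"
    proof (rule tendsto_rabs_zero_cancel, rule tendsto_sandwich[of "\<lambda>_. 0" _ _ "\<lambda>h. \<bar>h\<bar>"])
      show "((\<lambda>h. \<bar>h\<bar>) \<longlongrightarrow> 0) (at (0::real))" by (rule tendsto_rabs_zero) (rule tendsto_ident_at)
      show "\<forall>\<^sub>F h in at (0::real). \<bar>(max 0 h)\<^sup>2 / h\<bar> \<le> \<bar>h\<bar>"
        by (intro always_eventually allI) (auto simp: max_def power2_eq_square)
    qed auto
    then show ?thesis using 3 by (simp add: DERIV_def)
  qed
qed

lemma DERIV_ramp: "(ramp has_real_derivative ramp_deriv t) (at t)"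
proof -
  have s: "((\<lambda>t. (max 0 (t - c))\<^sup>2) has_real_derivative 2 * max 0 (t - c)) (at t)" for c :: real
  proof -
    have "((\<lambda>t. t - c) has_real_derivative 1) (at t)" by (auto intro!: derivative_eq_intros)
    from DERIV_chain'[OF this DERIV_max_square] show ?thesis by simp
  qed
  have "((\<lambda>t. 2 * (max 0 t)\<^sup>2 - 4 * (max 0 (t - 1/2))\<^sup>2 + 2 * (max 0 (t - 1))\<^sup>2) has_real_derivative
     2 * (2 * max 0 t) - 4 * (2 * max 0 (t - 1/2)) + 2 * (2 * max 0 (t - 1))) (at t)"
    by (intro DERIV_add DERIV_diff DERIV_cmult s DERIV_max_square)
  then show ?thesis unfolding ramp_def[abs_def] ramp_deriv_def by simp
qed

lemma DERIV_cutoff: "(cutoff has_real_derivative cutoff_deriv s) (at s)"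
proof -
  have 1: "((\<lambda>s. ramp (s - 1)) has_real_derivative 1 * ramp_deriv (s - 1)) (at s)"
    by (rule DERIV_chain'[OF _ DERIV_ramp, where f="\<lambda>s. s - 1", simplified mult.commute])
       (auto intro!: derivative_eq_intros)
  have 2: "((\<lambda>s. ramp (- s - 1)) has_real_derivative (- 1) * ramp_deriv (- s - 1)) (at s)"
    by (rule DERIV_chain'[OF _ DERIV_ramp, where f="\<lambda>s. - s - 1", simplified mult.commute])
       (auto intro!: derivative_eq_intros)
  show ?thesis using DERIV_add[OF 1 2] unfolding cutoff_def[abs_def] cutoff_deriv_def by simp
qed

lemma cutoff_deriv_continuous: "continuous_on UNIV cutoff_deriv"
  unfolding cutoff_deriv_def[abs_def] ramp_deriv_def by (intro continuous_intros)

lemma ramp_eq: "t \<le> 0 \<Longrightarrow> ramp t = 0" "1 \<le> t \<Longrightarrow> ramp t = 1"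
  "t \<le> 0 \<Longrightarrow> ramp_deriv t = 0" "1 \<le> t \<Longrightarrow> ramp_deriv t = 0"
  by (auto simp: ramp_def ramp_deriv_def max_def power2_eq_square algebra_simps)

lemma ramp_deriv_bounds: "\<bar>ramp_deriv t\<bar> \<le> 2"
  by (auto simp: ramp_deriv_def max_def abs_if)

lemma ramp_bounds: "0 \<le> ramp t \<and> ramp t \<le> 1"
proof -
  consider "t \<le> 0" | "1 \<le> t" | "0 \<le> t" "t \<le> 1/2" | "1/2 \<le> t" "t \<le> 1" by linarith
  then show ?thesis
  proof cases
    case 3
    have "2 * t\<^sup>2 \<le> 2 * (1/2)\<^sup>2" using 3 by (intro mult_left_mono power_mono) auto
    moreover have "max 0 t = t" "max 0 (t - 1/2) = 0" "max 0 (t - 1) = 0" using 3 by auto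
    ultimately show ?thesis by (simp add: ramp_def power2_eq_square)
  next
    case 4
    have e: "ramp t = 1 - 2 * (1 - t)\<^sup>2" using 4 by (auto simp: ramp_def max_def power2_eq_square algebra_simps)
    have "2 * (1 - t)\<^sup>2 \<le> 2 * (1/2)\<^sup>2" using 4 by (intro mult_left_mono power_mono) auto
    then show ?thesis using zero_le_power2[of "1 - t"] unfolding e by (simp add: power2_eq_square)
  qed (auto simp: ramp_eq)
qed

lemma cutoff_eq_0: "\<bar>s\<bar> \<le> 1 \<Longrightarrow> cutoff s = 0"
  by (simp add: cutoff_def ramp_eq)

lemma cutoff_eq_1: "2 \<le> \<bar>s\<bar> \<Longrightarrow> cutoff s = 1"
  by (cases "0 \<le> s") (simp_all add: cutoff_def ramp_eq)

lemma cutoff_le_1: "\<bar>cutoff s\<bar> \<le> 1"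
  using ramp_bounds[of "s - 1"] ramp_bounds[of "- s - 1"] ramp_eq(1)[of "s - 1"] ramp_eq(1)[of "- s - 1"]
  by (cases "0 \<le> s") (auto simp: cutoff_def)

lemma cutoff_deriv_eq_0: "\<bar>s\<bar> < 1 \<or> 2 \<le> \<bar>s\<bar> \<Longrightarrow> cutoff_deriv s = 0"
  by (cases "0 \<le> s") (auto simp: cutoff_deriv_def ramp_eq)

lemma cutoff_deriv_le: "\<bar>cutoff_deriv s\<bar> \<le> 2"
  using ramp_deriv_bounds[of "s - 1"] ramp_deriv_bounds[of "- s - 1"] ramp_eq(3)[of "s - 1"] ramp_eq(3)[of "- s - 1"]
  by (cases "0 \<le> s") (auto simp: cutoff_deriv_def)

lemma c1_grad_cutoff:
  assumes v: "c1_grad v G" and c: "0 < c"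
  shows "c1_grad (\<lambda>x. cutoff (v x / c)) (\<lambda>x. (cutoff_deriv (v x / c) / c) *\<^sub>R G x)"
  unfolding c1_grad_def
proof (intro conjI allI)
  fix x
  have "((\<lambda>x. v x / c) has_derivative (\<lambda>h. (G x \<bullet> h) / c)) (at x)"
    using v c by (auto simp: c1_grad_def intro!: derivative_eq_intros)
  then have "((\<lambda>x. cutoff (v x / c)) has_derivative (\<lambda>h. cutoff_deriv (v x / c) * ((G x \<bullet> h) / c))) (at x)"
    using DERIV_cutoff[of "v x / c"] unfolding has_field_derivative_def
    by (rule has_derivative_compose)
  moreover have "(\<lambda>h. cutoff_deriv (v x / c) * ((G x \<bullet> h) / c)) = (\<bullet>) ((cutoff_deriv (v x / c) / c) *\<^sub>R G x)"
    by auto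
  ultimately show "((\<lambda>x. cutoff (v x / c)) has_derivative (\<bullet>) ((cutoff_deriv (v x / c) / c) *\<^sub>R G x)) (at x)"
    by simp
next
  have "continuous_on UNIV (\<lambda>x. cutoff_deriv (v x / c))"
  proof (rule continuous_on_compose2[OF cutoff_deriv_continuous])
    show "continuous_on UNIV (\<lambda>x. v x / c)" using c1_grad_continuous[OF v] c by (intro continuous_intros) auto
  qed auto
  then show "continuous_on UNIV (\<lambda>x. (cutoff_deriv (v x / c) / c) *\<^sub>R G x)"
    using v c by (auto simp: c1_grad_def intro!: continuous_intros)
qed

section \<open>The Sobolev inequality\<close>

locale subcritical = mollifier \<phi> R for \<phi> :: "'a::euclidean_space \<Rightarrow> real" and R +
  fixes P :: real
  assumes P: "1 \<le> P" "P < DIM('a)"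
begin

definition \<alpha> :: real where "\<alpha> = DIM('a) / P"

definition q :: real where "q = P * DIM('a) / (DIM('a) - P)"

lemma alpha: "1 < \<alpha>" "decay (ennreal P) = \<alpha>"
  using P by (simp_all add: \<alpha>_def decay_def)

text \<open>The Sobolev exponent dP/(d - P) expressed through \<alpha> = d/P; in this form it
  emerges from the optimal radius in the weak type estimate.\<close>

lemma q_eq: "q = P + P / (\<alpha> - 1)" and q_ge: "P \<le> q" "0 < q"
proof -
  have d: "real DIM('a) = P * \<alpha>" using P by (simp add: \<alpha>_def)
  have "q = P * (P * \<alpha>) / (P * (\<alpha> - 1))" unfolding q_def d by (simp add: right_diff_distrib)
  also have "\<dots> = P + P / (\<alpha> - 1)" using P alpha by (simp add: field_simps)
  finally show e: "q = P + P / (\<alpha> - 1)" .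
  have "0 \<le> P / (\<alpha> - 1)" using P alpha by simp
  then show "P \<le> q" "0 < q" unfolding e using P by auto
qed

abbreviation (input) "p \<equiv> ennreal P"

lemma p_ge: "1 \<le> p" using P by simp

text \<open>As \<alpha> > 1, the function s^(-\<alpha>) is integrable at infinity, so the scale
  integral has a bound that depends neither on S nor on x.\<close>

lemma avg_tail:
  assumes v: "c1_grad v G" and N: "0 \<le> N" "Lp_norm lborel p G \<le> ennreal N" and r: "0 < r" "r \<le> S"
  shows "\<bar>avg S v x - avg r v x\<bar> \<le> R * N * (r powr (1 - \<alpha>) / (\<alpha> - 1))"
proof -
  have "\<bar>avg S v x - avg r v x\<bar> \<le> R * N * (S powr (1 - \<alpha>) / (1 - \<alpha>) - r powr (1 - \<alpha>) / (1 - \<alpha>))"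
    by (rule avg_scale_diff[OF v p_ge N r]) (use r alpha in \<open>auto intro: DERIV_powr_decay\<close>)
  also have "\<dots> \<le> R * N * (r powr (1 - \<alpha>) / (\<alpha> - 1))"
  proof (intro mult_left_mono)
    have "S powr (1 - \<alpha>) / (1 - \<alpha>) \<le> 0" using alpha by (simp add: divide_nonneg_neg)
    moreover have "r powr (1 - \<alpha>) / (\<alpha> - 1) = - (r powr (1 - \<alpha>) / (1 - \<alpha>))"
      by (simp add: minus_divide_right)
    ultimately show "S powr (1 - \<alpha>) / (1 - \<alpha>) - r powr (1 - \<alpha>) / (1 - \<alpha>) \<le> r powr (1 - \<alpha>) / (\<alpha> - 1)" by linarith
  qed (use R_pos N in auto)
  finally show ?thesis .
qed

lemma tail_tendsto_0: "(\<lambda>n. c * (real n powr (1 - \<alpha>) / (\<alpha> - 1))) \<longlonglongrightarrow> 0"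
proof -
  have "(\<lambda>n. real n powr (1 - \<alpha>)) \<longlonglongrightarrow> 0"
    by (rule tendsto_neg_powr) (use alpha filterlim_real_sequentially in auto)
  then have "(\<lambda>n. c * (real n powr (1 - \<alpha>) / (\<alpha> - 1))) \<longlonglongrightarrow> c * (0 / (\<alpha> - 1))" by (intro tendsto_intros) (use alpha in auto)
  then show ?thesis by simp
qed

lemma decay_tendsto_0: "(\<lambda>n. real n powr (- \<alpha>) * c) \<longlonglongrightarrow> 0"
proof -
  have "(\<lambda>n. real n powr (- \<alpha>)) \<longlonglongrightarrow> 0"
    by (rule tendsto_neg_powr) (use alpha filterlim_real_sequentially in auto)
  then show ?thesis by (rule tendsto_mult_left_zero)
qed

text \<open>The tail bound makes the averages over growing scales a Cauchy sequence.\<close>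

lemma ex_avg_limit:
  assumes v: "c1_grad v G" and N: "0 \<le> N" "Lp_norm lborel p G \<le> ennreal N"
  shows "\<exists>k. (\<lambda>n. avg (real n) v 0) \<longlonglongrightarrow> k"
proof -
  have "Cauchy (\<lambda>n. avg (real n) v 0)"
  proof (rule metric_CauchyI)
    fix e :: real assume e: "0 < e"
    have "\<forall>\<^sub>F n in sequentially. R * N * (real n powr (1 - \<alpha>) / (\<alpha> - 1)) < e / 2 \<and> n \<ge> 1"
      by (intro eventually_conj order_tendstoD(2)[OF tail_tendsto_0] eventually_ge_at_top) (use e in simp)
    then obtain M where M: "R * N * (real M powr (1 - \<alpha>) / (\<alpha> - 1)) < e / 2" "M \<ge> 1"
      by (auto simp: eventually_sequentially)
    have "\<bar>avg (real n) v 0 - avg (real M) v 0\<bar> < e / 2" if "n \<ge> M" for n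
      by (rule order.strict_trans1[OF avg_tail[OF v N] M(1)]) (use M(2) that in auto)
    then have "dist (avg (real m) v 0) (avg (real n) v 0) < e" if "m \<ge> M" "n \<ge> M" for m n
      using that by (smt (verit) dist_real_def field_sum_of_halves)
    then show "\<exists>M. \<forall>m\<ge>M. \<forall>n\<ge>M. dist (avg (real m) v 0) (avg (real n) v 0) < e" by blast
  qed
  then show ?thesis using Cauchy_convergent convergent_def by blast
qed

text \<open>Moving the base point from 0 to x changes the average at scale n by at most |x|
  n^(-\<alpha>) N, which tends to 0.\<close>

lemma avg_limit_everywhere:
  assumes v: "c1_grad v G" and N: "0 \<le> N" "Lp_norm lborel p G \<le> ennreal N"
    and k: "(\<lambda>n. avg (real n) v 0) \<longlonglongrightarrow> k"
  shows "(\<lambda>n. avg (real n) v x) \<longlonglongrightarrow> k"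
proof -
  have "(\<lambda>n. avg (real n) v x - avg (real n) v 0) \<longlonglongrightarrow> 0"
  proof (rule Lim_null_comparison)
    show "\<forall>\<^sub>F n in sequentially. norm (avg (real n) v x - avg (real n) v 0) \<le> real n powr (- \<alpha>) * (norm x * N)"
      using eventually_gt_at_top[of 0]
      by eventually_elim (use avg_translate_diff[OF v p_ge N] in \<open>simp add: alpha mult_ac\<close>)
  qed (rule decay_tendsto_0)
  from tendsto_add[OF this k] show ?thesis by simp
qed

text \<open>The normalisation that fixes the additive constant. Unlike membership in some L^q it is
  available before any integrability of v is known, and truncation preserves it.\<close>

definition vanishing :: "('a \<Rightarrow> real) \<Rightarrow> bool" where
  "vanishing v \<longleftrightarrow> (\<forall>x. (\<lambda>n. avg (real n) v x) \<longlonglongrightarrow> 0)"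

lemma avg_le_if_vanishing:
  assumes v: "c1_grad v G" and N: "0 \<le> N" "Lp_norm lborel p G \<le> ennreal N" and z: "vanishing v" and r: "0 < r"
  shows "\<bar>avg r v x\<bar> \<le> R * N * (r powr (1 - \<alpha>) / (\<alpha> - 1))"
proof (rule tendsto_upperbound)
  show "(\<lambda>n. \<bar>avg (real n) v x - avg r v x\<bar>) \<longlonglongrightarrow> \<bar>avg r v x\<bar>"
    using z unfolding vanishing_def by (auto intro!: tendsto_eq_intros)
  have "\<forall>\<^sub>F n in sequentially. r \<le> real n"
    using filterlim_real_sequentially unfolding filterlim_at_top by blast
  then show "\<forall>\<^sub>F n in sequentially. \<bar>avg (real n) v x - avg r v x\<bar> \<le> R * N * (r powr (1 - \<alpha>) / (\<alpha> - 1))"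
    by eventually_elim (rule avg_tail[OF v N r])
qed simp

section \<open>The weak type estimate\<close>

definition weak_const :: real where
  "weak_const = R powr P * (R / (\<alpha> - 1)) powr (P / (\<alpha> - 1))"

lemma weak_const_nonneg: "0 \<le> weak_const"
  by (simp add: weak_const_def)

text \<open>If \<open>avg r v\<close> is at most t in modulus, its distance from v is at least t
  wherever |v| \<ge> 2 t, and Chebyshev's inequality bounds the measure of that set by (r R N /
  t)^P. The optimal r turns this into a multiple of (N / t)^q.\<close>

lemma weak_type_pos:
  assumes v: "c1_grad v G" and N: "0 < N" "Lp_norm lborel p G \<le> ennreal N" and z: "vanishing v" and t: "0 < t"
  shows "emeasure lborel {x. 2 * t \<le> \<bar>v x\<bar>} \<le> ennreal (weak_const * (N / t) powr q)"
proof -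
  define B where "B = R / (\<alpha> - 1)"
  have B: "0 < B" using R_pos alpha by (simp add: B_def)
  \<comment> \<open>Solves R N r^(1 - \<alpha>) / (\<alpha> - 1) = t, whose left side is the
    pointwise bound for \<open>avg r v\<close>.\<close>
  define r where "r = (B * (N / t)) powr (1 / (\<alpha> - 1))"
  have r: "0 < r" using B N t by (simp add: r_def)
  have "r powr (1 - \<alpha>) = (B * (N / t)) powr (- 1)"
  proof -
    have "(1 / (\<alpha> - 1)) * (1 - \<alpha>) = - 1" using alpha by (simp add: field_simps)
    then show ?thesis by (simp add: r_def powr_powr)
  qed
  then have rt: "R * N * (r powr (1 - \<alpha>) / (\<alpha> - 1)) = t"
    using B N t alpha R_pos by (simp add: powr_minus B_def field_simps)
  note [measurable] = c1_grad_measurable[OF v] borel_measurable_continuous_onI[OF avg_continuous[OF c1_grad_loc_int[OF v] r]]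
  have "Lp_norm lborel p (\<lambda>x. v x - avg r v x) \<le> ennreal (r * R) * ennreal N"
    by (rule order_trans[OF c1_diff_avg_Lp[OF v r p_ge]]) (intro mult_left_mono N, simp)
  then have L: "(\<integral>\<^sup>+x. ennreal (\<bar>v x - avg r v x\<bar> powr P) \<partial>lborel) \<le> ennreal ((r * R * N) powr P)"
    using Lp_norm_finite_le[OF P(1), of "r * R * N" lborel "\<lambda>x. v x - avg r v x"] r R_pos N
    by (simp add: ennreal_mult)
  let ?A = "{x. 2 * t \<le> \<bar>v x\<bar>}"
  have "ennreal (t powr P) * emeasure lborel ?A = (\<integral>\<^sup>+x. ennreal (t powr P) * indicator ?A x \<partial>lborel)"
    by (rule nn_integral_cmult_indicator[symmetric]) measurable
  also have "\<dots> \<le> (\<integral>\<^sup>+x. ennreal (\<bar>v x - avg r v x\<bar> powr P) \<partial>lborel)"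
  proof (rule nn_integral_mono)
    fix x
    have "t \<le> \<bar>v x - avg r v x\<bar>" if "x \<in> ?A"
      using avg_le_if_vanishing[OF v _ N(2) z r, of x] N rt that by auto
    then show "ennreal (t powr P) * indicator ?A x \<le> ennreal (\<bar>v x - avg r v x\<bar> powr P)"
      using t P by (auto split: split_indicator intro!: ennreal_leI powr_mono2)
  qed
  also note L
  finally have 1: "ennreal (t powr P) * emeasure lborel ?A \<le> ennreal ((r * R * N) powr P)" .
  have "(r * R * N) powr P = t powr P * (weak_const * (N / t) powr q)"
    using r R_pos N t B
    by (simp add: q_eq weak_const_def B_def[symmetric] r_def powr_mult powr_powr powr_add powr_divide)
  with 1 have "ennreal (t powr P) * emeasure lborel ?A \<le> ennreal (t powr P) * ennreal (weak_const * (N / t) powr q)"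
    using weak_const_nonneg by (simp add: ennreal_mult)
  then show ?thesis
    by (subst (asm) ennreal_mult_le_mult_iff) (use t in auto)
qed

text \<open>For N = 0 the optimal radius degenerates; instead every e > 0 is an admissible gradient
  bound, and e tends to 0.\<close>

lemma weak_type:
  assumes v: "c1_grad v G" and N: "0 \<le> N" "Lp_norm lborel p G \<le> ennreal N" and z: "vanishing v" and t: "0 < t"
  shows "emeasure lborel {x. 2 * t \<le> \<bar>v x\<bar>} \<le> ennreal (weak_const * (N / t) powr q)"
proof (cases "N = 0")
  case True
  have le: "emeasure lborel {x. 2 * t \<le> \<bar>v x\<bar>} \<le> ennreal (weak_const * (e / t) powr q)" if "0 < e" for e
    by (rule weak_type_pos[OF v that _ z t]) (use N True that in \<open>auto intro: order_trans\<close>)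
  obtain m where m: "emeasure lborel {x. 2 * t \<le> \<bar>v x\<bar>} = ennreal m" "0 \<le> m"
    using le[of 1] by (cases "emeasure lborel {x. 2 * t \<le> \<bar>v x\<bar>}") (auto simp: top_unique)
  have "m \<le> 0"
  proof (rule tendsto_lowerbound)
    show "((\<lambda>e. weak_const * (e / t) powr q) \<longlongrightarrow> 0) (at_right 0)"
      by (intro tendsto_mult_right_zero tendsto_zero_powrI[where b=q])
         (use t q_ge in \<open>auto intro!: tendsto_eq_intros simp: eventually_at_filter\<close>)
    show "\<forall>\<^sub>F e in at_right 0. m \<le> weak_const * (e / t) powr q"
      using le m weak_const_nonneg by (auto simp: eventually_at_filter ennreal_le_iff)
  qed simp
  then show ?thesis using m by simp
qed (use weak_type_pos[OF v _ N(2) z t] N in auto)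

text \<open>The truncation is bounded by 1 and lives where |v| \<ge> c, a set of finite measure by
  the weak type estimate. It therefore lies in L^1, and its averages at scale n are
  O(n^(-d)).\<close>

lemma vanishing_cutoff:
  assumes v: "c1_grad v G" and N: "0 \<le> N" "Lp_norm lborel p G \<le> ennreal N" and z: "vanishing v" and c: "0 < c"
  shows "vanishing (\<lambda>x. cutoff (v x / c))"
  unfolding vanishing_def
proof
  fix x
  let ?w = "\<lambda>x. cutoff (v x / c)"
  note w = c1_grad_cutoff[OF v c]
  note [measurable] = c1_grad_measurable[OF v] c1_grad_measurable[OF w]
  obtain m where m: "emeasure lborel {x. 2 * (c / 2) \<le> \<bar>v x\<bar>} = ennreal m" "0 \<le> m"
    using weak_type[OF v N z, of "c / 2"] c by (cases "emeasure lborel {x. 2 * (c / 2) \<le> \<bar>v x\<bar>}") (auto simp: top_unique)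
  have "(\<integral>\<^sup>+x. ennreal (norm (?w x) powr 1) \<partial>lborel) \<le> (\<integral>\<^sup>+x. indicator {x. 2 * (c / 2) \<le> \<bar>v x\<bar>} x \<partial>lborel)"
  proof (rule nn_integral_mono)
    fix x
    show "ennreal (norm (?w x) powr 1) \<le> indicator {x. 2 * (c / 2) \<le> \<bar>v x\<bar>} x"
      using cutoff_le_1[of "v x / c"] cutoff_eq_0[of "v x / c"] c
      by (cases "c \<le> \<bar>v x\<bar>") (auto simp: ennreal_le_1 divide_le_eq)
  qed
  also have "\<dots> = ennreal (m powr 1)" using m by simp
  finally have "Lp_norm lborel (ennreal 1) ?w \<le> ennreal m" using m by (subst Lp_norm_finite_le) auto
  then have b: "norm (avg s ?w x) \<le> s powr (- decay (ennreal 1)) * m" if "0 < s" for s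
    using that m by (intro avg_pointwise) auto
  have "(\<lambda>n. real n powr (- decay (ennreal 1))) \<longlonglongrightarrow> 0"
    by (rule tendsto_neg_powr) (use P filterlim_real_sequentially in \<open>auto simp: decay_def rexp_ennreal[of 1, simplified]\<close>)
  from tendsto_mult_left_zero[OF this, of m]
  show "(\<lambda>n. avg (real n) ?w x) \<longlonglongrightarrow> 0"
    by (rule Lim_null_comparison[rotated]) (use b in \<open>auto intro!: eventually_sequentiallyI[of 1]\<close>)
qed

text \<open>The number 16 is 4 c times 2 times 2 / c: the upper edge 4 c of the next layer, the weak
  type estimate at t = 1/2, and the bound 2 / c on the slope of the truncation.\<close>

definition strong_const :: real where
  "strong_const = weak_const * 16 powr q"

lemma strong_const_nonneg: "0 \<le> strong_const"
  by (simp add: strong_const_def weak_const_nonneg)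

text \<open>Truncating at a level turns the weak bound into one that only sees the gradient on a single
  layer of level sets, so that the layers can be summed.\<close>

lemma level_set_layer_bound:
  assumes v: "c1_grad v G" and N: "0 \<le> N" "Lp_norm lborel p G \<le> ennreal N" and z: "vanishing v" and c: "0 < c"
  defines "I \<equiv> (\<integral>\<^sup>+x. indicator {x. c \<le> \<bar>v x\<bar> \<and> \<bar>v x\<bar> < 2 * c} x * ennreal (norm (G x) powr P) \<partial>lborel)"
  shows "ennreal ((4 * c) powr q) * emeasure lborel {x. 2 * c \<le> \<bar>v x\<bar>} \<le> ennreal (strong_const * N powr (q - P)) * I"
proof -
  let ?w = "\<lambda>x. cutoff (v x / c)" and ?W = "\<lambda>x. (cutoff_deriv (v x / c) / c) *\<^sub>R G x"
  note w = c1_grad_cutoff[OF v c]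
  note [measurable] = c1_grad_measurable[OF v] c1_grad_measurable[OF w]
  have "I \<le> (\<integral>\<^sup>+x. ennreal (norm (G x) powr P) \<partial>lborel)"
    unfolding I_def by (intro nn_integral_mono) (auto split: split_indicator)
  also have "\<dots> \<le> ennreal (N powr P)" using N P by (subst Lp_norm_finite_le[symmetric]) auto
  finally have IN: "I \<le> ennreal (N powr P)" .
  then obtain i where i: "I = ennreal i" "0 \<le> i" by (cases I) (auto simp: top_unique)
  have iN: "i \<le> N powr P" using IN i by simp
  \<comment> \<open>A bound for the L^P norm of the truncation's gradient, which has slope factor at
    most 2 / c and is supported on a single layer, with energy i.\<close>
  define M where "M = (2 / c) * i powr (1 / P)"
  have "M powr P = (2 / c) powr P * (i powr (1 / P)) powr P" unfolding M_def by (rule powr_mult; use c in simp)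
  then have M: "0 \<le> M" "M powr P = (2 / c) powr P * i" using c i P by (auto simp: M_def powr_powr)
  have "(\<integral>\<^sup>+x. ennreal (norm (?W x) powr P) \<partial>lborel)
     \<le> (\<integral>\<^sup>+x. ennreal ((2 / c) powr P) * (indicator {x. c \<le> \<bar>v x\<bar> \<and> \<bar>v x\<bar> < 2 * c} x * ennreal (norm (G x) powr P)) \<partial>lborel)"
  proof (rule nn_integral_mono)
    fix x
    show "ennreal (norm (?W x) powr P)
      \<le> ennreal ((2 / c) powr P) * (indicator {x. c \<le> \<bar>v x\<bar> \<and> \<bar>v x\<bar> < 2 * c} x * ennreal (norm (G x) powr P))"
    proof (cases "c \<le> \<bar>v x\<bar> \<and> \<bar>v x\<bar> < 2 * c")
      case True
      have "norm (?W x) \<le> (2 / c) * norm (G x)"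
        unfolding norm_scaleR using cutoff_deriv_le[of "v x / c"] c by (intro mult_right_mono) (auto intro: divide_right_mono)
      then have "norm (?W x) powr P \<le> ((2 / c) * norm (G x)) powr P" using P by (intro powr_mono2) auto
      also have "\<dots> = (2 / c) powr P * norm (G x) powr P" by (rule powr_mult; use c in simp)
      finally show ?thesis using True by (simp add: ennreal_mult[symmetric] ennreal_leI)
    next
      case False
      then have "cutoff_deriv (v x / c) = 0" using c by (intro cutoff_deriv_eq_0) (auto simp: field_simps)
      then show ?thesis by simp
    qed
  qed
  also have "\<dots> = ennreal (M powr P)"
    using i unfolding M by (subst nn_integral_cmult) (auto simp: I_def[symmetric] ennreal_mult)
  finally have "Lp_norm lborel p ?W \<le> ennreal M" using M P by (subst Lp_norm_finite_le) auto
  \<comment> \<open>The truncation equals 1 where |v| \<ge> 2 c, so the level 2 t = 1 captures that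
    set.\<close>
  from weak_type[OF w M(1) this vanishing_cutoff[OF v N z c], of "1 / 2"]
  have "emeasure lborel {x. 1 \<le> \<bar>?w x\<bar>} \<le> ennreal (weak_const * (2 * M) powr q)" by (simp add: mult.commute)
  moreover have "emeasure lborel {x. 2 * c \<le> \<bar>v x\<bar>} \<le> emeasure lborel {x. 1 \<le> \<bar>?w x\<bar>}"
  proof (rule emeasure_mono)
    show "{x. 2 * c \<le> \<bar>v x\<bar>} \<subseteq> {x. 1 \<le> \<bar>?w x\<bar>}"
      using c by (auto simp: cutoff_eq_1 field_simps)
  qed measurable
  ultimately have "emeasure lborel {x. 2 * c \<le> \<bar>v x\<bar>} \<le> ennreal (weak_const * (2 * M) powr q)" by order
  then have "ennreal ((4 * c) powr q) * emeasure lborel {x. 2 * c \<le> \<bar>v x\<bar>} \<le> ennreal ((4 * c) powr q) * ennreal (weak_const * (2 * M) powr q)"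
    by (intro mult_left_mono) auto
  also have "\<dots> = ennreal (weak_const * (4 * c * (2 * M)) powr q)"
  proof -
    have "(4 * c * (2 * M)) powr q = (4 * c) powr q * (2 * M) powr q" by (rule powr_mult; use c M in simp)
    then show ?thesis using weak_const_nonneg by (simp only: ennreal_mult[symmetric] powr_ge_zero mult_nonneg_nonneg mult.left_commute)
  qed
  also have "4 * c * (2 * M) = 16 * i powr (1 / P)" using c by (simp add: M_def)
  also have "weak_const * (16 * i powr (1 / P)) powr q = strong_const * i powr (q / P)"
    using i by (simp add: strong_const_def powr_mult powr_powr)
  \<comment> \<open>The power q/P \<ge> 1 is made linear in the layer energy by means of i \<le>
    N^P; only a linear bound can be summed over the layers.\<close>
  also have "i powr (q / P) \<le> N powr (q - P) * i"
  proof (cases "i = 0")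
    case False
    have "i powr (q / P) = i powr (q / P - 1) * i" using i False by (simp add: powr_diff)
    also have "i powr (q / P - 1) \<le> (N powr P) powr (q / P - 1)"
      using iN i q_ge P by (intro powr_mono2) auto
    also have "(N powr P) powr (q / P - 1) = N powr (q - P)"
      using P by (simp add: powr_powr right_diff_distrib)
    finally show ?thesis using i by (simp add: mult_right_mono)
  qed (use N in simp)
  then have "ennreal (strong_const * i powr (q / P)) \<le> ennreal (strong_const * N powr (q - P)) * I"
    unfolding i using strong_const_nonneg i by (simp add: ennreal_mult[symmetric] mult.assoc mult_left_mono ennreal_leI)
  finally show ?thesis .
qed

text \<open>On \<open>L (Suc j)\<close> one has |v| < 4 \<open>l j\<close>, while the measure of
  that layer is controlled by the gradient on \<open>L j\<close> alone. The dyadic layers are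
  disjoint, so the gradient contributions add up to at most one full integral.\<close>

lemma sobolev_above_level:
  assumes v: "c1_grad v G" and N: "0 \<le> N" "Lp_norm lborel p G \<le> ennreal N" and z: "vanishing v" and c: "0 < c"
  shows "(\<integral>\<^sup>+x. indicator {x. 2 * c \<le> \<bar>v x\<bar>} x * ennreal (\<bar>v x\<bar> powr q) \<partial>lborel) \<le> ennreal (strong_const * N powr q)"
proof -
  note [measurable] = c1_grad_measurable[OF v]
  define l where "l j = c * 2 ^ j" for j :: nat
  have l: "0 < l j" "l (Suc j) = 2 * l j" for j using c by (auto simp: l_def)
  have l_mono: "l i \<le> l j" if "i \<le> j" for i j using that c by (auto simp: l_def)
  define L where "L j = {x. l j \<le> \<bar>v x\<bar> \<and> \<bar>v x\<bar> < l (Suc j)}" for j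
  have [measurable]: "L j \<in> sets borel" for j unfolding L_def by measurable
  have disj: "disjoint_family L"
    unfolding disjoint_family_on_def
  proof (intro ballI impI)
    fix i j :: nat assume "i \<noteq> j"
    then consider "Suc i \<le> j" | "Suc j \<le> i" by linarith
    then show "L i \<inter> L j = {}" by cases (use l_mono in \<open>force simp: L_def\<close>)+
  qed
  have cover: "\<exists>j. x \<in> L (Suc j)" if "2 * c \<le> \<bar>v x\<bar>" for x
  proof -
    obtain n where "\<bar>v x\<bar> / c < 2 ^ n" using real_arch_pow[of 2 "\<bar>v x\<bar> / c"] by auto
    then have n: "\<bar>v x\<bar> < l n" using c by (simp add: l_def field_simps)
    define m where "m = (LEAST n. \<bar>v x\<bar> < l n)"
    have m: "\<bar>v x\<bar> < l m" unfolding m_def by (rule LeastI[of _ n]) (rule n)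
    \<comment> \<open>Each layer is estimated through the one below it, so the lowest layer must not
      be hit; the threshold 2 c = \<open>l 1\<close> starts just above it.\<close>
    have "m > 1" 
    proof (rule ccontr)
      assume "\<not> m > 1"
      then have "l m \<le> l 1" by (intro l_mono) auto
      with m that show False by (simp add: l_def)
    qed
    then obtain j where j: "m = Suc (Suc j)" by (metis One_nat_def less_natE add_Suc_right plus_1_eq_Suc)
    have "\<not> \<bar>v x\<bar> < l (Suc j)" unfolding m_def using not_less_Least[of "Suc j" "\<lambda>n. \<bar>v x\<bar> < l n"] j m_def by simp
    then show ?thesis using m j by (auto simp: L_def intro!: exI[of _ j])
  qed
  have le: "f j \<le> (\<Sum>j. f j)" for f :: "nat \<Rightarrow> ennreal" and j
    using sum_le_suminf[OF summableI, of "{j}" f] by simp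
  have "(\<integral>\<^sup>+x. indicator {x. 2 * c \<le> \<bar>v x\<bar>} x * ennreal (\<bar>v x\<bar> powr q) \<partial>lborel)
     \<le> (\<integral>\<^sup>+x. (\<Sum>j. indicator (L (Suc j)) x * ennreal ((4 * l j) powr q)) \<partial>lborel)"
  proof (rule nn_integral_mono)
    fix x
    show "indicator {x. 2 * c \<le> \<bar>v x\<bar>} x * ennreal (\<bar>v x\<bar> powr q) \<le> (\<Sum>j. indicator (L (Suc j)) x * ennreal ((4 * l j) powr q))"
    proof (cases "2 * c \<le> \<bar>v x\<bar>")
      case True
      obtain j where j: "x \<in> L (Suc j)" using cover[OF True] by blast
      have "ennreal (\<bar>v x\<bar> powr q) \<le> indicator (L (Suc j)) x * ennreal ((4 * l j) powr q)"
        using j q_ge by (auto simp: L_def l intro!: ennreal_leI powr_mono2)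
      also have "\<dots> \<le> (\<Sum>j. indicator (L (Suc j)) x * ennreal ((4 * l j) powr q))"
        by (rule le)
      finally show ?thesis using True by simp
    qed simp
  qed
  also have "\<dots> = (\<Sum>j. ennreal ((4 * l j) powr q) * emeasure lborel (L (Suc j)))"
    by (subst nn_integral_suminf, measurable) (simp add: nn_integral_multc, simp add: mult.commute)
  also have "\<dots> \<le> (\<Sum>j. ennreal (strong_const * N powr (q - P)) * (\<integral>\<^sup>+x. indicator (L j) x * ennreal (norm (G x) powr P) \<partial>lborel))"
  proof (rule suminf_le[OF _ summableI summableI])
    fix j
    have "emeasure lborel (L (Suc j)) \<le> emeasure lborel {x. 2 * l j \<le> \<bar>v x\<bar>}"
      by (rule emeasure_mono) (auto simp: L_def l)
    then have "ennreal ((4 * l j) powr q) * emeasure lborel (L (Suc j)) \<le> ennreal ((4 * l j) powr q) * emeasure lborel {x. 2 * l j \<le> \<bar>v x\<bar>}"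
      by (intro mult_left_mono) auto
    also have "\<dots> \<le> ennreal (strong_const * N powr (q - P)) * (\<integral>\<^sup>+x. indicator (L j) x * ennreal (norm (G x) powr P) \<partial>lborel)"
      using level_set_layer_bound[OF v N z l(1)[of j]] by (simp add: L_def l)
    finally show "ennreal ((4 * l j) powr q) * emeasure lborel (L (Suc j))
      \<le> ennreal (strong_const * N powr (q - P)) * (\<integral>\<^sup>+x. indicator (L j) x * ennreal (norm (G x) powr P) \<partial>lborel)" .
  qed
  also have "\<dots> = ennreal (strong_const * N powr (q - P)) * (\<Sum>j. (\<integral>\<^sup>+x. indicator (L j) x * ennreal (norm (G x) powr P) \<partial>lborel))"
    by (rule ennreal_suminf_cmult)
  also have "(\<Sum>j. (\<integral>\<^sup>+x. indicator (L j) x * ennreal (norm (G x) powr P) \<partial>lborel))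
      = (\<integral>\<^sup>+x. (\<Sum>j. indicator (L j) x * ennreal (norm (G x) powr P)) \<partial>lborel)"
    by (rule nn_integral_suminf[symmetric]) measurable
  also have "\<dots> \<le> (\<integral>\<^sup>+x. ennreal (norm (G x) powr P) \<partial>lborel)"
  proof (rule nn_integral_mono)
    fix x
    have "(\<Sum>j. indicator (L j) x * ennreal (norm (G x) powr P)) = (\<Sum>j. indicator (L j) x) * ennreal (norm (G x) powr P)"
      by (rule ennreal_suminf_multc)
    also have "\<dots> = indicator (\<Union>j. L j) x * ennreal (norm (G x) powr P)"
      by (simp add: suminf_indicator[OF disj])
    also have "\<dots> \<le> ennreal (norm (G x) powr P)" by (auto split: split_indicator)
    finally show "(\<Sum>j. indicator (L j) x * ennreal (norm (G x) powr P)) \<le> ennreal (norm (G x) powr P)" .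
  qed
  also have "\<dots> \<le> ennreal (N powr P)" using N P by (subst Lp_norm_finite_le[symmetric]) auto
  also have "ennreal (strong_const * N powr (q - P)) * ennreal (N powr P) = ennreal (strong_const * N powr q)"
    using strong_const_nonneg by (simp add: ennreal_mult[symmetric] mult.assoc powr_add[symmetric])
  finally show ?thesis by (simp add: mult_left_mono)
qed

text \<open>The threshold of the previous bound tends to 0 while its constant stays fixed. At points
  with v x = 0 both sides of the limit are 0.\<close>

lemma sobolev_c1:
  assumes v: "c1_grad v G" and N: "0 \<le> N" "Lp_norm lborel p G \<le> ennreal N" and z: "vanishing v"
  shows "(\<integral>\<^sup>+x. ennreal (\<bar>v x\<bar> powr q) \<partial>lborel) \<le> ennreal (strong_const * N powr q)"
proof (rule nn_integral_le_limit)
  note [measurable] = c1_grad_measurable[OF v]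
  define c where "c n = 1 / real (Suc n)" for n
  show "(\<integral>\<^sup>+x. indicator {x. 2 * c n \<le> \<bar>v x\<bar>} x * ennreal (\<bar>v x\<bar> powr q) \<partial>lborel) \<le> ennreal (strong_const * N powr q)" for n
    by (rule sobolev_above_level[OF v N z]) (simp add: c_def)
  show "(\<lambda>x. indicator {x. 2 * c n \<le> \<bar>v x\<bar>} x * ennreal (\<bar>v x\<bar> powr q)) \<in> borel_measurable lborel" for n
    by measurable
  show "AE x in lborel. (\<lambda>n. indicator {x. 2 * c n \<le> \<bar>v x\<bar>} x * ennreal (\<bar>v x\<bar> powr q)) \<longlonglongrightarrow> ennreal (\<bar>v x\<bar> powr q)"
  proof (rule AE_I2)
    fix x
    show "(\<lambda>n. indicator {x. 2 * c n \<le> \<bar>v x\<bar>} x * ennreal (\<bar>v x\<bar> powr q)) \<longlonglongrightarrow> ennreal (\<bar>v x\<bar> powr q)"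
    proof (cases "v x = 0")
      case False
      have "(\<lambda>n. 2 * c n) \<longlonglongrightarrow> 2 * 0" unfolding c_def
        by (intro tendsto_mult tendsto_const LIMSEQ_inverse_real_of_nat[unfolded inverse_eq_divide])
      then have "\<forall>\<^sub>F n in sequentially. 2 * c n < \<bar>v x\<bar>" by (rule order_tendstoD(2)) (use False in simp)
      then show ?thesis by (intro tendsto_eventually) (auto elim!: eventually_mono)
    qed simp
  qed
qed

end

section \<open>From continuously differentiable functions to functions with a weak gradient\<close>

context mollifier
begin

lemma c1_grad_avg: "wgrad u g \<Longrightarrow> 0 < s \<Longrightarrow> c1_grad (avg s u) (avg s g)"
  by (auto simp: c1_grad_def wgrad_def intro: avg_has_gradient avg_continuous)

end

lemma c1_grad_diff_const: "c1_grad v G \<Longrightarrow> c1_grad (\<lambda>x. v x - c) G"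
  by (auto simp: c1_grad_def intro!: derivative_eq_intros)

context subcritical
begin

lemma weak_avg_limit:
  assumes w: "wgrad u g" and N: "0 \<le> N" "Lp_norm lborel p g \<le> ennreal N" and e: "0 < e"
  shows "(\<lambda>n. avg (real n) (avg e u) 0 - avg (real n) u 0) \<longlonglongrightarrow> 0"
proof (rule Lim_null_comparison)
  show "\<forall>\<^sub>F n in sequentially. norm (avg (real n) (avg e u) 0 - avg (real n) u 0) \<le> real n powr (- \<alpha>) * (e * R * N)"
    using eventually_gt_at_top[of 0]
    by eventually_elim (use avg_avg_close[OF w e _ p_ge N] in \<open>simp add: alpha\<close>)
qed (rule decay_tendsto_0)

lemma avg_Lp_le:
  assumes w: "wgrad u g" and N: "Lp_norm lborel p g \<le> ennreal N" and e: "0 < e"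
  shows "Lp_norm lborel p (avg e g) \<le> ennreal N"
  using avg_Lp[OF _ e p_ge, of g] w N by (auto simp: wgrad_def intro: order_trans)

text \<open>Mollifying at scale 1 leads to the C^1 case, and at large scales the averages of u and
  of its mollification differ by a null sequence.\<close>

lemma ex_weak_avg_limit:
  assumes w: "wgrad u g" and N: "0 \<le> N" "Lp_norm lborel p g \<le> ennreal N"
  shows "\<exists>k. (\<lambda>n. avg (real n) u 0) \<longlonglongrightarrow> k"
proof -
  obtain k where "(\<lambda>n. avg (real n) (avg 1 u) 0) \<longlonglongrightarrow> k"
    using ex_avg_limit[OF c1_grad_avg[OF w] N(1) avg_Lp_le[OF w N(2)], of 1] by auto
  from tendsto_diff[OF this weak_avg_limit[OF w N, of 1]] show ?thesis by auto
qed

text \<open>One constant k normalises the mollifications at every scale e, so their limit as e tends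
  to 0 is normalised by the same k.\<close>

lemma vanishing_avg:
  assumes w: "wgrad u g" and N: "0 \<le> N" "Lp_norm lborel p g \<le> ennreal N"
    and k: "(\<lambda>n. avg (real n) u 0) \<longlonglongrightarrow> k" and e: "0 < e"
  shows "vanishing (\<lambda>x. avg e u x - k)"
  unfolding vanishing_def
proof
  fix x
  note c = c1_grad_avg[OF w e]
  have "(\<lambda>n. avg (real n) (avg e u) 0) \<longlonglongrightarrow> k"
    using tendsto_add[OF weak_avg_limit[OF w N e] k] by simp
  from avg_limit_everywhere[OF c N(1) avg_Lp_le[OF w N(2) e] this, of x]
  have "(\<lambda>n. avg (real n) (avg e u) x - k) \<longlonglongrightarrow> k - k" by (intro tendsto_diff tendsto_const)
  then show "(\<lambda>n. avg (real n) (\<lambda>x. avg e u x - k) x) \<longlonglongrightarrow> 0"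
    using avg_shift[OF c1_grad_loc_int[OF c], where c="- k"] by simp
qed

text \<open>At dyadic scales the distances to \<open>u\<close> are summable in \<open>L\<^sup>p\<close>.\<close>

lemma AE_avg_tendsto:
  assumes w: "wgrad u g" and N: "0 \<le> N" "Lp_norm lborel p g \<le> ennreal N"
  shows "AE x in lborel. (\<lambda>n. avg ((1/2) ^ n) u x) \<longlonglongrightarrow> u x"
proof -
  have l: "loc_int u" using w by (simp add: wgrad_def)
  define e where "e n = (1/2 :: real) ^ n" for n
  have e: "0 < e n" for n by (simp add: e_def)
  note [measurable] = loc_int_measurable[OF l] borel_measurable_continuous_onI[OF avg_continuous[OF l e]]
  define A where "A = (R * N) powr P"
  define \<theta> where "\<theta> = (1/2 :: real) powr P"
  have \<theta>: "0 \<le> \<theta>" "\<theta> < 1" using P powr_less_mono2[of P "1/2" 1] by (auto simp: \<theta>_def)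
  have I: "(\<integral>\<^sup>+x. ennreal (\<bar>u x - avg (e n) u x\<bar> powr P) \<partial>lborel) \<le> ennreal (A * \<theta> ^ n)" for n
  proof -
    have "Lp_norm lborel p (\<lambda>x. u x - avg (e n) u x) \<le> ennreal (e n * R) * ennreal N"
      by (rule order_trans[OF diff_avg_Lp[OF w e p_ge]]) (intro mult_left_mono N, simp)
    also have "\<dots> = ennreal (e n * (R * N))" using e[of n] R_pos N by (simp add: ennreal_mult[symmetric] mult.assoc)
    finally have "(\<integral>\<^sup>+x. ennreal (norm (u x - avg (e n) u x) powr P) \<partial>lborel) \<le> ennreal ((e n * (R * N)) powr P)"
      using e[of n] R_pos N P by (subst Lp_norm_finite_le[symmetric]) auto
    also have "(e n * (R * N)) powr P = e n powr P * (R * N) powr P" by (rule powr_mult; use e R_pos N in \<open>simp add: less_imp_le\<close>)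
    also have "e n powr P = \<theta> ^ n" by (simp add: e_def \<theta>_def powr_realpow[symmetric] powr_powr powr_power mult.commute)
    finally show ?thesis by (simp add: A_def mult.commute)
  qed
  have "(\<integral>\<^sup>+x. (\<Sum>n. ennreal (\<bar>u x - avg (e n) u x\<bar> powr P)) \<partial>lborel)
      = (\<Sum>n. (\<integral>\<^sup>+x. ennreal (\<bar>u x - avg (e n) u x\<bar> powr P) \<partial>lborel))"
    by (rule nn_integral_suminf) measurable
  also have "\<dots> \<le> (\<Sum>n. ennreal (A * \<theta> ^ n))"
    by (intro suminf_le summableI I)
  also have "\<dots> < \<infinity>"
    using \<theta> by (subst suminf_ennreal2) (auto simp: A_def intro!: summable_mult summable_geometric)
  finally have "AE x in lborel. (\<Sum>n. ennreal (\<bar>u x - avg (e n) u x\<bar> powr P)) \<noteq> \<infinity>"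
    by (intro nn_integral_PInf_AE) auto
  then show ?thesis
  proof eventually_elim
    case (elim x)
    then have "summable (\<lambda>n. \<bar>u x - avg (e n) u x\<bar> powr P)" by (intro summable_suminf_not_top) auto
    then have "(\<lambda>n. \<bar>u x - avg (e n) u x\<bar> powr P) \<longlonglongrightarrow> 0" by (rule summable_LIMSEQ_zero)
    then have "(\<lambda>n. (\<bar>u x - avg (e n) u x\<bar> powr P) powr (1 / P)) \<longlonglongrightarrow> 0"
      by (rule tendsto_zero_powrI[where b="1 / P"]) (use P in auto)
    then have "(\<lambda>n. \<bar>u x - avg (e n) u x\<bar>) \<longlonglongrightarrow> 0" using P by (simp add: powr_powr)
    then have "(\<lambda>n. u x - avg (e n) u x) \<longlonglongrightarrow> 0" by (rule tendsto_rabs_zero_cancel)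
    from tendsto_diff[OF tendsto_const[of "u x"] this] show ?case by (simp add: e_def)
  qed
qed

text \<open>Fatou's lemma along the scales 2^(-n). The bound for the mollifications is uniform,
  because averaging does not increase the L^p norm of the gradient.\<close>

lemma sobolev_wgrad:
  assumes w: "wgrad u g" and N: "0 \<le> N" "Lp_norm lborel p g \<le> ennreal N"
    and k: "(\<lambda>n. avg (real n) u 0) \<longlonglongrightarrow> k"
  shows "(\<integral>\<^sup>+x. ennreal (\<bar>u x - k\<bar> powr q) \<partial>lborel) \<le> ennreal (strong_const * N powr q)"
proof (rule nn_integral_le_limit)
  have l: "loc_int u" using w by (simp add: wgrad_def)
  have e: "0 < (1/2 :: real) ^ n" for n by simp
  show "(\<integral>\<^sup>+x. ennreal (\<bar>avg ((1/2) ^ n) u x - k\<bar> powr q) \<partial>lborel) \<le> ennreal (strong_const * N powr q)" for n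
    by (rule sobolev_c1[OF c1_grad_diff_const[OF c1_grad_avg[OF w e]] N(1) avg_Lp_le[OF w N(2) e] vanishing_avg[OF w N k e]])
  note [measurable] = borel_measurable_continuous_onI[OF avg_continuous[OF l e]]
  show "(\<lambda>x. ennreal (\<bar>avg ((1/2) ^ n) u x - k\<bar> powr q)) \<in> borel_measurable lborel" for n by measurable
  show "AE x in lborel. (\<lambda>n. ennreal (\<bar>avg ((1/2) ^ n) u x - k\<bar> powr q)) \<longlonglongrightarrow> ennreal (\<bar>u x - k\<bar> powr q)"
    using AE_avg_tendsto[OF w N]
  proof eventually_elim
    case (elim x)
    show ?case
      by (intro tendsto_ennrealI tendsto_powr2[where a="\<bar>u x - k\<bar>"] tendsto_rabs tendsto_diff elim tendsto_const) (use q_ge in auto)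
  qed
qed

text \<open>As P is finite, the part of g outside a large ball has small L^P norm, and
  \<open>avg 1 g x\<close> sees only points within distance R of x.\<close>

lemma avg_gradient_tendsto_0:
  assumes g: "loc_int g" and N: "0 \<le> N" "Lp_norm lborel p g \<le> ennreal N" and e: "0 < e"
  shows "\<exists>\<rho>. \<forall>x. \<rho> \<le> norm x \<longrightarrow> norm (avg 1 g x :: 'b::euclidean_space) \<le> e"
proof -
  note [measurable] = loc_int_measurable[OF g]
  define h where "h n x = indicator {x. real n \<le> norm x} x *\<^sub>R g x" for n x
  have [measurable]: "h n \<in> borel_measurable borel" for n unfolding h_def[abs_def] by measurable
  have fin: "(\<integral>\<^sup>+x. ennreal (norm (g x) powr P) \<partial>lborel) < \<infinity>"
  proof -
    have "(\<integral>\<^sup>+x. ennreal (norm (g x) powr P) \<partial>lborel) \<le> ennreal (N powr P)"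
      using N P by (subst Lp_norm_finite_le[symmetric]) auto
    then show ?thesis by (simp add: le_less_trans)
  qed
  have "(\<lambda>n. (\<integral>\<^sup>+x. ennreal (norm (h n x) powr P) \<partial>lborel)) \<longlonglongrightarrow> (\<integral>\<^sup>+x. 0 \<partial>(lborel :: 'a measure))"
  proof (rule nn_integral_dominated_convergence[where w="\<lambda>x. ennreal (norm (g x) powr P)"])
    show "AE x in lborel. (\<lambda>n. ennreal (norm (h n x) powr P)) \<longlonglongrightarrow> 0"
    proof (rule AE_I2)
      fix x :: 'a
      obtain m where "norm x < real m" using reals_Archimedean2 by blast
      then show "(\<lambda>n. ennreal (norm (h n x) powr P)) \<longlonglongrightarrow> 0"
        by (intro tendsto_eventually eventually_sequentiallyI[of m]) (auto simp: h_def)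
    qed
    show "AE x in lborel. ennreal (norm (h n x) powr P) \<le> ennreal (norm (g x) powr P)" for n
      by (intro AE_I2) (auto simp: h_def split: split_indicator)
  qed (use fin in auto)
  then have "\<forall>\<^sub>F n in sequentially. (\<integral>\<^sup>+x. ennreal (norm (h n x) powr P) \<partial>lborel) < ennreal (e powr P)"
    by (intro order_tendstoD(2)) (use e in auto)
  then obtain n where n: "(\<integral>\<^sup>+x. ennreal (norm (h n x) powr P) \<partial>lborel) < ennreal (e powr P)"
    by (auto simp: eventually_sequentially)
  then have "Lp_norm lborel p (h n) \<le> ennreal e" using e P by (subst Lp_norm_finite_le) auto
  then have le: "norm (avg 1 (h n) x) \<le> e" for x
    using avg_pointwise[OF _ _ p_ge, of "h n" 1 e x] e by simp
  show ?thesis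
  proof (intro exI[of _ "real n + R"] allI impI)
    fix x :: 'a assume x: "real n + R \<le> norm x"
    have "avg 1 g x = avg 1 (h n) x"
      unfolding avg_def
    proof (rule integral_cong_AE)
      show "AE y in K. g (x - 1 *\<^sub>R y) = h n (x - 1 *\<^sub>R y)"
        using AE_K
      proof eventually_elim
        case (elim y)
        then have "real n \<le> norm (x - y)" using x norm_triangle_ineq2[of x y] by linarith
        then show ?case by (simp add: h_def)
      qed
    qed measurable
    then show "norm (avg 1 g x) \<le> e" using le[of x] by simp
  qed
qed

text \<open>The value at x splits into its average at scale r, small uniformly in x for large r, and
  a difference of at most r R times the gradient near x. The scale r is fixed first; then x goes to
  infinity, where the mollified gradient is small.\<close>

lemma avg_tendsto_0_at_infinity:
  assumes w: "wgrad u g" and N: "0 \<le> N" "Lp_norm lborel p g \<le> ennreal N"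
    and k: "(\<lambda>n. avg (real n) u 0) \<longlonglongrightarrow> k"
  shows "((\<lambda>x. avg 1 u x - k) \<longlongrightarrow> 0) at_infinity"
  unfolding tendsto_iff eventually_at_infinity
proof (intro allI impI)
  fix e :: real assume e: "0 < e"
  have one: "(0::real) < 1" by simp
  have g: "loc_int g" using w by (simp add: wgrad_def)
  define v where "v x = avg 1 u x - k" for x
  note v = c1_grad_diff_const[OF c1_grad_avg[OF w one], of k, folded v_def]
  note z = vanishing_avg[OF w N k one, folded v_def]
  have "\<forall>\<^sub>F n in sequentially. R * N * (real n powr (1 - \<alpha>) / (\<alpha> - 1)) < e / 2 \<and> n \<ge> 1"
    by (intro eventually_conj order_tendstoD(2)[OF tail_tendsto_0] eventually_ge_at_top) (use e in simp)
  then obtain n where n: "R * N * (real n powr (1 - \<alpha>) / (\<alpha> - 1)) < e / 2" "n \<ge> 1"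
    by (auto simp: eventually_sequentially)
  define r where "r = real n"
  have r: "1 \<le> r" using n by (simp add: r_def)
  define e' where "e' = e / (2 * r * R)"
  have e': "0 < e'" "r * R * e' = e / 2" using e r R_pos by (auto simp: e'_def field_simps)
  obtain \<rho> where \<rho>: "\<And>x. \<rho> \<le> norm x \<Longrightarrow> norm (avg 1 g x) \<le> e'"
    using avg_gradient_tendsto_0[OF g N e'(1)] by blast
  have "dist (v x) 0 < e" if x: "\<rho> + r * R \<le> norm x" for x
  proof -
    have "\<bar>v x - avg r v x\<bar> \<le> r * R * e'"
    proof (rule c1_diff_avg_le[OF v])
      fix y assume "norm (y - x) \<le> r * R"
      then have "\<rho> \<le> norm y" using x norm_triangle_ineq2[of x y] by (simp add: norm_minus_commute)
      then show "norm (avg 1 g y) \<le> e'" by (rule \<rho>)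
    qed (use r in simp)
    moreover have "\<bar>avg r v x\<bar> < e / 2"
      by (rule order.strict_trans1[OF avg_le_if_vanishing[OF v N(1) avg_Lp_le[OF w N(2) one] z] n(1)[folded r_def]])
         (use r in simp)
    ultimately show ?thesis using e'(2) unfolding dist_real_def by linarith
  qed
  then show "\<exists>b. \<forall>x. b \<le> norm x \<longrightarrow> dist (avg 1 u x - k) 0 < e" unfolding v_def by blast
qed

end

section \<open>Borel representatives\<close>

lemma Lp_norm_lebesgue:
  fixes f :: "'a::euclidean_space \<Rightarrow> 'b::euclidean_space"
  assumes [measurable]: "f \<in> borel_measurable borel"
  shows "Lp_norm lebesgue p f = Lp_norm lborel p f"
proof -
  have m: "(\<lambda>x. ennreal (norm (f x))) \<in> borel_measurable lborel" by measurable
  have "esssup lebesgue (\<lambda>x. ennreal (norm (f x))) = esssup lborel (\<lambda>x. ennreal (norm (f x)))"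
    unfolding esssup_eq_AE[OF m] esssup_eq_AE[OF measurable_completion[OF m]] AE_completion_iff ..
  then show ?thesis by (simp add: Lp_norm_def nn_integral_completion)
qed

lemma Lp_norm_cong_AE:
  assumes "f \<in> borel_measurable M" "g \<in> borel_measurable M" and ae: "AE x in M. f x = g x"
  shows "Lp_norm M p f = Lp_norm M p g"
proof -
  have "esssup M (\<lambda>x. ennreal (norm (f x))) = esssup M (\<lambda>x. ennreal (norm (g x)))"
    by (rule esssup_AE_cong) (use assms in auto)
  moreover have "(\<integral>\<^sup>+x. ennreal (norm (f x) powr enn2real p) \<partial>M) = (\<integral>\<^sup>+x. ennreal (norm (g x) powr enn2real p) \<partial>M)"
    by (rule nn_integral_cong_AE) (use ae in auto)
  ultimately show ?thesis by (simp add: Lp_norm_def)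
qed

lemma ex_borel_representative:
  fixes f :: "'a::euclidean_space \<Rightarrow> 'b::euclidean_space"
  assumes f: "f \<in> borel_measurable lebesgue"
  shows "\<exists>f'\<in>borel_measurable borel. AE x in lebesgue. f x = f' x"
proof -
  have "\<forall>i. \<exists>h\<in>borel_measurable lborel. AE x in lborel. f x \<bullet> i = h x" for i
    using f by (intro allI completion_ex_borel_measurable_real) auto
  then have "\<exists>h. \<forall>i. h i \<in> borel_measurable lborel \<and> (AE x in lborel. f x \<bullet> i = h i x)"
    by (intro choice) blast
  then obtain h where h: "\<And>i. h i \<in> borel_measurable borel" "\<And>i. AE x in lborel. f x \<bullet> i = h i x"
    by auto
  have "AE x in lborel. \<forall>i\<in>Basis. f x \<bullet> i = h i x" by (intro AE_finite_allI h) simp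
  then have "AE x in lebesgue. \<forall>i\<in>Basis. f x \<bullet> i = h i x" by (rule AE_completion)
  then have "AE x in lebesgue. f x = (\<Sum>i\<in>Basis. h i x *\<^sub>R i)"
  proof eventually_elim
    case (elim x)
    have "f x = (\<Sum>i\<in>Basis. (f x \<bullet> i) *\<^sub>R i)" by (simp add: euclidean_representation)
    also have "\<dots> = (\<Sum>i\<in>Basis. h i x *\<^sub>R i)" using elim by (intro sum.cong) auto
    finally show ?case .
  qed
  then show ?thesis using h(1) by (intro bexI[of _ "\<lambda>x. \<Sum>i\<in>Basis. h i x *\<^sub>R i"]) auto
qed

text \<open>The function is the pointwise limit of its restrictions to growing closed balls, each of
  which is integrable and hence measurable.\<close>

lemma absolutely_integrable_on_compact_measurable:
  fixes f :: "'a::euclidean_space \<Rightarrow> 'b::euclidean_space"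
  assumes f: "\<And>K. compact K \<Longrightarrow> f absolutely_integrable_on K"
  shows "f \<in> borel_measurable lebesgue"
proof (rule borel_measurable_LIMSEQ_metric)
  fix n
  show "(\<lambda>x. indicator (cball 0 (real n)) x *\<^sub>R f x) \<in> borel_measurable lebesgue"
    using f[OF compact_cball, of 0 "real n"] unfolding set_integrable_def by (rule borel_measurable_integrable)
next
  fix x :: 'a
  obtain m where "norm x < real m" using reals_Archimedean2 by blast
  then show "(\<lambda>n. indicator (cball 0 (real n)) x *\<^sub>R f x) \<longlonglongrightarrow> f x"
    by (intro tendsto_eventually eventually_sequentiallyI[of m]) auto
qed

lemma absolutely_integrable_on_compact_iff_loc_int:
  fixes f :: "'a::euclidean_space \<Rightarrow> 'b::euclidean_space"
  assumes f[measurable]: "f \<in> borel_measurable borel"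
  shows "(\<forall>K. compact K \<longrightarrow> f absolutely_integrable_on K) \<longleftrightarrow> loc_int f"
proof
  assume *: "\<forall>K. compact K \<longrightarrow> f absolutely_integrable_on K"
  show "loc_int f"
  proof (rule loc_intI[OF f])
    fix r
    have "integrable lebesgue (\<lambda>x. indicator (cball 0 r) x *\<^sub>R f x)"
      using * compact_cball unfolding set_integrable_def by blast
    then show "integrable lborel (\<lambda>x. indicator (cball 0 r) x *\<^sub>R f x)"
      by (subst (asm) integrable_completion) auto
  qed
next
  assume l: "loc_int f"
  show "\<forall>K. compact K \<longrightarrow> f absolutely_integrable_on K"
  proof (intro allI impI)
    fix K :: "'a set" assume K: "compact K"
    then have [measurable]: "K \<in> sets borel" by (simp add: borel_compact)
    obtain r where r: "K \<subseteq> cball 0 r" using compact_imp_bounded[OF K] by (force simp: bounded_iff)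
    have "integrable lborel (\<lambda>x. indicator K x *\<^sub>R f x)"
      by (rule loc_int_integrable[OF l, where B=1 and a=0 and r=r]) (use r in \<open>auto split: split_indicator\<close>)
    then show "f absolutely_integrable_on K"
      unfolding set_integrable_def by (subst integrable_completion) auto
  qed
qed

lemma has_weak_gradient_iff_wgrad:
  fixes u :: "'a::euclidean_space \<Rightarrow> real"
  assumes [measurable]: "u \<in> borel_measurable borel" "g \<in> borel_measurable borel"
  shows "has_weak_gradient u g \<longleftrightarrow> wgrad u g"
proof -
  have "(LINT x|lebesgue. u x * partial_deriv i \<phi> x) = (\<integral>x. u x * partial_deriv i \<phi> x \<partial>lborel)"
    "(LINT x|lebesgue. (g x \<bullet> i) * \<phi> x) = (\<integral>x. (g x \<bullet> i) * \<phi> x \<partial>lborel)"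
    if "\<phi> \<in> test_fun" "i \<in> Basis" for \<phi> :: "'a \<Rightarrow> real" and i
    using test_fun_measurable[OF that(1)] test_fun_measurable[OF test_fun_partial_deriv[OF that]]
    by (intro integral_completion; simp)+
  then show ?thesis
    unfolding has_weak_gradient_def wgrad_def
      absolutely_integrable_on_compact_iff_loc_int[OF assms(1)] absolutely_integrable_on_compact_iff_loc_int[OF assms(2)]
    by auto
qed

lemma has_weak_gradient_measurable:
  assumes "has_weak_gradient u g"
  shows "u \<in> borel_measurable lebesgue" "g \<in> borel_measurable lebesgue"
  using assms by (auto simp: has_weak_gradient_def intro: absolutely_integrable_on_compact_measurable)

lemma has_weak_gradient_cong_AE:
  fixes u u' :: "'a::euclidean_space \<Rightarrow> real"
  assumes w: "has_weak_gradient u g" and u: "AE x in lebesgue. u x = u' x" and g: "AE x in lebesgue. g x = g' x"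
  shows "has_weak_gradient u' g'"
proof -
  note m = has_weak_gradient_measurable[OF w]
  have m': "u' \<in> borel_measurable lebesgue" "g' \<in> borel_measurable lebesgue"
    using borel_measurable_AE[OF m(1) u] borel_measurable_AE[OF m(2) g] by auto
  have ai: "f' absolutely_integrable_on K"
    if "f absolutely_integrable_on K" "f' \<in> borel_measurable lebesgue" "AE x in lebesgue. f x = f' x" "compact K"
    for f f' :: "'a \<Rightarrow> 'b::euclidean_space" and K
  proof -
    have [measurable]: "K \<in> sets lebesgue" using that(4) by (simp add: borel_compact)
    have "f \<in> borel_measurable lebesgue" using borel_measurable_AE[OF that(2), of f] that(3) by (auto simp: eq_commute)
    then show ?thesis
      using that(1) unfolding set_integrable_def
      by (subst (asm) integrable_cong_AE[where g="\<lambda>x. indicator K x *\<^sub>R f' x"]) (use that(2,3) in auto)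
  qed
  show ?thesis
    unfolding has_weak_gradient_def
  proof (intro conjI allI impI ballI)
    show "u' absolutely_integrable_on K" if "compact K" for K
      using w that by (intro ai[OF _ m'(1) u]) (auto simp: has_weak_gradient_def)
    show "g' absolutely_integrable_on K" if "compact K" for K
      using w that by (intro ai[OF _ m'(2) g]) (auto simp: has_weak_gradient_def)
    fix \<phi> :: "'a \<Rightarrow> real" and i :: 'a assume \<phi>: "\<phi> \<in> test_fun" and i: "i \<in> Basis"
    have [measurable]: "\<phi> \<in> borel_measurable lebesgue" "partial_deriv i \<phi> \<in> borel_measurable lebesgue"
      using test_fun_measurable[OF \<phi>] test_fun_measurable[OF test_fun_partial_deriv[OF \<phi> i]] by (auto intro: measurable_completion)
    have "(LINT x|lebesgue. u' x * partial_deriv i \<phi> x) = (LINT x|lebesgue. u x * partial_deriv i \<phi> x)"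
      by (rule integral_cong_AE) (use m m' u in auto)
    also have "\<dots> = - (LINT x|lebesgue. (g x \<bullet> i) * \<phi> x)"
      using w \<phi> i by (simp add: has_weak_gradient_def)
    also have "(LINT x|lebesgue. (g x \<bullet> i) * \<phi> x) = (LINT x|lebesgue. (g' x \<bullet> i) * \<phi> x)"
      by (rule integral_cong_AE) (use m m' g in auto)
    finally show "(LINT x|lebesgue. u' x * partial_deriv i \<phi> x) = - (LINT x|lebesgue. (g' x \<bullet> i) * \<phi> x)" .
  qed
qed

text \<open>Both the function and its gradient become Borel, which makes the product measure
  arguments for averages applicable.\<close>

lemma ex_wgrad_representative:
  fixes u :: "'a::euclidean_space \<Rightarrow> real"
  assumes "has_weak_gradient u g"
  obtains u' g' where "wgrad u' g'" "AE x in lebesgue. u x = u' x" "AE x in lebesgue. g x = g' x"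
proof -
  note m = has_weak_gradient_measurable[OF assms]
  obtain u' g' where *: "u' \<in> borel_measurable borel" "g' \<in> borel_measurable borel"
    "AE x in lebesgue. u x = u' x" "AE x in lebesgue. g x = g' x"
    using ex_borel_representative[OF m(1)] ex_borel_representative[OF m(2)] by metis
  from has_weak_gradient_cong_AE[OF assms *(3,4)] have "wgrad u' g'"
    using has_weak_gradient_iff_wgrad[OF *(1,2)] by simp
  with * that show ?thesis by blast
qed

lemma wgrad_imp_has_weak_gradient: "wgrad u g \<Longrightarrow> has_weak_gradient u g"
  using has_weak_gradient_iff_wgrad[of u g] by (auto simp: wgrad_def dest: loc_int_measurable)

text \<open>\<open>weak_grad\<close> is an arbitrary choice. As soon as some weak gradient exists,
  the chosen function is one, and uniqueness for a Borel version of it identifies it with g almost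
  everywhere. All norms of \<open>weak_grad\<close> are evaluated in this way.\<close>

lemma weak_grad_AE_eq:
  assumes w: "wgrad u g" and v: "AE x in lebesgue. u x = v x"
  shows "AE x in lebesgue. weak_grad v x = g x" "weak_grad v \<in> borel_measurable lebesgue"
    "Lp_norm lebesgue p (weak_grad v) = Lp_norm lborel p g" "has_weak_gradient v g"
proof -
  show hg: "has_weak_gradient v g"
    by (rule has_weak_gradient_cong_AE[OF wgrad_imp_has_weak_gradient[OF w] v]) simp
  then have hw: "has_weak_gradient v (weak_grad v)" unfolding weak_grad_def by (rule someI[of "has_weak_gradient v" g])
  show m: "weak_grad v \<in> borel_measurable lebesgue" by (rule has_weak_gradient_measurable[OF hw])
  obtain h where h: "h \<in> borel_measurable borel" "AE x in lebesgue. weak_grad v x = h x"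
    using ex_borel_representative[OF m] by blast
  have bm: "u \<in> borel_measurable borel" "g \<in> borel_measurable borel" using w by (auto simp: wgrad_def dest: loc_int_measurable)
  have "has_weak_gradient u h"
    by (rule has_weak_gradient_cong_AE[OF hw _ h(2)]) (use v in \<open>auto simp: eq_commute\<close>)
  then have "wgrad u h" using has_weak_gradient_iff_wgrad[OF bm(1) h(1)] by simp
  from AE_completion[OF wgrad_unique[OF this w]] h(2)
  show ae: "AE x in lebesgue. weak_grad v x = g x" by eventually_elim simp
  have "Lp_norm lebesgue p (weak_grad v) = Lp_norm lebesgue p g"
    by (rule Lp_norm_cong_AE[OF m measurable_completion ae]) (use bm in simp)
  then show "Lp_norm lebesgue p (weak_grad v) = Lp_norm lborel p g" using Lp_norm_lebesgue[OF bm(2)] by simp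
qed

text \<open>The integral of the derivative is invariant under the translations by t i, hence equal
  to its average over t in [0, 1]. By Fubini's theorem and the fundamental theorem of calculus this
  is the integral of \<phi> (x + i) - \<phi> x, which is 0. Thus constants have weak gradient
  0.\<close>

lemma integral_partial_deriv_eq_0:
  fixes \<phi> :: "'a::euclidean_space \<Rightarrow> real"
  assumes \<phi>: "\<phi> \<in> test_fun" and i: "i \<in> Basis"
  shows "(\<integral>x. partial_deriv i \<phi> x \<partial>lborel) = 0"
proof -
  interpret T: prob_space uniform01 by (rule prob_space_uniform01)
  interpret Q: pair_sigma_finite "lborel :: 'a measure" uniform01 ..
  define \<psi> where "\<psi> = partial_deriv i \<phi>"
  have \<psi>: "\<psi> \<in> test_fun" unfolding \<psi>_def by (rule test_fun_partial_deriv[OF \<phi> i])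
  note [measurable] = test_fun_measurable[OF \<psi>] test_fun_measurable[OF \<phi>]
  obtain C where C: "\<And>x. C < norm x \<Longrightarrow> \<psi> x = 0" using test_fun_support[OF \<psi>] by metis
  obtain D where D: "\<And>x. \<bar>\<psi> x\<bar> \<le> D" using test_fun_bounded[OF \<psi>] by metis
  have one: "loc_int (\<lambda>_ :: 'a. 1 :: real)" by (intro loc_int_continuous continuous_on_const)
  have "integrable (lborel \<Otimes>\<^sub>M uniform01) (\<lambda>(x, t). (1 :: real) \<bullet> \<psi> (x + t *\<^sub>R i))"
  proof (rule integrable_pair_translate[OF prob_space_uniform01 _ one, where \<tau>="\<lambda>_. 0" and \<rho>=0 and B=D and C="C + 1"])
    show "AE t in uniform01. \<forall>x. x \<notin> cball 0 (C + 1) \<longrightarrow> \<psi> (x + t *\<^sub>R i) = 0"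
      using AE_uniform01
    proof (eventually_elim, safe)
      fix t :: real and x :: 'a assume t: "0 \<le> t" "t \<le> 1" and x: "x \<notin> cball 0 (C + 1)"
      have "norm x \<le> norm (x + t *\<^sub>R i) + norm (t *\<^sub>R i)" using norm_triangle_ineq4[of "x + t *\<^sub>R i" "t *\<^sub>R i"] by simp
      then have "C < norm (x + t *\<^sub>R i)" using t x i by simp
      then show "\<psi> (x + t *\<^sub>R i) = 0" by (rule C)
    qed
    show "(\<lambda>(x, t). \<psi> (x + t *\<^sub>R i)) \<in> borel_measurable (lborel \<Otimes>\<^sub>M uniform01)" by measurable
  qed (use D in simp_all)
  from Q.Fubini_integral[OF this]
  have "(\<integral>t. (\<integral>x. \<psi> (x + t *\<^sub>R i) \<partial>lborel) \<partial>uniform01) = (\<integral>x. (\<integral>t. \<psi> (x + t *\<^sub>R i) \<partial>uniform01) \<partial>lborel)" by simp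
  moreover have "(\<integral>x. \<psi> (x + t *\<^sub>R i) \<partial>lborel) = (\<integral>x. \<psi> x \<partial>lborel)" for t
    by (subst (2) lborel_integral_affine[of _ 1 "t *\<^sub>R i"]) (auto simp: add.commute)
  moreover have "(\<integral>t. \<psi> (x + t *\<^sub>R i) \<partial>uniform01) = \<phi> (x + i) - \<phi> x" for x
  proof -
    have "\<psi> y = grad \<phi> y \<bullet> i" for y
      unfolding \<psi>_def using frechet_derivative_eq_grad[of \<phi> y i] test_fun_has_derivative[OF \<phi>] differentiableI by blast
    then show ?thesis
      using integral_gradient_segment[OF test_fun_grad[OF \<phi>] grad_continuous[OF \<phi>], of x i] by simp
  qed
  moreover have "(\<integral>x. \<phi> (x + i) - \<phi> x \<partial>lborel) = 0"
  proof -
    have I: "integrable lborel \<phi>" using loc_int_test_fun_integrable[OF one \<phi>] by simp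
    have "integrable lborel (\<lambda>x. \<phi> (x + i))" using lborel_integrable_affine[OF I, of 1 i] by (simp add: add.commute)
    moreover have "(\<integral>x. \<phi> (x + i) \<partial>lborel) = (\<integral>x. \<phi> x \<partial>lborel)"
      by (subst (2) lborel_integral_affine[of _ 1 i]) (auto simp: add.commute)
    ultimately show ?thesis using I by simp
  qed
  ultimately show ?thesis by (simp add: T.prob_space \<psi>_def)
qed

lemma wgrad_shift:
  fixes u :: "'a::euclidean_space \<Rightarrow> real"
  assumes "wgrad u g"
  shows "wgrad (\<lambda>x. u x + c) g"
proof -
  have "wgrad (\<lambda>_ :: 'a. c) (\<lambda>_. 0)"
    by (auto simp: wgrad_def integral_partial_deriv_eq_0 intro!: loc_int_continuous)
  from wgrad_add[OF assms this, of 1 1] show ?thesis by simp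
qed

section \<open>Classes modulo constants\<close>

lemma const_class_measurable:
  fixes u :: "'a::euclidean_space \<Rightarrow> real"
  assumes "v \<in> const_class u"
  shows "v \<in> borel_measurable lebesgue" "u \<in> borel_measurable lebesgue"
proof -
  from assms obtain c where v: "v \<in> borel_measurable lebesgue" and c: "AE x in lebesgue. v x = u x + c"
    by (auto simp: const_class_def)
  show "v \<in> borel_measurable lebesgue" by (rule v)
  have "AE x in lebesgue. v x - c = u x" using c by eventually_elim simp
  then show "u \<in> borel_measurable lebesgue" by (rule borel_measurable_AE[rotated]) (use v in simp)
qed

lemma const_class_self: "u \<in> borel_measurable lebesgue \<Longrightarrow> u \<in> const_class u"
  by (auto simp: const_class_def intro!: exI[of _ 0])

lemma const_class_eq:
  fixes u :: "'a::euclidean_space \<Rightarrow> real"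
  assumes "AE x in lebesgue. v x = u x + c"
  shows "const_class v = const_class u"
proof -
  have "\<exists>b. AE x in lebesgue. w x = u x + b" if "AE x in lebesgue. w x = v x + a" for w a
  proof -
    have "AE x in lebesgue. w x = u x + (c + a)" using that assms by eventually_elim simp
    then show ?thesis by blast
  qed
  moreover have "\<exists>b. AE x in lebesgue. w x = v x + b" if "AE x in lebesgue. w x = u x + a" for w a
  proof -
    have "AE x in lebesgue. w x = v x + (a - c)" using that assms by eventually_elim simp
    then show ?thesis by blast
  qed
  ultimately show ?thesis by (auto simp: const_class_def)
qed

text \<open>The choice is determined only up to a constant and a null set. Averages at positive
  scales ignore the null set, and the anchor below compensates the constant.\<close>

definition rep :: "('a::euclidean_space \<Rightarrow> real) set \<Rightarrow> 'a \<Rightarrow> real" where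
  "rep U = (SOME u. u \<in> U \<and> (\<exists>g. wgrad u g))"

lemma rep_const_class:
  assumes w: "wgrad u g" and v: "AE x in lebesgue. v x = u x + c"
  shows "rep (const_class v) \<in> const_class v" "\<exists>c. AE x in lborel. rep (const_class v) x = u x + c" "wgrad (rep (const_class v)) g"
proof -
  have um: "u \<in> borel_measurable borel" using w by (auto simp: wgrad_def dest: loc_int_measurable)
  have "u \<in> const_class u" by (rule const_class_self) (use um in \<open>simp add: measurable_completion\<close>)
  then have "u \<in> const_class v" using const_class_eq[OF v] by simp
  with w have "\<exists>u. u \<in> const_class v \<and> (\<exists>g. wgrad u g)" by blast
  from someI_ex[OF this] have "rep (const_class v) \<in> const_class v \<and> (\<exists>g. wgrad (rep (const_class v)) g)"
    unfolding rep_def .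
  then obtain h where h: "rep (const_class v) \<in> const_class v" "wgrad (rep (const_class v)) h" by blast
  show "rep (const_class v) \<in> const_class v" by (rule h)
  obtain b where b: "AE x in lebesgue. rep (const_class v) x = u x + b"
    using h(1) const_class_eq[OF v] by (auto simp: const_class_def)
  then have b': "AE x in lborel. rep (const_class v) x = u x + b" by (simp add: AE_completion_iff)
  then show "\<exists>c. AE x in lborel. rep (const_class v) x = u x + c" ..
  have "AE x in lebesgue. u x + b = rep (const_class v) x" using b by eventually_elim simp
  from weak_grad_AE_eq(4)[OF wgrad_shift[OF w] this]
  have "has_weak_gradient (rep (const_class v)) g" .
  then show "wgrad (rep (const_class v)) g"
    using has_weak_gradient_iff_wgrad[of "rep (const_class v)" g] h(2) w by (auto simp: wgrad_def dest: loc_int_measurable)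
qed

text \<open>That N is real records the finiteness of the gradient norm, which all members of the
  class share.\<close>

definition rep_gradient :: "ennreal \<Rightarrow> ('a::euclidean_space \<Rightarrow> real) set \<Rightarrow> ('a \<Rightarrow> 'a) \<Rightarrow> real \<Rightarrow> bool" where
  "rep_gradient p U g N \<longleftrightarrow> wgrad (rep U) g \<and> U = const_class (rep U) \<and> 0 \<le> N \<and> Lp_norm lborel p g = ennreal N
     \<and> Wdot_norm p U = ennreal N \<and> (\<forall>u\<in>U. Lp_norm lebesgue p (weak_grad u) = ennreal N)
     \<and> (\<forall>u\<in>U. \<exists>c. AE x in lebesgue. u x = rep U x + c)"

lemma rep_gradientD:
  assumes "rep_gradient p U g N"
  shows "wgrad (rep U) g" "U = const_class (rep U)" "0 \<le> N" "Lp_norm lborel p g = ennreal N" "Lp_norm lborel p g \<le> ennreal N"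
    "Wdot_norm p U = ennreal N" "\<And>u. u \<in> U \<Longrightarrow> Lp_norm lebesgue p (weak_grad u) = ennreal N"
    "\<And>u. u \<in> U \<Longrightarrow> \<exists>c. AE x in lebesgue. u x = rep U x + c"
  using assms by (auto simp: rep_gradient_def)

lemma ex_rep_gradient:
  fixes U :: "('a::euclidean_space \<Rightarrow> real) set"
  assumes "U \<in> Wdot p"
  obtains g N where "rep_gradient p U g N"
proof -
  from assms obtain v where v: "U = const_class v" "v \<in> W1p_loc p" "weak_grad v \<in> Lp_space lebesgue p"
    by (auto simp: Wdot_def)
  then obtain h where "has_weak_gradient v h" by (auto simp: W1p_loc_def)
  then obtain u g where u: "wgrad u g" "AE x in lebesgue. v x = u x" by (rule ex_wgrad_representative)
  then have v0: "AE x in lebesgue. v x = u x + 0" by simp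
  note r = rep_const_class[OF u(1) v0, folded v(1)]
  obtain c where c: "AE x in lborel. rep U x = u x + c" using r(2) by blast
  have "AE x in lebesgue. v x = rep U x + (- c)"
    using AE_completion[OF c] u(2) by eventually_elim simp
  from const_class_eq[OF this] have U: "U = const_class (rep U)" by (rule trans[OF v(1)])
  have cc: "\<exists>c. AE x in lebesgue. u x = rep U x + c" if "u \<in> U" for u
  proof -
    have "u \<in> const_class (rep U)" by (subst U[symmetric]) (rule that)
    then show ?thesis by (auto simp: const_class_def)
  qed
  have N: "Lp_norm lebesgue p (weak_grad w) = Lp_norm lborel p g" if w: "w \<in> U" for w
  proof -
    obtain b where b: "AE x in lebesgue. w x = rep U x + b" using cc[OF w] by blast
    have "AE x in lebesgue. rep U x + b = w x" using b by eventually_elim simp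
    from weak_grad_AE_eq(3)[OF wgrad_shift[OF r(3)] this] show ?thesis .
  qed
  have "AE x in lebesgue. u x = v x" using u(2) by eventually_elim simp
  then have "Lp_norm lebesgue p (weak_grad v) = Lp_norm lborel p g" by (rule weak_grad_AE_eq(3)[OF u(1)])
  then have "Lp_norm lborel p g < \<infinity>" using v(3) by (simp add: Lp_space_def)
  then obtain M where M: "Lp_norm lborel p g = ennreal M" "0 \<le> M" by (cases "Lp_norm lborel p g") auto
  have "(SOME u. u \<in> U) \<in> U" using r(1) by (rule someI[of "\<lambda>u. u \<in> U"])
  then have "Wdot_norm p U = ennreal M" unfolding Wdot_norm_def using N M by simp
  then have "rep_gradient p U g M"
    unfolding rep_gradient_def using r(3) U M N cc by (intro conjI) auto
  with that show ?thesis by blast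
qed

text \<open>The whole space has infinite measure, so a nonzero constant has infinite L^Q norm for
  finite Q. This is the uniqueness part of the embedding.\<close>

lemma finite_Lp_diff_const_eq_0:
  fixes u v :: "'a::euclidean_space \<Rightarrow> real"
  assumes Q: "1 \<le> Q" and u: "u \<in> Lp_space lebesgue (ennreal Q)" and v: "v \<in> Lp_space lebesgue (ennreal Q)"
    and c: "AE x in lebesgue. v x = u x + c"
  shows "c = 0"
proof (rule ccontr)
  assume "c \<noteq> 0"
  obtain A B where AB: "Lp_norm lebesgue (ennreal Q) u = ennreal A" "Lp_norm lebesgue (ennreal Q) v = ennreal B" "0 \<le> A"
    using u v unfolding Lp_space_def
    by (cases "Lp_norm lebesgue (ennreal Q) u"; cases "Lp_norm lebesgue (ennreal Q) v") auto
  define N where "N = max A B"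
  have N: "0 \<le> N" "Lp_norm lebesgue (ennreal Q) u \<le> ennreal N" "Lp_norm lebesgue (ennreal Q) v \<le> ennreal N"
    unfolding AB(1,2) N_def using AB(3) by (auto intro!: ennreal_leI)
  have "Lp_norm lebesgue (ennreal Q) (\<lambda>x. v x - u x) \<le> ennreal (2 * N)"
    by (rule Lp_norm_diff_le) (use Q u v N in \<open>auto simp: Lp_space_def\<close>)
  then have "(\<integral>\<^sup>+x. ennreal (norm (v x - u x) powr Q) \<partial>lebesgue) \<le> ennreal ((2 * N) powr Q)"
    using Q N by (subst (asm) Lp_norm_finite_le) auto
  also have "(\<integral>\<^sup>+x. ennreal (norm (v x - u x) powr Q) \<partial>lebesgue) = (\<integral>\<^sup>+(x::'a). ennreal (\<bar>c\<bar> powr Q) \<partial>lebesgue)"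
    by (rule nn_integral_cong_AE) (use c in eventually_elim, simp)
  also have "\<dots> = \<infinity>"
    using \<open>c \<noteq> 0\<close> by (simp add: nn_integral_completion ennreal_mult_eq_top_iff)
  finally show False by (simp add: top_unique)
qed

section \<open>The two linear maps\<close>

context mollifier
begin

text \<open>A relation rather than a function, since the limit used for p < d has to be shown to
  exist. Both alternatives are linear in u and follow u when a constant is added.\<close>

definition is_anchor :: "ennreal \<Rightarrow> ('a \<Rightarrow> real) \<Rightarrow> real \<Rightarrow> bool" where
  "is_anchor p u k \<longleftrightarrow> (if p < of_nat DIM('a) then (\<lambda>n. avg (real n) u 0) \<longlonglongrightarrow> k else avg 1 u 0 = k)"

definition anchor :: "ennreal \<Rightarrow> ('a \<Rightarrow> real) \<Rightarrow> real" where
  "anchor p u = (THE k. is_anchor p u k)"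

lemma anchor_eq: "is_anchor p u k \<Longrightarrow> anchor p u = k"
  unfolding anchor_def by (rule the_equality) (auto simp: is_anchor_def split: if_splits intro: LIMSEQ_unique)

definition smooth_part :: "ennreal \<Rightarrow> ('a \<Rightarrow> real) set \<Rightarrow> 'a \<Rightarrow> real" where
  "smooth_part p U x = avg 1 (rep U) x - anchor p (rep U)"

definition rough_part :: "('a \<Rightarrow> real) set \<Rightarrow> 'a \<Rightarrow> real" where
  "rough_part U x = rep U x - avg 1 (rep U) x"

lemma avg_AE_shift:
  fixes u v :: "'a \<Rightarrow> real"
  assumes l: "loc_int u" "loc_int v" and ae: "AE x in lborel. v x = u x + c" and s: "s \<noteq> 0"
  shows "avg s v x = avg s u x + c"
proof -
  note [measurable] = loc_int_measurable[OF l(1)] loc_int_measurable[OF l(2)]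
  have "avg s v x = avg s (\<lambda>x. u x + c) x" by (rule avg_cong_AE[OF _ _ ae s]) measurable
  then show ?thesis by (simp add: avg_shift[OF l(1)])
qed

lemma is_anchor_shift:
  assumes l: "loc_int u" "loc_int v" and ae: "AE x in lborel. v x = u x + c" and k: "is_anchor p u k"
  shows "is_anchor p v (k + c)"
proof (cases "p < of_nat DIM('a)")
  case True
  have "(\<lambda>n. avg (real n) u 0 + c) \<longlonglongrightarrow> k + c" using k True by (intro tendsto_intros) (simp add: is_anchor_def)
  \<comment> \<open>The index n = 0 is skipped: \<open>avg 0\<close> evaluates at a point, which
    almost everywhere equality does not control.\<close>
  then have "(\<lambda>n. avg (real n) v 0) \<longlonglongrightarrow> k + c"
    by (rule Lim_transform_eventually)
       (use avg_AE_shift[OF l ae] in \<open>auto intro!: eventually_sequentiallyI[of 1]\<close>)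
  then show ?thesis using True by (simp add: is_anchor_def)
next
  case False
  then show ?thesis using k avg_AE_shift[OF l ae, of 1] by (simp add: is_anchor_def)
qed

lemma is_anchor_add:
  assumes l: "loc_int u" "loc_int v" and "is_anchor p u k" "is_anchor p v m"
  shows "is_anchor p (\<lambda>x. a * u x + b * v x) (a * k + b * m)"
  using assms(3,4) avg_add[OF l, of _ a b] by (auto simp: is_anchor_def intro!: tendsto_intros)

lemma subcriticalI:
  assumes "1 \<le> p" "p < of_nat DIM('a)"
  obtains P where "p = ennreal P" "subcritical \<phi> R P"
proof -
  have "p \<noteq> \<infinity>" using assms(2) by auto
  with assms(1) obtain P where P: "p = ennreal P" "1 \<le> P" by (metis Lp_exponent_cases)
  then have "P < DIM('a)" using assms(2) by (simp add: ennreal_of_nat_eq_real_of_nat ennreal_less_iff)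
  then have "subcritical \<phi> R P" using P by unfold_locales auto
  with P that show ?thesis by blast
qed

lemma is_anchor_anchor:
  assumes w: "wgrad u g" and p: "1 \<le> p" and N: "0 \<le> N" "Lp_norm lborel p g \<le> ennreal N"
  shows "is_anchor p u (anchor p u)"
proof -
  have "\<exists>k. is_anchor p u k"
  proof (cases "p < of_nat DIM('a)")
    case True
    obtain P where PP: "p = ennreal P" "subcritical \<phi> R P" by (rule subcriticalI[OF p True])
    interpret subcritical \<phi> R P by (rule PP)
    from ex_weak_avg_limit[OF w N[unfolded PP(1)]] True show ?thesis by (simp add: is_anchor_def)
  qed (auto simp: is_anchor_def)
  then obtain k where "is_anchor p u k" ..
  then show ?thesis using anchor_eq by simp
qed

text \<open>The representative of the combination is the combination of the representatives plus
  some constant e, almost everywhere. Average and anchor both shift by e, so it cancels: everywhere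
  in the smooth part, which contains only averages, but just almost everywhere in the rough part,
  which contains values of the representative.\<close>

lemma Wdot_combination:
  assumes p: "1 \<le> p" and u: "const_class u \<in> Wdot p" and v: "const_class v \<in> Wdot p"
  shows "smooth_part p (const_class (\<lambda>y. a * u y + b * v y)) x
      = a * smooth_part p (const_class u) x + b * smooth_part p (const_class v) x" (is ?A)
    and "AE x in lebesgue. rough_part (const_class (\<lambda>y. a * u y + b * v y)) x
      = a * rough_part (const_class u) x + b * rough_part (const_class v) x" (is ?B)
proof -
  obtain g M where "rep_gradient p (const_class u) g M" by (rule ex_rep_gradient[OF u])
  note g = rep_gradientD[OF this]
  obtain h N where "rep_gradient p (const_class v) h N" by (rule ex_rep_gradient[OF v])
  note h = rep_gradientD[OF this]
  \<comment> \<open>The members of a class are measurable and make u measurable, so u lies in its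
    own class once that is nonempty; \<open>rep\<close> provides the member.\<close>
  have "u \<in> const_class u" "v \<in> const_class v" if "s \<in> const_class u" "t \<in> const_class v" for s t
    using that by (auto intro: const_class_self const_class_measurable)
  moreover have "rep (const_class u) \<in> const_class u" "rep (const_class v) \<in> const_class v"
    using const_class_self[OF has_weak_gradient_measurable(1)[OF wgrad_imp_has_weak_gradient[OF g(1)]]]
      const_class_self[OF has_weak_gradient_measurable(1)[OF wgrad_imp_has_weak_gradient[OF h(1)]]]
    unfolding g(2)[symmetric] h(2)[symmetric] .
  ultimately have uv: "u \<in> const_class u" "v \<in> const_class v" by blast+
  define ru where "ru = rep (const_class u)"
  define rv where "rv = rep (const_class v)"
  define rw where "rw = rep (const_class (\<lambda>y. a * u y + b * v y))"
  define w where "w x = a * ru x + b * rv x" for x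
  note g = g[folded ru_def] and h = h[folded rv_def]
  obtain c d where "AE x in lebesgue. u x = ru x + c" "AE x in lebesgue. v x = rv x + d"
    using g(8)[OF uv(1)] h(8)[OF uv(2)] by blast
  then have "AE x in lebesgue. a * u x + b * v x = w x + (a * c + b * d)"
    by eventually_elim (simp add: w_def algebra_simps)
  note r = rep_const_class[OF wgrad_add[OF g(1) h(1), of a b, folded w_def] this, folded rw_def]
  obtain e where e: "AE x in lborel. rw x = w x + e" using r(2) by blast
  have l: "loc_int ru" "loc_int rv" "loc_int w" "loc_int rw"
    using g(1) h(1) r(3) wgrad_add[OF g(1) h(1), of a b, folded w_def] by (auto simp: wgrad_def)
  have aw: "avg 1 w x = a * avg 1 ru x + b * avg 1 rv x" for x
    unfolding w_def using avg_add[OF l(1,2), of 1 a b x] by simp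
  have arw: "avg 1 rw x = avg 1 w x + e" for x by (rule avg_AE_shift[OF l(3,4) e]) simp
  have "is_anchor p w (a * anchor p ru + b * anchor p rv)"
    unfolding w_def by (intro is_anchor_add l is_anchor_anchor[OF g(1) p g(3,5)] is_anchor_anchor[OF h(1) p h(3,5)])
  from anchor_eq[OF is_anchor_shift[OF l(3,4) e this]]
  have k: "anchor p rw = a * anchor p ru + b * anchor p rv + e" .
  show ?A unfolding smooth_part_def ru_def[symmetric] rv_def[symmetric] rw_def[symmetric] arw aw k
    by (simp add: algebra_simps)
  show ?B
    unfolding rough_part_def ru_def[symmetric] rv_def[symmetric] rw_def[symmetric] arw aw
    using AE_completion[OF e] by eventually_elim (simp add: w_def algebra_simps)
qed

lemma linear_parts:
  assumes "1 \<le> p"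
  shows "linear_Wdot p (smooth_part p)" "linear_Wdot_AE p rough_part"
  using Wdot_combination[OF assms] by (auto simp: linear_Wdot_def linear_Wdot_AE_def)

lemma wgrad_smooth_part:
  "wgrad (rep U) g \<Longrightarrow> wgrad (smooth_part p U) (avg 1 g)"
  using wgrad_shift[OF wgrad_avg[of "rep U" g 1], of "- anchor p (rep U)"] by (simp add: smooth_part_def[abs_def])

lemma wgrad_rough_part:
  assumes "wgrad (rep U) g"
  shows "wgrad (rough_part U) (\<lambda>x. g x - avg 1 g x)"
  using wgrad_add[OF assms wgrad_avg[OF assms, of 1], of 1 "-1"] by (simp add: rough_part_def[abs_def])

lemma weak_grad_wgrad:
  assumes "wgrad u g"
  shows "weak_grad u \<in> borel_measurable lebesgue" "Lp_norm lebesgue p (weak_grad u) = Lp_norm lborel p g"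
    "has_weak_gradient u g"
  using weak_grad_AE_eq[OF assms, of u] by auto

text \<open>At scale 1 the factor s^(-d/p) equals 1 for every p, which gives the L^\<infinity> bound
  with constant exactly 1. The factor 2 comes from the triangle inequality for g minus
  \<open>avg 1 g\<close>.\<close>

lemma parts_bounds:
  assumes w: "wgrad (rep U) g" and p: "1 \<le> p"
  shows "Lp_norm lebesgue p (weak_grad (smooth_part p U)) \<le> Lp_norm lborel p g"
    and "Lp_norm lebesgue \<infinity> (weak_grad (smooth_part p U)) \<le> Lp_norm lborel p g"
    and "Lp_norm lebesgue p (rough_part U) \<le> ennreal R * Lp_norm lborel p g"
    and "Lp_norm lebesgue p (weak_grad (rough_part U)) \<le> ennreal 2 * Lp_norm lborel p g"
proof -
  have l: "loc_int (rep U)" "loc_int g" using w by (auto simp: wgrad_def)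
  have la: "loc_int (avg 1 g)" by (intro loc_int_continuous avg_continuous l) simp
  note [measurable] = loc_int_measurable[OF l(2)] loc_int_measurable[OF la]
  have A: "Lp_norm lborel p (avg 1 g) \<le> Lp_norm lborel p g" by (rule avg_Lp[OF l(2) _ p]) simp
  then show "Lp_norm lebesgue p (weak_grad (smooth_part p U)) \<le> Lp_norm lborel p g"
    by (simp add: weak_grad_wgrad(2)[OF wgrad_smooth_part[OF w]])
  have rm: "rough_part U \<in> borel_measurable borel"
    using wgrad_rough_part[OF w] by (auto simp: wgrad_def dest: loc_int_measurable)
  show "Lp_norm lebesgue p (rough_part U) \<le> ennreal R * Lp_norm lborel p g"
    using diff_avg_Lp[OF w _ p, of 1] by (simp add: Lp_norm_lebesgue[OF rm]) (simp add: rough_part_def[abs_def])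
  show "Lp_norm lebesgue \<infinity> (weak_grad (smooth_part p U)) \<le> Lp_norm lborel p g"
  proof (cases "Lp_norm lborel p g")
    case (real N)
    then have "norm (avg 1 g x) \<le> N" for x using avg_pointwise[OF _ _ p, of g 1 N x] by simp
    then show ?thesis unfolding weak_grad_wgrad(2)[OF wgrad_smooth_part[OF w]] real(2)
      by (subst Lp_norm_infinity_le) (auto intro: ennreal_leI)
  qed simp
  show "Lp_norm lebesgue p (weak_grad (rough_part U)) \<le> ennreal 2 * Lp_norm lborel p g"
  proof (cases "Lp_norm lborel p g")
    case (real N)
    have "Lp_norm lborel p (\<lambda>x. g x - avg 1 g x) \<le> ennreal (2 * N)"
      by (rule Lp_norm_diff_le[OF p]) (use real A in auto)
    then show ?thesis unfolding weak_grad_wgrad(2)[OF wgrad_rough_part[OF w]] real(2) using real by (simp add: ennreal_mult)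
  qed (simp add: ennreal_mult_top)
qed

text \<open>R bounds the function and 2 its gradient; neither depends on p.\<close>

lemma W1p_norm_rough_part:
  assumes w: "wgrad (rep U) g" and p: "1 \<le> p"
  shows "W1p_norm p (rough_part U) \<le> ennreal (R + 2) * Lp_norm lborel p g"
  unfolding W1p_norm_def using add_mono[OF parts_bounds(3,4)[OF w p]] R_pos
  by (simp add: ennreal_plus distrib_right)

lemma smooth_part_C_inf:
  assumes w: "wgrad (rep U) g"
  shows "smooth_part p U \<in> C_inf"
proof -
  have "Ck n (\<lambda>x. avg 1 (rep U) x + (- anchor p (rep U)))" for n
    using w by (intro Ck_add Ck_const avg_Ck) (auto simp: wgrad_def)
  then show ?thesis by (simp add: C_inf_def smooth_part_def[abs_def])
qed

lemma rough_part_W1p: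
  assumes w: "wgrad (rep U) g" and p: "1 \<le> p" and N: "Lp_norm lborel p g < \<infinity>"
  shows "rough_part U \<in> W1p p"
proof -
  have rm: "rough_part U \<in> borel_measurable lebesgue"
    using has_weak_gradient_measurable(1)[OF weak_grad_wgrad(3)[OF wgrad_rough_part[OF w]]] .
  have "ennreal R * Lp_norm lborel p g < \<infinity>" "ennreal 2 * Lp_norm lborel p g < \<infinity>"
    using N by (simp_all add: ennreal_mult_less_top)
  then have "Lp_norm lebesgue p (rough_part U) < \<infinity>" "Lp_norm lebesgue p (weak_grad (rough_part U)) < \<infinity>"
    using parts_bounds(3,4)[OF w p] by (auto intro: le_less_trans)
  then show ?thesis
    using rm weak_grad_wgrad[OF wgrad_rough_part[OF w]] by (auto simp: W1p_def Lp_space_def)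
qed

text \<open>The two averages cancel, so the parts add up to the representative minus its
  anchor.\<close>

lemma parts_sum:
  assumes "U = const_class (rep U)"
  shows "U = const_class (\<lambda>x. smooth_part p U x + rough_part U x)"
proof -
  have "AE x in lebesgue. smooth_part p U x + rough_part U x = rep U x + (- anchor p (rep U))"
    by (simp add: smooth_part_def rough_part_def)
  from const_class_eq[OF this] assms show ?thesis by (rule trans[OF _ sym, rotated])
qed

lemma smooth_part_gradient:
  assumes w: "wgrad (rep U) g" and p: "1 \<le> p" and N: "0 \<le> N" "Lp_norm lborel p g \<le> ennreal N"
  shows "c1_grad (smooth_part p U) (avg 1 g)" "Lp_norm lborel p (avg 1 g) \<le> ennreal N" "norm (avg 1 g x) \<le> N"
proof -
  have l: "loc_int g" using w by (auto simp: wgrad_def)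
  show "c1_grad (smooth_part p U) (avg 1 g)"
    using c1_grad_diff_const[OF c1_grad_avg[OF w, of 1], of "anchor p (rep U)"] by (simp add: smooth_part_def[abs_def])
  show "Lp_norm lborel p (avg 1 g) \<le> ennreal N" by (rule order_trans[OF avg_Lp[OF l _ p] N(2)]) simp
  show "norm (avg 1 g x) \<le> N"
    using avg_pointwise[OF loc_int_measurable[OF l] _ p N, of 1 x] by simp
qed

lemma smooth_part_at_0:
  assumes "\<not> p < of_nat DIM('a)"
  shows "smooth_part p U 0 = 0"
  using anchor_eq[of p "rep U" "avg 1 (rep U) 0"] assms by (simp add: smooth_part_def is_anchor_def)

lemma decay_lt_1:
  assumes "1 \<le> p" "of_nat DIM('a) < p"
  shows "decay p < 1"
  using assms(1)
proof (cases rule: Lp_exponent_cases)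
  case 1
  then show ?thesis by (simp add: decay_def)
next
  case (2 P)
  then show ?thesis using assms(2) by (simp add: decay_def ennreal_of_nat_eq_real_of_nat ennreal_less_iff)
qed

lemma decay_eq_1: "decay (of_nat DIM('a)) = 1"
proof -
  have "(1::real) \<le> DIM('a)" by (simp add: Suc_le_eq)
  then show ?thesis by (simp add: decay_def ennreal_of_nat_eq_real_of_nat)
qed

end

text \<open>This includes p = \<infinity>, where the conjugate exponent is 1 and both sides equal
  1.\<close>

lemma conj_exp_inverse:
  assumes "1 < p"
  shows "enn2real (inverse (conj_exp p)) = 1 - rexp p"
proof (cases p)
  case (real P)
  then have "1 < P" using assms by (simp add: ennreal_1[symmetric] ennreal_less_iff del: ennreal_1)
  moreover have "1 - inverse (ennreal P) = ennreal (1 - 1 / P)"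
    using \<open>1 < P\<close> by (simp add: inverse_ennreal inverse_eq_divide ennreal_1[symmetric] ennreal_minus del: ennreal_1)
  ultimately show ?thesis unfolding conj_exp_def real(2) by (simp add: inverse_ennreal)
qed (simp add: conj_exp_def)

lemma sobolev_conj_eq:
  assumes "1 \<le> P" "P < real d"
  shows "sobolev_conj d (ennreal P) = ennreal (P * real d / (real d - P))"
proof -
  have "inverse (ennreal P) - inverse (of_nat d) = ennreal (1 / P - 1 / real d)"
    using assms by (simp add: inverse_ennreal ennreal_of_nat_eq_real_of_nat ennreal_minus inverse_eq_divide)
  moreover have "0 < 1 / P - 1 / real d" "1 / (1 / P - 1 / real d) = P * real d / (real d - P)"
    using assms by (auto simp: field_simps)
  ultimately show ?thesis unfolding sobolev_conj_def by (simp add: inverse_ennreal inverse_eq_divide)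
qed

section \<open>The three regimes of p\<close>

context mollifier
begin

lemma smooth_part_growth_supercritical:
  assumes U: "U \<in> Wdot p" and p: "of_nat DIM('a) < p"
  shows "ennreal \<bar>smooth_part p U x\<bar> \<le> ennreal (2 * R + 2 * R / (1 - decay p) + 1) * Wdot_norm p U
    * ennreal (norm x powr enn2real (inverse (conj_exp p)))"
proof -
  \<comment> \<open>With d \<ge> 1, p > d puts p strictly above 1, as the formula for the conjugate
    exponent requires.\<close>
  have "of_nat 1 \<le> (of_nat DIM('a) :: ennreal)" by (rule of_nat_mono) (simp add: Suc_le_eq)
  then have "1 \<le> (of_nat DIM('a) :: ennreal)" by simp
  from le_less_trans[OF this p] have p1: "1 < p" and p1': "1 \<le> p" by auto
  obtain g N where "rep_gradient p U g N" by (rule ex_rep_gradient[OF U])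
  note g = rep_gradientD[OF this]
  note G = smooth_part_gradient[OF g(1) p1' g(3,5)]
  have d: "decay p < 1" using decay_lt_1[OF p1' p] .
  have "\<bar>smooth_part p U x\<bar> \<le> (2 * R + 2 * R / (1 - decay p) + 1) * N * norm x powr (1 - rexp p)"
    by (rule growth_supercritical[OF G(1) p1' G(2,3) smooth_part_at_0 d]) (use p in auto)
  moreover have "0 \<le> 2 * R + 2 * R / (1 - decay p) + 1" using R_pos d by simp
  ultimately show ?thesis
    unfolding g(6) conj_exp_inverse[OF p1] using g(3) by (simp only: ennreal_mult[symmetric] mult_nonneg_nonneg powr_ge_zero ennreal_leI)
qed

lemma smooth_part_growth_critical:
  assumes U: "U \<in> Wdot p" and p: "p = of_nat DIM('a)"
  shows "ennreal \<bar>smooth_part p U x\<bar> \<le> ennreal (6 * R + 2) * Wdot_norm p U * ennreal (ln (2 + norm x))"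
proof -
  have "of_nat 1 \<le> (of_nat DIM('a) :: ennreal)" by (rule of_nat_mono) (simp add: Suc_le_eq)
  then have p1: "1 \<le> p" unfolding p by simp
  obtain g N where "rep_gradient p U g N" by (rule ex_rep_gradient[OF U])
  note g = rep_gradientD[OF this]
  note G = smooth_part_gradient[OF g(1) p1 g(3,5)]
  have d: "decay p = 1" unfolding p by (rule decay_eq_1)
  have "\<bar>smooth_part p U x\<bar> \<le> (6 * R + 2) * N * ln (2 + norm x)"
    by (rule growth_critical[OF G(1) p1 G(2,3) smooth_part_at_0 d]) (use p in auto)
  moreover have "0 \<le> ln (2 + norm x)" by (intro ln_ge_zero) (use norm_ge_zero[of x] in linarith)
  moreover have "0 \<le> 6 * R + 2" using R_pos by simp
  ultimately show ?thesis
    unfolding g(6) using g(3) by (simp only: ennreal_mult[symmetric] mult_nonneg_nonneg powr_ge_zero ennreal_leI)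
qed

lemma smooth_part_tendsto_0:
  assumes U: "U \<in> Wdot p" and p: "1 \<le> p" "p < of_nat DIM('a)"
  shows "(smooth_part p U \<longlongrightarrow> 0) at_infinity"
proof -
  obtain g N where "rep_gradient p U g N" by (rule ex_rep_gradient[OF U])
  note g = rep_gradientD[OF this]
  obtain P where PP: "p = ennreal P" "subcritical \<phi> R P" by (rule subcriticalI[OF p])
  interpret subcritical \<phi> R P by (rule PP)
  have "is_anchor p (rep U) (anchor p (rep U))" by (rule is_anchor_anchor[OF g(1) p(1) g(3,5)])
  then have "(\<lambda>n. avg (real n) (rep U) 0) \<longlonglongrightarrow> anchor p (rep U)" using p(2) by (simp add: is_anchor_def)
  from avg_tendsto_0_at_infinity[OF g(1) g(3) g(5)[unfolded PP(1)] this]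
  show ?thesis by (simp add: smooth_part_def[abs_def])
qed

text \<open>The distinguished member is the representative minus the limit of its averages, to which
  \<open>sobolev_wgrad\<close> applies. Any other member in the same space differs from it by a
  constant almost everywhere, and that constant must be 0.\<close>

lemma sobolev_embedding:
  assumes p: "1 \<le> p" "p < of_nat DIM('a)"
  shows "\<exists>C>0. \<forall>U\<in>(Wdot p :: ('a \<Rightarrow> real) set set). \<exists>u0\<in>U. u0 \<in> Lp_space lebesgue (sobolev_conj DIM('a) p)
    \<and> (\<forall>v\<in>U. v \<in> Lp_space lebesgue (sobolev_conj DIM('a) p) \<longrightarrow> (AE x in lebesgue. v x = u0 x))
    \<and> Lp_norm lebesgue (sobolev_conj DIM('a) p) u0 \<le> ennreal C * Lp_norm lebesgue p (weak_grad u0)"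
proof -
  obtain P where PP: "p = ennreal P" "subcritical \<phi> R P" by (rule subcriticalI[OF p])
  interpret subcritical \<phi> R P by (rule PP)
  have sc: "sobolev_conj DIM('a) p = ennreal q"
    unfolding PP(1) q_def by (rule sobolev_conj_eq[OF P])
  have q1: "1 \<le> q" using q_ge P by linarith
  \<comment> \<open>\<open>strong_const\<close> is only known to be nonnegative; the summand 1 makes
    C positive.\<close>
  define C where "C = strong_const powr (1 / q) + 1"
  have C: "0 < C" by (simp add: C_def add_nonneg_pos)
  show ?thesis
  proof (intro exI[of _ C] conjI C ballI)
    fix U :: "('a \<Rightarrow> real) set" assume U: "U \<in> Wdot p"
    obtain g N where "rep_gradient p U g N" by (rule ex_rep_gradient[OF U])
    note g = rep_gradientD[OF this]
    define k where "k = anchor p (rep U)"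
    define u0 where "u0 x = rep U x - k" for x
    have u0m[measurable]: "u0 \<in> borel_measurable borel"
      unfolding u0_def[abs_def] using g(1) by (auto simp: wgrad_def dest: loc_int_measurable)
    have u0: "u0 \<in> U"
    proof -
      have "AE x in lebesgue. u0 x = rep U x + (- k)" by (simp add: u0_def)
      then show ?thesis by (subst g(2)) (auto simp: const_class_def measurable_completion)
    qed
    have "is_anchor p (rep U) k" unfolding k_def by (rule is_anchor_anchor[OF g(1) p(1) g(3,5)])
    then have "(\<lambda>n. avg (real n) (rep U) 0) \<longlonglongrightarrow> k" using p(2) by (simp add: is_anchor_def)
    from sobolev_wgrad[OF g(1) g(3) g(5)[unfolded PP(1)] this]
    have "(\<integral>\<^sup>+x. ennreal (norm (u0 x) powr q) \<partial>lborel) \<le> ennreal (strong_const * N powr q)"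
      by (simp add: u0_def)
    also have "strong_const * N powr q = (strong_const powr (1 / q) * N) powr q"
    proof -
      have "(strong_const powr (1 / q) * N) powr q = (strong_const powr (1 / q)) powr q * N powr q"
        by (rule powr_mult; use g(3) in simp)
      then show ?thesis using q1 strong_const_nonneg by (simp add: powr_powr)
    qed
    finally have "Lp_norm lborel (ennreal q) u0 \<le> ennreal (strong_const powr (1 / q) * N)"
      using q1 g(3) by (subst Lp_norm_finite_le) auto
    also have "\<dots> \<le> ennreal (C * N)" using g(3) by (intro ennreal_leI mult_right_mono) (auto simp: C_def)
    finally have L: "Lp_norm lebesgue (ennreal q) u0 \<le> ennreal C * Lp_norm lebesgue p (weak_grad u0)"
      using g(3) C by (simp add: Lp_norm_lebesgue g(7)[OF u0] ennreal_mult)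
    then have u0L: "u0 \<in> Lp_space lebesgue (ennreal q)"
      by (auto simp: Lp_space_def measurable_completion g(7)[OF u0] ennreal_mult_less_top intro: le_less_trans)
    show "\<exists>u0\<in>U. u0 \<in> Lp_space lebesgue (sobolev_conj DIM('a) p)
      \<and> (\<forall>v\<in>U. v \<in> Lp_space lebesgue (sobolev_conj DIM('a) p) \<longrightarrow> (AE x in lebesgue. v x = u0 x))
      \<and> Lp_norm lebesgue (sobolev_conj DIM('a) p) u0 \<le> ennreal C * Lp_norm lebesgue p (weak_grad u0)"
      unfolding sc
    proof (intro bexI[OF _ u0] conjI u0L L ballI impI)
      fix v assume v: "v \<in> U" "v \<in> Lp_space lebesgue (ennreal q)"
      obtain c where c: "AE x in lebesgue. v x = rep U x + c" using g(8)[OF v(1)] by blast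
      then have c': "AE x in lebesgue. v x = u0 x + (c + k)" by eventually_elim (simp add: u0_def)
      have "c + k = 0" by (rule finite_Lp_diff_const_eq_0[OF q1 u0L v(2) c'])
      with c' show "AE x in lebesgue. v x = u0 x" by simp
    qed
  qed
qed

end

theorem theorem3:
  shows "\<exists>C::real. C > 0 \<and> (\<forall>p::ennreal. 1 \<le> p \<longrightarrow>
    (\<exists>(Jinf :: (real ^ 'n \<Rightarrow> real) set \<Rightarrow> real ^ 'n \<Rightarrow> real)
      (J0 :: (real ^ 'n \<Rightarrow> real) set \<Rightarrow> real ^ 'n \<Rightarrow> real).
       linear_Wdot p Jinf \<and> linear_Wdot_AE p J0
     \<and> (\<forall>U\<in>Wdot p. Jinf U \<in> C_inf \<and> J0 U \<in> W1p p)
     \<and> (\<forall>U\<in>Wdot p. U = const_class (\<lambda>x. Jinf U x + J0 U x))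
     \<and> (\<forall>U\<in>Wdot p. \<forall>u\<in>U.
          Lp_norm lebesgue p (weak_grad (Jinf U)) \<le> Lp_norm lebesgue p (weak_grad u)
        \<and> Lp_norm lebesgue \<infinity> (weak_grad (Jinf U)) \<le> Lp_norm lebesgue p (weak_grad u)
        \<and> W1p_norm p (J0 U) \<le> ennreal C * Lp_norm lebesgue p (weak_grad u))
     \<and> (p < of_nat CARD('n) \<longrightarrow>
          (\<exists>C1::real. C1 > 0 \<and> (\<forall>U \<in> (Wdot p :: (real ^ 'n \<Rightarrow> real) set set). \<exists>u0\<in>U.
               u0 \<in> Lp_space lebesgue (sobolev_conj CARD('n) p)
             \<and> (\<forall>v\<in>U. v \<in> Lp_space lebesgue (sobolev_conj CARD('n) p)
                    \<longrightarrow> (AE x in lebesgue. v x = u0 x))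
             \<and> Lp_norm lebesgue (sobolev_conj CARD('n) p) u0
                 \<le> ennreal C1 * Lp_norm lebesgue p (weak_grad u0)))
        \<and> (\<forall>U\<in>Wdot p. (Jinf U \<longlongrightarrow> 0) at_infinity))
     \<and> (p > of_nat CARD('n) \<longrightarrow>
          (\<exists>C2::real. C2 > 0 \<and> (\<forall>U\<in>Wdot p. \<forall>x.
             ennreal \<bar>Jinf U x\<bar> \<le> ennreal C2 * Wdot_norm p U
                 * ennreal (norm x powr enn2real (inverse (conj_exp p))))))
     \<and> (p = of_nat CARD('n) \<longrightarrow>
          (\<exists>C3::real. C3 > 0 \<and> (\<forall>U\<in>Wdot p. \<forall>x.
             ennreal \<bar>Jinf U x\<bar> \<le> ennreal C3 * Wdot_norm p U
                 * ennreal (ln (2 + norm x)))))))"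
proof -
  \<comment> \<open>The density is chosen before p, so R, and with it the constant R + 2, depends on
    the dimension only.\<close>
  obtain \<phi> :: "real ^ 'n \<Rightarrow> real" and R where "mollifier \<phi> R" using ex_mollifier by blast
  then interpret mollifier \<phi> R .
  have dim: "DIM(real ^ 'n) = CARD('n)" by simp
  have basic: "smooth_part p U \<in> C_inf" "rough_part U \<in> W1p p"
    "U = const_class (\<lambda>x. smooth_part p U x + rough_part U x)"
    "u \<in> U \<Longrightarrow> Lp_norm lebesgue p (weak_grad (smooth_part p U)) \<le> Lp_norm lebesgue p (weak_grad u)"
    "u \<in> U \<Longrightarrow> Lp_norm lebesgue \<infinity> (weak_grad (smooth_part p U)) \<le> Lp_norm lebesgue p (weak_grad u)"
    "u \<in> U \<Longrightarrow> W1p_norm p (rough_part U) \<le> ennreal (R + 2) * Lp_norm lebesgue p (weak_grad u)"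
    if p: "1 \<le> p" and U: "U \<in> Wdot p" for p U u
  proof -
    obtain g N where "rep_gradient p U g N" by (rule ex_rep_gradient[OF U])
    note g = rep_gradientD[OF this]
    show "smooth_part p U \<in> C_inf" by (rule smooth_part_C_inf[OF g(1)])
    show "rough_part U \<in> W1p p" using rough_part_W1p[OF g(1) p] g(4) by simp
    show "U = const_class (\<lambda>x. smooth_part p U x + rough_part U x)" by (rule parts_sum[OF g(2)])
    assume "u \<in> U"
    then show "Lp_norm lebesgue p (weak_grad (smooth_part p U)) \<le> Lp_norm lebesgue p (weak_grad u)"
      "Lp_norm lebesgue \<infinity> (weak_grad (smooth_part p U)) \<le> Lp_norm lebesgue p (weak_grad u)"
      "W1p_norm p (rough_part U) \<le> ennreal (R + 2) * Lp_norm lebesgue p (weak_grad u)"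
      using parts_bounds(1,2)[OF g(1) p] W1p_norm_rough_part[OF g(1) p] g(4,7) by auto
  qed
  let "\<exists>C. C > 0 \<and> (\<forall>p. 1 \<le> p \<longrightarrow> (\<exists>Jinf J0. ?P C p Jinf J0))" = ?thesis
  have main: "?P (R + 2) p (smooth_part p) rough_part" if p: "1 \<le> p" for p
  proof (intro conjI ballI impI; (fact linear_parts[OF p] | (rule basic[OF p]; assumption))?)
    assume sub: "p < of_nat CARD('n)"
    note sub = p sub[folded dim]
    show "\<exists>C>0. \<forall>U\<in>(Wdot p :: (real ^ 'n \<Rightarrow> real) set set). \<exists>u0\<in>U. u0 \<in> Lp_space lebesgue (sobolev_conj CARD('n) p)
      \<and> (\<forall>v\<in>U. v \<in> Lp_space lebesgue (sobolev_conj CARD('n) p) \<longrightarrow> (AE x in lebesgue. v x = u0 x))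
      \<and> Lp_norm lebesgue (sobolev_conj CARD('n) p) u0 \<le> ennreal C * Lp_norm lebesgue p (weak_grad u0)"
      by (rule sobolev_embedding[OF sub, unfolded dim])
    show "(smooth_part p U \<longlongrightarrow> 0) at_infinity" if "U \<in> Wdot p" for U
      by (rule smooth_part_tendsto_0[OF that sub])
  next
    assume "p > of_nat CARD('n)"
    note super = this[folded dim]
    have "0 < 2 * R + 2 * R / (1 - decay p) + 1" using R_pos decay_lt_1[OF p super] by (simp add: add_pos_pos)
    then show "\<exists>C>0. \<forall>U\<in>Wdot p. \<forall>x. ennreal \<bar>smooth_part p U x\<bar> \<le> ennreal C * Wdot_norm p U
        * ennreal (norm x powr enn2real (inverse (conj_exp p)))"
      using smooth_part_growth_supercritical[OF _ super] by blast
  next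
    assume "p = of_nat CARD('n)"
    note crit = this[folded dim]
    have "0 < 6 * R + 2" using R_pos by simp
    then show "\<exists>C>0. \<forall>U\<in>Wdot p. \<forall>x. ennreal \<bar>smooth_part p U x\<bar> \<le> ennreal C * Wdot_norm p U * ennreal (ln (2 + norm x))"
      using smooth_part_growth_critical[OF _ crit] by blast
  qed
  show ?thesis
  proof (intro exI[of _ "R + 2"] conjI allI impI)
    show "0 < R + 2" using R_pos by simp
    fix p :: ennreal assume p: "1 \<le> p"
    show "\<exists>Jinf J0. ?P (R + 2) p Jinf J0"
      by (rule exI[of _ "smooth_part p"], rule exI[of _ rough_part], rule main[OF p])
  qed
qed

end
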